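(* Let $V(x)=-|x|$ on $\mathbb{R}$ and let $\mu^1$ and $\mu^2$ be the Wigner measures associated with the solutions of $i\varepsilon\partial_t\Psi_t^\varepsilon=-\frac{\varepsilon^2}{2}\partial_x^2\Psi_t^\varepsilon+V\Psi_t^\varepsilon$ with initial data respectively $$\Psi_0^{\varepsilon,1}(x)=\frac{1}{\varepsilon^{1/4}}\Psi^1\left(\frac{x}{\sqrt\varepsilon}\right)\quad\text{and}\quad\Psi_0^{\varepsilon,2}(x)=\frac{1}{\varepsilon^{1/4}}\Psi^2\left(\frac{x}{\sqrt\varepsilon}\right)e^{-i\varepsilon^{\beta-1}x},$$ with $0<\beta<\frac1{10}$, $\Psi^1,\Psi^2\in C_0^\infty(\mathbb{R})$, $\|\Psi^1\|_{L^2(\mathbb{R})}=\|\Psi^2\|_{L^2(\mathbb{R})}=1$, and $\Psi^1$ supported on $x>0$. Then, for $t\le0$, $$\mu_t^1(x,\xi)=\mu_t^2(x,\xi)=\delta\left(x-\tfrac{t^2}{2}\right)\otimes\delta(\xi-t),$$ whereas, for $t>0$, $$\mu_t^1(x,\xi)=\delta\left(x-\tfrac{t^2}{2}\right)\otimes\delta(\xi-t)\quad\text{and}\quad\mu_t^2(x,\xi)=\delta\left(x+\tfrac{t^2}{2}\right)\otimes\delta(\xi+t).$$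
   Context: For $\Psi\in L^2(\mathbb{R})$, $W^\varepsilon\Psi(x,\xi)=\frac{1}{2\pi\varepsilon}\int_{\mathbb{R}}e^{\frac i\varepsilon y\xi}\Psi(x-\frac y2)\overline{\Psi(x+\frac y2)}\,dy$. The Wigner (semiclassical) measure $\mu_t$ at time $t$ of a family $(\Psi^\varepsilon)$ of solutions is the limit: $\langle W^{\varepsilon}\Psi_t^{\varepsilon},a\rangle\to\int a\,d\mu_t$ as $\varepsilon\to0$ (along a subsequence) for all $a\in C_0^\infty(\mathbb{R}^2)$. The operator $-\frac{\varepsilon^2}{2}\partial_x^2-|x|$ is essentially self-adjoint, so solutions are defined for all $t\in\mathbb{R}$. *)

theory Defs
  imports "HOL-Probability.Probability"
begin

text \<open>
  The class $C^k$. On a Euclidean space, $f$ is $C^{k+1}$ iff it is differentiable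
  and all its directional derivatives are $C^k$.
\<close>

primrec Ck :: "nat \<Rightarrow> ('a::euclidean_space \<Rightarrow> 'b::real_normed_vector) \<Rightarrow> bool" where
  "Ck 0 f \<longleftrightarrow> continuous_on UNIV f"
| "Ck (Suc k) f \<longleftrightarrow> (\<forall>x. f differentiable (at x)) \<and>
     (\<forall>v. Ck k (\<lambda>x. frechet_derivative f (at x) v))"

definition supp :: "('a::topological_space \<Rightarrow> 'b::zero) \<Rightarrow> 'a set" where
  "supp f = closure {x. f x \<noteq> 0}"

definition test_function :: "('a::euclidean_space \<Rightarrow> complex) \<Rightarrow> bool" where
  "test_function f \<longleftrightarrow> (\<forall>k. Ck k f) \<and> compact (supp f)"

text \<open>
  Elements of $L^2(\mathbb{R})$ are represented by Borel functions, to be identified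
  when equal almost everywhere. The number \<open>l2norm f\<close> is meaningful only for
  square-integrable \<open>f\<close>.
\<close>

definition L2 :: "(real \<Rightarrow> complex) set" where
  "L2 = {f. f \<in> borel_measurable lborel \<and> integrable lborel (\<lambda>x. (norm (f x))\<^sup>2)}"

definition l2norm :: "(real \<Rightarrow> complex) \<Rightarrow> real" where
  "l2norm f = sqrt (LINT x|lborel. (norm (f x))\<^sup>2)"

definition schroedinger_op ::
    "real \<Rightarrow> (real \<Rightarrow> real) \<Rightarrow> (real \<Rightarrow> complex) \<Rightarrow> real \<Rightarrow> complex" where
  "schroedinger_op \<epsilon> V \<phi> x =
     - of_real (\<epsilon>\<^sup>2 / 2) * vector_derivative (\<lambda>y. vector_derivative \<phi> (at y)) (at x)
     + of_real (V x) * \<phi> x"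

text \<open>
  The graph of the closure in $L^2(\mathbb{R})$ of the Schroedinger operator with
  domain $C_0^\infty(\mathbb{R})$. When that operator is essentially self-adjoint, as
  for $V(x) = -|x|$, this closure is its self-adjoint extension.
\<close>

definition hamiltonian ::
    "real \<Rightarrow> (real \<Rightarrow> real) \<Rightarrow> ((real \<Rightarrow> complex) \<times> (real \<Rightarrow> complex)) set" where
  "hamiltonian \<epsilon> V = {(u, v). u \<in> L2 \<and> v \<in> L2 \<and>
     (\<exists>\<phi> :: nat \<Rightarrow> real \<Rightarrow> complex. (\<forall>n. test_function (\<phi> n)) \<and>
        (\<lambda>n. l2norm (\<lambda>x. \<phi> n x - u x)) \<longlonglongrightarrow> 0 \<and>
        (\<lambda>n. l2norm (\<lambda>x. schroedinger_op \<epsilon> V (\<phi> n) x - v x)) \<longlonglongrightarrow> 0)}"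

text \<open>
  \<open>\<psi>\<close> solves $i \varepsilon \partial_t \psi = - \frac{\varepsilon^2}{2} \partial_x^2 \psi + V \psi$
  on $\mathbb{R}$, $\psi_{t=0} = \psi_0$, the time derivative \<open>\<psi>'\<close> being taken in
  $L^2(\mathbb{R})$. For initial data in the domain of the self-adjoint Hamiltonian
  this is the orbit of the unitary group it generates.
\<close>

definition schroedinger_solution ::
    "real \<Rightarrow> (real \<Rightarrow> real) \<Rightarrow> (real \<Rightarrow> complex) \<Rightarrow> (real \<Rightarrow> real \<Rightarrow> complex) \<Rightarrow> bool" where
  "schroedinger_solution \<epsilon> V \<psi>\<^sub>0 \<psi> \<longleftrightarrow>
     (AE x in lborel. \<psi> 0 x = \<psi>\<^sub>0 x) \<and>
     (\<exists>\<psi>' :: real \<Rightarrow> real \<Rightarrow> complex. \<forall>t.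
        \<psi> t \<in> L2 \<and> \<psi>' t \<in> L2 \<and>
        ((\<lambda>h. l2norm (\<lambda>x. (\<psi> (t + h) x - \<psi> t x) / of_real h - \<psi>' t x)) \<longlongrightarrow> 0) (at 0) \<and>
        (\<psi> t, \<lambda>x. \<i> * of_real \<epsilon> * \<psi>' t x) \<in> hamiltonian \<epsilon> V)"

definition wigner :: "real \<Rightarrow> (real \<Rightarrow> complex) \<Rightarrow> real \<Rightarrow> real \<Rightarrow> complex" where
  "wigner \<epsilon> \<Psi> x \<xi> = of_real (1 / (2 * pi * \<epsilon>)) *
     (LINT y|lborel. exp (\<i> / of_real \<epsilon> * of_real (y * \<xi>)) * \<Psi> (x - y / 2) * cnj (\<Psi> (x + y / 2)))"

definition wigner_pairing ::
    "real \<Rightarrow> (real \<Rightarrow> complex) \<Rightarrow> (real \<times> real \<Rightarrow> complex) \<Rightarrow> complex" where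
  "wigner_pairing \<epsilon> \<Psi> a = (LINT p|lborel. wigner \<epsilon> \<Psi> (fst p) (snd p) * a p)"

text \<open>
  The set of all Wigner measures of a family \<open>\<Phi> \<epsilon>\<close>, $\varepsilon > 0$: the locally
  finite Borel measures that are limits of the Wigner transforms along some sequence
  $\varepsilon_n \to 0^+$. Saying that the Wigner measure of the family is \<open>\<mu>\<close> means
  that this set is \<open>{\<mu>}\<close>.
\<close>

definition wigner_measures :: "(real \<Rightarrow> real \<Rightarrow> complex) \<Rightarrow> (real \<times> real) measure set" where
  "wigner_measures \<Phi> = {\<mu>. sets \<mu> = sets borel \<and> (\<forall>K. compact K \<longrightarrow> emeasure \<mu> K < \<infinity>) \<and>
     (\<exists>\<epsilon> :: nat \<Rightarrow> real. (\<forall>n. \<epsilon> n > 0) \<and> \<epsilon> \<longlonglongrightarrow> 0 \<and>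
        (\<forall>a. test_function a \<longrightarrow>
           (\<lambda>n. wigner_pairing (\<epsilon> n) (\<Phi> (\<epsilon> n)) a) \<longlonglongrightarrow> (LINT p|\<mu>. a p)))}"

end

theory Submission
  imports Defs
begin

text \<open>
  Let \<open>(q, p)\<close> be the classical trajectory from \<open>(0, p0)\<close>, \<open>p0 \<ge> 0\<close>, which stays in \<open>x > 0\<close> for \<open>t > 0\<close>; time
  reversal and parity reduce all cases to this one. There the potential is the linear one, whose flow maps
  Weyl operators $\psi \mapsto e^{ikx}\psi(x - \varepsilon y)$ to Weyl operators. For the solution \<open>\<psi>\<close> and a transported
  Weyl operator \<open>U\<close> the function \<open>w = U \<psi> - \<psi>\<close> solves the Schroedinger equation up to a bounded residual
  supported in \<open>x < 0\<close>; hence \<open>\<parallel>w\<parallel>\<close> grows at most like \<open>2 \<integral> \<bar>y\<bar> M\<close>, where \<open>M\<close> is the norm of \<open>\<psi>\<close> on \<open>x < 0\<close>. Smallness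
  of \<open>w\<close> for \<open>y = 0\<close> and all \<open>k\<close> means concentration of \<open>\<psi>\<close> near \<open>q\<close>, so it bounds \<open>M\<close> in turn. With \<open>F'' = M\<close> this
  closes to \<open>F'' \<le> (a \<surd>\<epsilon> + c F) / q\<close>, \<open>c < 3\<close>, and a comparison function of cubic growth gives \<open>F \<rightarrow> 0\<close>: if
  \<open>p0 = \<epsilon> powr \<beta>\<close> because the packet leaves the singularity fast enough, if \<open>p0 = 0\<close> because the support condition makes \<open>M = O(t\<^sup>2)\<close>
  uniformly in \<open>\<epsilon>\<close>. Finally, asymptotic invariance under translations by \<open>\<epsilon> v\<close> up to the phase $e^{ipv}$ and concentration of the
  mass at \<open>q\<close> make the Wigner transform converge to the Dirac mass at \<open>(q, p)\<close>.
\<close>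


section \<open>Square-integrable functions\<close>

text \<open>The force of -|x| jumps at 0, so a classical trajectory at rest at the origin has no
  unique continuation; the momentum \<epsilon> powr \<beta> is invisible in the limit but selects
  the branch. The inequality for \<open>F\<close> has the same defect: for \<open>p0 = 0\<close> it
  reads F'' \<le> 2 c F / s^2 up to the \<epsilon>-term, and this admits nonzero solutions s^m, m (m
  - 1) = 2 c, with zero data. Information on short times is therefore indispensable; it enters
  through \<open>p0 > 0\<close> or through M = O(t^2). The bound c < 3 makes s^3 a strict
  supersolution; in units of \<open>p0\<close>, cubic growth costs one factor 1 / p0, which leaves
  \<epsilon> powr (1/4 - 2 \<beta>). Weyl operators stand in for position and momentum because a
  solution lies only in the domain of a closure: no derivative in x and no moment of it is at hand,
  whereas bounded operators always apply. Their increments, linear in \<kappa> and v, replace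
  variances.\<close>

definition ip :: "(real \<Rightarrow> complex) \<Rightarrow> (real \<Rightarrow> complex) \<Rightarrow> complex" where
  "ip f g = (LINT x|lborel. f x * cnj (g x))"

lemma borel_measurable_cnj [measurable (raw)]:
  "f \<in> borel_measurable M \<Longrightarrow> (\<lambda>x. cnj (f x)) \<in> borel_measurable M"
  by (rule measurable_compose[OF _ borel_measurable_continuous_onI]) (auto intro!: continuous_intros)

lemma L2_D:
  assumes "f \<in> L2"
  shows "f \<in> borel_measurable borel" "integrable lborel (\<lambda>x. (norm (f x))\<^sup>2)"
  using assms by (auto simp: L2_def)

lemma L2_I:
  assumes "f \<in> borel_measurable borel" "integrable lborel (\<lambda>x. (norm (f x))\<^sup>2)"
  shows "f \<in> L2"
  using assms by (auto simp: L2_def)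

text \<open>\<open>l2norm\<close> is 0 on functions that are not square-integrable, so a bound of it
  carries information only together with membership in \<open>L2\<close>; both are delivered at
  once.\<close>

lemma L2_dominated:
  assumes "f \<in> borel_measurable borel" "g \<in> L2" "\<And>x. norm (f x) \<le> C * norm (g x)" "C \<ge> 0"
  shows "f \<in> L2" "l2norm f \<le> C * l2norm g"
proof -
  note [measurable] = assms(1) L2_D(1)[OF assms(2)]
  have le: "(norm (f x))\<^sup>2 \<le> C\<^sup>2 * (norm (g x))\<^sup>2" for x
    using power_mono[OF assms(3), of x 2] by (simp add: power_mult_distrib)
  have int: "integrable lborel (\<lambda>x. C\<^sup>2 * (norm (g x))\<^sup>2)"
    using L2_D(2)[OF assms(2)] by simp
  have int2: "integrable lborel (\<lambda>x. (norm (f x))\<^sup>2)"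
    by (rule Bochner_Integration.integrable_bound[OF int]) (use le in auto)
  then show "f \<in> L2" by (intro L2_I) auto
  have "(LINT x|lborel. (norm (f x))\<^sup>2) \<le> (LINT x|lborel. C\<^sup>2 * (norm (g x))\<^sup>2)"
    by (rule integral_mono[OF int2 int le])
  also have "\<dots> = C\<^sup>2 * (LINT x|lborel. (norm (g x))\<^sup>2)" by simp
  finally have "l2norm f \<le> sqrt (C\<^sup>2 * (LINT x|lborel. (norm (g x))\<^sup>2))"
    unfolding l2norm_def by simp
  also have "\<dots> = C * l2norm g"
    using assms(4) by (simp add: l2norm_def real_sqrt_mult)
  finally show "l2norm f \<le> C * l2norm g" .
qed

lemma L2_add: assumes "f \<in> L2" "g \<in> L2" shows "(\<lambda>x. f x + g x) \<in> L2"
proof (rule L2_I)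
  note [measurable] = L2_D(1)[OF assms(1)] L2_D(1)[OF assms(2)]
  show "(\<lambda>x. f x + g x) \<in> borel_measurable borel" by measurable
  have int: "integrable lborel (\<lambda>x. 2 * (norm (f x))\<^sup>2 + 2 * (norm (g x))\<^sup>2)"
    using L2_D(2)[OF assms(1)] L2_D(2)[OF assms(2)] by simp
  have le: "(norm (f x + g x))\<^sup>2 \<le> 2 * (norm (f x))\<^sup>2 + 2 * (norm (g x))\<^sup>2" for x
  proof -
    have "(norm (f x + g x))\<^sup>2 \<le> (norm (f x) + norm (g x))\<^sup>2"
      by (intro power_mono norm_triangle_ineq) auto
    also have "\<dots> \<le> 2 * (norm (f x))\<^sup>2 + 2 * (norm (g x))\<^sup>2"
      using sum_squares_ge_zero[of "norm (f x) - norm (g x)" 0]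
      by (simp add: power2_eq_square algebra_simps)
    finally show ?thesis .
  qed
  show "integrable lborel (\<lambda>x. (norm (f x + g x))\<^sup>2)"
    by (rule Bochner_Integration.integrable_bound[OF int]) (use le in auto)
qed

lemma L2_mult_bounded:
  assumes "h \<in> borel_measurable borel" "f \<in> L2" "\<And>x. norm (h x) \<le> C"
  shows "(\<lambda>x. h x * f x) \<in> L2" "l2norm (\<lambda>x. h x * f x) \<le> C * l2norm f"
proof -
  note [measurable] = assms(1) L2_D(1)[OF assms(2)]
  have C: "C \<ge> 0" using assms(3)[of 0] norm_ge_zero order_trans by blast
  have m: "(\<lambda>x. h x * f x) \<in> borel_measurable borel" by measurable
  have "norm (h x * f x) \<le> C * norm (f x)" for x
    using assms(3) by (simp add: norm_mult mult_right_mono)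
  from L2_dominated[OF m assms(2) this C] show
    "(\<lambda>x. h x * f x) \<in> L2" "l2norm (\<lambda>x. h x * f x) \<le> C * l2norm f" by auto
qed

lemma L2_cmult: "f \<in> L2 \<Longrightarrow> (\<lambda>x. c * f x) \<in> L2"
  using L2_mult_bounded(1)[of "\<lambda>_. c" f "norm c"] by simp

lemma L2_diff: assumes "f \<in> L2" "g \<in> L2" shows "(\<lambda>x. f x - g x) \<in> L2"
  using L2_add[OF assms(1) L2_cmult[OF assms(2), of "-1"]] by simp

lemma L2_zero: "(\<lambda>_. 0) \<in> L2"
  by (rule L2_I) auto

lemma L2_cnj: assumes "f \<in> L2" shows "(\<lambda>x. cnj (f x)) \<in> L2"
  using L2_D[OF assms] by (intro L2_I) auto

lemma L2_translate: assumes "f \<in> L2" shows "(\<lambda>x. f (x - r)) \<in> L2"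
proof (rule L2_I)
  note [measurable] = L2_D(1)[OF assms]
  show "(\<lambda>x. f (x - r)) \<in> borel_measurable borel" by measurable
  show "integrable lborel (\<lambda>x. (norm (f (x - r)))\<^sup>2)"
    using lborel_integrable_real_affine[OF L2_D(2)[OF assms], of 1 "-r"] by simp
qed

lemma integral_translate:
  fixes f :: "real \<Rightarrow> 'a::{banach, second_countable_topology}"
  shows "(LINT x|lborel. f (x - r)) = (LINT x|lborel. f x)"
  using lborel_integral_real_affine[of 1 f "-r"] by simp

lemma l2norm_translate: "l2norm (\<lambda>x. f (x - r)) = l2norm f"
  using integral_translate[of "\<lambda>x. (norm (f x))\<^sup>2" r] by (simp add: l2norm_def)

lemma l2norm_nonneg: "0 \<le> l2norm f" by (simp add: l2norm_def)

lemma l2norm_sq: "(l2norm f)\<^sup>2 = (LINT x|lborel. (norm (f x))\<^sup>2)"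
  by (simp add: l2norm_def)

lemma l2norm_cong_norm:
  "(\<And>x. norm (f x) = norm (g x)) \<Longrightarrow> l2norm f = l2norm g"
  by (simp add: l2norm_def)

lemma l2norm_cong_AE:
  assumes "AE x in lborel. f x = g x" "f \<in> borel_measurable borel" "g \<in> borel_measurable borel"
  shows "l2norm f = l2norm g"
proof -
  note [measurable] = assms(2,3)
  have "(LINT x|lborel. (norm (f x))\<^sup>2) = (LINT x|lborel. (norm (g x))\<^sup>2)"
    by (rule integral_cong_AE) (use assms(1) in auto)
  then show ?thesis by (simp add: l2norm_def)
qed

lemma L2_mult_integrable:
  assumes "f \<in> L2" "g \<in> L2"
  shows "integrable lborel (\<lambda>x. f x * cnj (g x))" "integrable lborel (\<lambda>x. norm (f x) * norm (g x))"
proof -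
  note [measurable] = L2_D(1)[OF assms(1)] L2_D(1)[OF assms(2)]
  have int: "integrable lborel (\<lambda>x. (norm (f x))\<^sup>2 + (norm (g x))\<^sup>2)"
    using L2_D(2)[OF assms(1)] L2_D(2)[OF assms(2)] by simp
  have le: "norm (f x) * norm (g x) \<le> (norm (f x))\<^sup>2 + (norm (g x))\<^sup>2" for x
    using sum_squares_bound[of "norm (f x)" "norm (g x)"] mult_nonneg_nonneg[OF norm_ge_zero[of "f x"] norm_ge_zero[of "g x"]]
    by linarith
  show "integrable lborel (\<lambda>x. f x * cnj (g x))"
    by (rule Bochner_Integration.integrable_bound[OF int]) (use le in \<open>auto simp: norm_mult\<close>)
  show "integrable lborel (\<lambda>x. norm (f x) * norm (g x))"
    by (rule Bochner_Integration.integrable_bound[OF int]) (use le in \<open>auto simp: norm_mult\<close>)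
qed

text \<open>Cauchy-Schwarz, from the inequality 2 a b \<le> a^2 + b^2 with one free weight on each
  factor; the weights are then balanced as s = \<open>l2norm g\<close>, t =
  \<open>l2norm f\<close>.\<close>

lemma L2_mult_integral_le:
  assumes "f \<in> L2" "g \<in> L2"
  shows "(LINT x|lborel. norm (f x) * norm (g x)) \<le> l2norm f * l2norm g"
proof -
  let ?I = "LINT x|lborel. norm (f x) * norm (g x)"
  note int = L2_mult_integrable(2)[OF assms] L2_D(2)[OF assms(1)] L2_D(2)[OF assms(2)]
  have I0: "?I \<ge> 0" by (rule Bochner_Integration.integral_nonneg) auto
  have key: "2 * (s * t) * ?I \<le> s\<^sup>2 * (l2norm f)\<^sup>2 + t\<^sup>2 * (l2norm g)\<^sup>2" for s t :: real
  proof -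
    have "2 * (s * t) * ?I = (LINT x|lborel. 2 * (s * t) * (norm (f x) * norm (g x)))"
      by simp
    also have "\<dots> \<le> (LINT x|lborel. s\<^sup>2 * (norm (f x))\<^sup>2 + t\<^sup>2 * (norm (g x))\<^sup>2)"
    proof (rule integral_mono)
      fix x show "2 * (s * t) * (norm (f x) * norm (g x)) \<le> s\<^sup>2 * (norm (f x))\<^sup>2 + t\<^sup>2 * (norm (g x))\<^sup>2"
        using sum_squares_bound[of "s * norm (f x)" "t * norm (g x)"]
        by (simp add: power_mult_distrib mult_ac)
    qed (use int in auto)
    also have "\<dots> = s\<^sup>2 * (l2norm f)\<^sup>2 + t\<^sup>2 * (l2norm g)\<^sup>2"
      using int by (simp add: l2norm_sq)
    finally show ?thesis .
  qed
  show ?thesis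
  proof (cases "l2norm f = 0 \<or> l2norm g = 0")
    case True
    \<comment> \<open>Balancing degenerates when a norm vanishes. Here one weight is made large
      instead: with (N + 1) / I the inequality \<open>key\<close> would read 2 (N + 1) \<le>
      N.\<close>
    have "?I \<le> 0"
    proof (rule ccontr)
      assume "\<not> ?I \<le> 0"
      then have I: "?I > 0" by simp
      define N where "N = (l2norm f)\<^sup>2 + (l2norm g)\<^sup>2"
      have N: "N \<ge> 0" by (simp add: N_def)
      from True show False
      proof
        assume "l2norm f = 0"
        then have "2 * ((N + 1) / ?I) * ?I \<le> N" using key[of "(N + 1) / ?I" 1] by (simp add: N_def)
        then show False using I N by simp
      next
        assume "l2norm g = 0"
        then have "2 * ((N + 1) / ?I) * ?I \<le> N" using key[of 1 "(N + 1) / ?I"] by (simp add: N_def)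
        then show False using I N by simp
      qed
    qed
    then show ?thesis using True by auto
  next
    case False
    then have pos: "l2norm f > 0" "l2norm g > 0" using l2norm_nonneg[of f] l2norm_nonneg[of g] by auto
    have "2 * (l2norm g * l2norm f) * ?I \<le> 2 * (l2norm g * l2norm f) * (l2norm f * l2norm g)"
      using key[of "l2norm g" "l2norm f"] by (simp add: power2_eq_square algebra_simps)
    then show ?thesis using pos by (simp add: mult_le_cancel_left)
  qed
qed

lemma ip_weighted_le:
  assumes "f \<in> L2" "g \<in> L2" "h \<in> borel_measurable borel" "\<And>x. norm (h x) \<le> C"
  shows "norm (LINT x|lborel. h x * f x * cnj (g x)) \<le> C * (l2norm f * l2norm g)"
proof -
  note m = L2_mult_bounded[OF assms(3,1,4)]
  have "norm (LINT x|lborel. h x * f x * cnj (g x)) \<le> (LINT x|lborel. norm (h x * f x * cnj (g x)))"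
    by (rule integral_norm_bound)
  also have "\<dots> = (LINT x|lborel. norm (h x * f x) * norm (g x))" by (simp add: norm_mult)
  also have "\<dots> \<le> l2norm (\<lambda>x. h x * f x) * l2norm g"
    by (rule L2_mult_integral_le[OF m(1) assms(2)])
  also have "\<dots> \<le> C * (l2norm f * l2norm g)"
    using mult_right_mono[OF m(2) l2norm_nonneg[of g]] by (simp add: mult_ac)
  finally show ?thesis .
qed

lemma ip_le:
  assumes "f \<in> L2" "g \<in> L2"
  shows "norm (ip f g) \<le> l2norm f * l2norm g"
  using ip_weighted_le[OF assms, of "\<lambda>_. 1" 1] by (simp add: ip_def)

lemma ip_diff_left: "f \<in> L2 \<Longrightarrow> g \<in> L2 \<Longrightarrow> h \<in> L2 \<Longrightarrow> ip (\<lambda>x. f x - g x) h = ip f h - ip g h"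
  using L2_mult_integrable(1)[of f h] L2_mult_integrable(1)[of g h] by (simp add: ip_def algebra_simps)

lemma ip_cnj: "cnj (ip f g) = ip g f"
proof -
  have "cnj (ip f g) = (LINT x|lborel. cnj (f x * cnj (g x)))"
    unfolding ip_def by (rule Bochner_Integration.integral_cnj[symmetric])
  then show ?thesis by (simp add: ip_def mult.commute)
qed

lemma ip_diff_right: "f \<in> L2 \<Longrightarrow> g \<in> L2 \<Longrightarrow> h \<in> L2 \<Longrightarrow> ip h (\<lambda>x. f x - g x) = ip h f - ip h g"
  using L2_mult_integrable(1)[of h f] L2_mult_integrable(1)[of h g] by (simp add: ip_def algebra_simps)

lemma ip_cmult_left: "ip (\<lambda>x. c * f x) h = c * ip f h"
  by (simp add: ip_def mult.assoc)

lemma ip_self: "ip f f = of_real ((l2norm f)\<^sup>2)"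
proof -
  have "ip f f = (LINT x|lborel. complex_of_real ((norm (f x))\<^sup>2))"
    unfolding ip_def by (intro Bochner_Integration.integral_cong refl) (simp only: complex_norm_square)
  also have "\<dots> = of_real (LINT x|lborel. (norm (f x))\<^sup>2)" by (rule integral_complex_of_real)
  finally show ?thesis by (simp add: l2norm_sq)
qed

text \<open>Polarization. For a unitary U and a unit vector it reduces the norm of U \<psi> - \<psi>
  to the single number Re <U \<psi>, \<psi>>, which is what \<open>weyl_estimate\<close>
  differentiates in time.\<close>

lemma l2norm_diff_sq:
  assumes "f \<in> L2" "g \<in> L2"
  shows "(l2norm (\<lambda>x. f x - g x))\<^sup>2 = (l2norm f)\<^sup>2 + (l2norm g)\<^sup>2 - 2 * Re (ip f g)"
proof -
  have "complex_of_real ((l2norm (\<lambda>x. f x - g x))\<^sup>2) = ip (\<lambda>x. f x - g x) (\<lambda>x. f x - g x)"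
    by (simp only: ip_self)
  also have "\<dots> = ip f f + ip g g - (ip f g + cnj (ip f g))"
    using assms L2_diff[OF assms] by (simp add: ip_diff_left ip_diff_right ip_cnj)
  finally have "Re (complex_of_real ((l2norm (\<lambda>x. f x - g x))\<^sup>2)) = Re (ip f f + ip g g - (ip f g + cnj (ip f g)))"
    by (rule arg_cong)
  then show ?thesis by (simp add: ip_self del: of_real_power)
qed

lemma l2norm_add_le:
  assumes "f \<in> L2" "g \<in> L2"
  shows "l2norm (\<lambda>x. f x + g x) \<le> l2norm f + l2norm g"
proof (rule power2_le_imp_le)
  have g: "(\<lambda>x. - g x) \<in> L2" using L2_cmult[OF assms(2), of "-1"] by simp
  have n: "l2norm (\<lambda>x. - g x) = l2norm g" by (rule l2norm_cong_norm) simp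
  have "(l2norm (\<lambda>x. f x + g x))\<^sup>2 = (l2norm f)\<^sup>2 + (l2norm g)\<^sup>2 - 2 * Re (ip f (\<lambda>x. - g x))"
    using l2norm_diff_sq[OF assms(1) g] n by simp
  also have "\<dots> \<le> (l2norm f + l2norm g)\<^sup>2"
    using ip_le[OF assms(1) g] abs_Re_le_cmod[of "ip f (\<lambda>x. - g x)"] n
    by (simp add: power2_sum)
  finally show "(l2norm (\<lambda>x. f x + g x))\<^sup>2 \<le> (l2norm f + l2norm g)\<^sup>2" .
qed (simp add: l2norm_nonneg)

lemma l2norm_uminus: "l2norm (\<lambda>x. - f x) = l2norm f"
  by (rule l2norm_cong_norm) simp

lemma l2norm_minus_commute: "l2norm (\<lambda>x. f x - g x) = l2norm (\<lambda>x. g x - f x)"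
  by (rule l2norm_cong_norm) (simp add: norm_minus_commute)

lemma l2norm_cmult: "l2norm (\<lambda>x. c * f x) = norm c * l2norm f"
  by (simp add: l2norm_def norm_mult power_mult_distrib real_sqrt_mult)

lemma l2norm_diff_le:
  assumes "f \<in> L2" "g \<in> L2"
  shows "l2norm (\<lambda>x. f x - g x) \<le> l2norm f + l2norm g"
  using l2norm_add_le[OF assms(1) L2_cmult[OF assms(2), of "-1"]] by (simp add: l2norm_uminus)

lemma l2norm_triangle:
  assumes "f \<in> L2" "g \<in> L2" "h \<in> L2"
  shows "l2norm (\<lambda>x. f x - h x) \<le> l2norm (\<lambda>x. f x - g x) + l2norm (\<lambda>x. g x - h x)"
  using l2norm_add_le[OF L2_diff[OF assms(1,2)] L2_diff[OF assms(2,3)]] by simp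

lemma l2norm_diff_ge:
  assumes "f \<in> L2" "g \<in> L2"
  shows "\<bar>l2norm f - l2norm g\<bar> \<le> l2norm (\<lambda>x. f x - g x)"
  using l2norm_add_le[OF L2_diff[OF assms] assms(2)] l2norm_add_le[OF L2_diff[OF assms(2,1)] assms(1)]
    l2norm_minus_commute[of f g]
  by (simp add: abs_le_iff)

text \<open>Sesquilinear forms \<open>\<langle>h T\<^sub>r f, g\<rangle>\<close> with a bounded multiplier \<open>h\<close> and a translation \<open>T\<^sub>r\<close>;
  they contain the Weyl operators (\<open>h\<close> a character).\<close>

definition tform :: "(real \<Rightarrow> complex) \<Rightarrow> real \<Rightarrow> (real \<Rightarrow> complex) \<Rightarrow> (real \<Rightarrow> complex) \<Rightarrow> complex" where
  "tform h r f g = (LINT x|lborel. h x * f (x - r) * cnj (g x))"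

lemma tform_le:
  assumes "f \<in> L2" "g \<in> L2" "h \<in> borel_measurable borel" "\<And>x. norm (h x) \<le> C"
  shows "norm (tform h r f g) \<le> C * (l2norm f * l2norm g)"
  using ip_weighted_le[OF L2_translate[OF assms(1)] assms(2-4), of r]
  unfolding tform_def l2norm_translate .

lemma tform_integrable:
  assumes "f \<in> L2" "g \<in> L2" "h \<in> borel_measurable borel" "\<And>x. norm (h x) \<le> C"
  shows "integrable lborel (\<lambda>x. h x * f (x - r) * cnj (g x))"
  using L2_mult_integrable(1)[OF L2_mult_bounded(1)[OF assms(3) L2_translate[OF assms(1)] assms(4)] assms(2)] .

lemma tform_diff:
  assumes "f \<in> L2" "g \<in> L2" "f' \<in> L2" "g' \<in> L2"
    "h \<in> borel_measurable borel" "\<And>x. norm (h x) \<le> C"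
  shows "tform h r f g - tform h r f' g' = tform h r (\<lambda>x. f x - f' x) g + tform h r f' (\<lambda>x. g x - g' x)"
  using tform_integrable[OF assms(1,2,5,6), of r] tform_integrable[OF assms(3,2,5,6), of r]
    tform_integrable[OF assms(3,4,5,6), of r]
  by (simp add: tform_def algebra_simps)

lemma tform_diff_le:
  assumes "f \<in> L2" "g \<in> L2" "f' \<in> L2" "g' \<in> L2"
    "h \<in> borel_measurable borel" "\<And>x. norm (h x) \<le> C"
  shows "norm (tform h r f g - tform h r f' g') \<le>
    C * (l2norm (\<lambda>x. f x - f' x) * l2norm g + l2norm f' * l2norm (\<lambda>x. g x - g' x))"
  unfolding tform_diff[OF assms]
  using norm_triangle_mono[OF tform_le[OF L2_diff[OF assms(1,3)] assms(2,5,6)]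
      tform_le[OF assms(3) L2_diff[OF assms(2,4)] assms(5,6)], of r r]
  by (simp add: algebra_simps)

section \<open>Compactly supported functions and the Schroedinger operator\<close>

definition Cc :: "(real \<Rightarrow> complex) \<Rightarrow> bool" where
  "Cc f \<longleftrightarrow> continuous_on UNIV f \<and> (\<exists>R. \<forall>x. R < \<bar>x\<bar> \<longrightarrow> f x = 0)"

lemma Cc_E:
  assumes "Cc f"
  obtains R where "R > 0" "\<And>x. R < \<bar>x\<bar> \<Longrightarrow> f x = 0"
proof -
  from assms obtain R where "\<And>x. R < \<bar>x\<bar> \<Longrightarrow> f x = 0" by (auto simp: Cc_def)
  then show ?thesis by (intro that[of "max R 1"]) auto
qed

lemma Cc_continuous: "Cc f \<Longrightarrow> continuous_on UNIV f"
  by (simp add: Cc_def)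

lemma Cc_measurable: "Cc f \<Longrightarrow> f \<in> borel_measurable borel"
  by (simp add: Cc_def borel_measurable_continuous_onI)

lemma Cc_add: assumes "Cc f" "Cc g" shows "Cc (\<lambda>x. f x + g x)"
proof -
  obtain R where "\<And>x. R < \<bar>x\<bar> \<Longrightarrow> f x = 0" using Cc_E[OF assms(1)] by metis
  moreover obtain S where "\<And>x. S < \<bar>x\<bar> \<Longrightarrow> g x = 0" using Cc_E[OF assms(2)] by metis
  ultimately have "\<forall>x. max R S < \<bar>x\<bar> \<longrightarrow> f x + g x = 0" by auto
  moreover have "continuous_on UNIV (\<lambda>x. f x + g x)"
    using assms by (auto simp: Cc_def intro!: continuous_intros)
  ultimately show ?thesis unfolding Cc_def by blast
qed

lemma Cc_mult:
  assumes "Cc f" "continuous_on UNIV h" shows "Cc (\<lambda>x. h x * f x)"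
proof -
  obtain R where "\<And>x. R < \<bar>x\<bar> \<Longrightarrow> f x = 0" using Cc_E[OF assms(1)] by metis
  then show ?thesis using assms by (auto simp: Cc_def intro!: continuous_intros)
qed

lemma Cc_cmult: "Cc f \<Longrightarrow> Cc (\<lambda>x. c * f x)"
  by (rule Cc_mult) auto

lemma Cc_diff: assumes "Cc f" "Cc g" shows "Cc (\<lambda>x. f x - g x)"
  using Cc_add[OF assms(1) Cc_cmult[OF assms(2), of "-1"]] by simp

lemma Cc_cnj: "Cc f \<Longrightarrow> Cc (\<lambda>x. cnj (f x))"
  by (auto simp: Cc_def intro!: continuous_intros)

lemma Cc_translate: assumes "Cc f" shows "Cc (\<lambda>x. f (x - r))"
proof -
  obtain R where R: "\<And>x. R < \<bar>x\<bar> \<Longrightarrow> f x = 0" using Cc_E[OF assms] by metis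
  have "\<forall>x. R + \<bar>r\<bar> < \<bar>x\<bar> \<longrightarrow> f (x - r) = 0" by (auto intro!: R)
  moreover have "continuous_on UNIV (\<lambda>x. f (x - r))"
    by (rule continuous_on_compose2[OF Cc_continuous[OF assms]]) (auto intro!: continuous_intros)
  ultimately show ?thesis by (auto simp: Cc_def)
qed

lemma Cc_scale: assumes "Cc f" "s \<noteq> 0" shows "Cc (\<lambda>x. f (x / s))"
proof -
  obtain R where R: "\<And>x. R < \<bar>x\<bar> \<Longrightarrow> f x = 0" using Cc_E[OF assms(1)] by metis
  have "\<forall>x. R * \<bar>s\<bar> < \<bar>x\<bar> \<longrightarrow> f (x / s) = 0" using assms(2) by (auto intro!: R simp: field_simps)
  moreover have "continuous_on UNIV (\<lambda>x. f (x / s))"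
    by (rule continuous_on_compose2[OF Cc_continuous[OF assms(1)]]) (use assms(2) in \<open>auto intro!: continuous_intros\<close>)
  ultimately show ?thesis by (auto simp: Cc_def)
qed

lemma Cc_integrable: assumes "Cc f" shows "integrable lborel f"
proof -
  obtain R where R: "\<And>x. R < \<bar>x\<bar> \<Longrightarrow> f x = 0" using Cc_E[OF assms] by metis
  have "integrable lborel (\<lambda>x. indicator {-R..R} x *\<^sub>R f x)"
    by (rule borel_integrable_compact) (use Cc_continuous[OF assms] continuous_on_subset in auto)
  moreover have "(\<lambda>x. indicator {-R..R} x *\<^sub>R f x) = f"
  proof
    fix x show "indicator {-R..R} x *\<^sub>R f x = f x"
      using R[of x] by (cases "x \<in> {-R..R}") (auto simp: indicator_def)
  qed
  ultimately show ?thesis by simp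
qed

lemma Cc_bounded: assumes "Cc f" shows "\<exists>B>0. \<forall>x. norm (f x) \<le> B"
proof -
  obtain R where R: "\<And>x. R < \<bar>x\<bar> \<Longrightarrow> f x = 0" using Cc_E[OF assms] by metis
  have "compact (f ` {-R..R})"
    by (rule compact_continuous_image) (use Cc_continuous[OF assms] continuous_on_subset in auto)
  then obtain B where B: "B > 0" "\<And>x. x \<in> {-R..R} \<Longrightarrow> norm (f x) \<le> B"
    using compact_imp_bounded bounded_pos by (metis image_eqI)
  have "norm (f x) \<le> B" for x
    using B R[of x] by (cases "x \<in> {-R..R}") auto
  then show ?thesis using B(1) by auto
qed

lemma Cc_L2: assumes "Cc f" shows "f \<in> L2"
proof (rule L2_I[OF Cc_measurable[OF assms]])
  have "Cc (\<lambda>x. cnj (f x) * f x)"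
    by (rule Cc_mult[OF assms]) (rule continuous_on_cnj[OF Cc_continuous[OF assms]])
  from integrable_norm[OF Cc_integrable[OF this]]
  show "integrable lborel (\<lambda>x. (norm (f x))\<^sup>2)" by (simp add: norm_mult power2_eq_square)
qed

text \<open>The bridge from uniform smallness on a fixed compact set, as pointwise calculus provides
  it, to smallness in L^2.\<close>

lemma l2norm_le_of_bounded_support:
  assumes "f \<in> borel_measurable borel" "\<And>x. norm (f x) \<le> e" "\<And>x. R < \<bar>x\<bar> \<Longrightarrow> f x = 0" "R \<ge> 0"
  shows "f \<in> L2" "l2norm f \<le> sqrt (2 * R) * e"
proof -
  let ?g = "indicator {-R..R} :: real \<Rightarrow> complex"
  have e: "e \<ge> 0" using assms(2)[of 0] norm_ge_zero order_trans by blast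
  have i: "integrable lborel (\<lambda>x. (norm (?g x))\<^sup>2)" and v: "(LINT x|lborel. (norm (?g x))\<^sup>2) = 2 * R"
  proof -
    have eq: "(\<lambda>x. (norm (?g x))\<^sup>2) = indicator {-R..R}" by (auto simp: indicator_def)
    show "integrable lborel (\<lambda>x. (norm (?g x))\<^sup>2)" unfolding eq by (rule integrable_real_indicator) (auto simp: emeasure_lborel_Icc_eq)
    show "(LINT x|lborel. (norm (?g x))\<^sup>2) = 2 * R" unfolding eq using assms(4) by simp
  qed
  have g: "?g \<in> L2" by (rule L2_I[OF _ i]) auto
  have le: "norm (f x) \<le> e * norm (?g x)" for x
    using assms(2)[of x] assms(3)[of x] by (cases "x \<in> {-R..R}") (auto simp: indicator_def)
  show "f \<in> L2" using L2_dominated(1)[OF assms(1) g le e] .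
  have "l2norm ?g = sqrt (2 * R)" using v by (simp add: l2norm_def)
  with L2_dominated(2)[OF assms(1) g le e] show "l2norm f \<le> sqrt (2 * R) * e" by (simp add: mult.commute)
qed

lemma Cc_deriv:
  assumes "Cc f" "\<And>x. (f has_vector_derivative f' x) (at x)" "continuous_on UNIV f'"
  shows "Cc f'"
proof -
  obtain R where R: "\<And>x. R < \<bar>x\<bar> \<Longrightarrow> f x = 0" using Cc_E[OF assms(1)] by metis
  have "f' x = 0" if x: "R < \<bar>x\<bar>" for x
  proof -
    have op: "open {y::real. R < \<bar>y\<bar>}" by (intro open_Collect_less continuous_intros)
    have "((\<lambda>_. 0) has_vector_derivative f' x) (at x)"
      by (rule has_vector_derivative_transform_within_open[OF assms(2) op]) (use x R in auto)
    then show ?thesis using vector_derivative_unique_at has_vector_derivative_const by metis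
  qed
  then show ?thesis using assms(3) by (auto simp: Cc_def)
qed

lemma integral_derivative_eq_0:
  assumes "Cc F" "\<And>x. (F has_vector_derivative f x) (at x)" "continuous_on UNIV f"
  shows "(LINT x|lborel. f x) = 0"
proof -
  obtain R where R: "R > 0" "\<And>x. R < \<bar>x\<bar> \<Longrightarrow> F x = 0" using Cc_E[OF assms(1)] by metis
  obtain S where S: "S > 0" "\<And>x. S < \<bar>x\<bar> \<Longrightarrow> f x = 0" using Cc_E[OF Cc_deriv[OF assms]] by metis
  define T where "T = max R S + 1"
  have "has_bochner_integral lborel (\<lambda>x. indicator {-T..T} x *\<^sub>R f x) (F T - F (-T))"
  proof (rule has_bochner_integral_FTC_Icc)
    show "-T \<le> T" using R S by (auto simp: T_def)
    show "continuous_on {-T..T} f" using assms(3) continuous_on_subset by auto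
    fix x show "(F has_vector_derivative f x) (at x within {-T..T})"
      using assms(2) has_vector_derivative_at_within by blast
  qed
  moreover have "(\<lambda>x. indicator {-T..T} x *\<^sub>R f x) = f"
  proof
    fix x show "indicator {-T..T} x *\<^sub>R f x = f x"
      using S(2)[of x] by (cases "x \<in> {-T..T}") (auto simp: indicator_def T_def)
  qed
  moreover have "F T = 0" "F (-T) = 0" using R S by (auto simp: T_def)
  ultimately show ?thesis by (simp add: has_bochner_integral_integral_eq)
qed

text \<open>Compact support is asked of one factor only, so that the other may be a
  character.\<close>

lemma ibp:
  assumes f: "Cc f" "\<And>x. (f has_vector_derivative f' x) (at x)" "continuous_on UNIV f'"
    and g: "\<And>x. (g has_vector_derivative g' x) (at x)" "continuous_on UNIV g'"
  shows "(LINT x|lborel. f' x * g x) = - (LINT x|lborel. f x * g' x)"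
proof -
  have cg: "continuous_on UNIV g" using g(1)
    by (meson continuous_at_imp_continuous_on has_vector_derivative_continuous)
  have "Cc (\<lambda>x. g x * f x)" by (rule Cc_mult[OF f(1) cg])
  then have c: "Cc (\<lambda>x. f x * g x)" by (simp add: mult.commute)
  have "(LINT x|lborel. f x * g' x + f' x * g x) = 0"
  proof (rule integral_derivative_eq_0[OF c])
    show "((\<lambda>x. f x * g x) has_vector_derivative f x * g' x + f' x * g x) (at x)" for x
      by (rule has_vector_derivative_mult[OF f(2) g(1)])
    show "continuous_on UNIV (\<lambda>x. f x * g' x + f' x * g x)"
      by (intro continuous_on_add continuous_on_mult cg f(3) g(2) Cc_continuous[OF f(1)])
  qed
  moreover have "integrable lborel (\<lambda>x. f x * g' x)"
    using Cc_integrable[OF Cc_mult[OF f(1) g(2)]] by (simp add: mult.commute)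
  moreover have "integrable lborel (\<lambda>x. f' x * g x)"
    using Cc_integrable[OF Cc_mult[OF Cc_deriv[OF f] cg]] by (simp add: mult.commute)
  ultimately show ?thesis by (simp add: add_eq_0_iff)
qed

section \<open>C^2 functions of compact support and the symmetry of the Schroedinger
  operator\<close>

definition is_C2c :: "(real \<Rightarrow> complex) \<Rightarrow> (real \<Rightarrow> complex) \<Rightarrow> (real \<Rightarrow> complex) \<Rightarrow> bool" where
  "is_C2c f f1 f2 \<longleftrightarrow> Cc f \<and> continuous_on UNIV f2 \<and>
     (\<forall>x. (f has_vector_derivative f1 x) (at x)) \<and> (\<forall>x. (f1 has_vector_derivative f2 x) (at x))"

lemma is_C2c_D:
  assumes "is_C2c f f1 f2"
  shows "Cc f" "Cc f1" "Cc f2"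
    "\<And>x. (f has_vector_derivative f1 x) (at x)" "\<And>x. (f1 has_vector_derivative f2 x) (at x)"
proof -
  show f: "Cc f" and d1: "\<And>x. (f has_vector_derivative f1 x) (at x)"
    and d2: "\<And>x. (f1 has_vector_derivative f2 x) (at x)" using assms by (auto simp: is_C2c_def)
  have "continuous_on UNIV f1" using d2
    by (meson continuous_at_imp_continuous_on has_vector_derivative_continuous)
  from Cc_deriv[OF f d1 this] show f1: "Cc f1" .
  show "Cc f2" using Cc_deriv[OF f1 d2] assms by (auto simp: is_C2c_def)
qed

lemma ibp2:
  assumes f: "is_C2c f f1 f2" and g: "is_C2c g g1 g2"
  shows "(LINT x|lborel. f2 x * cnj (g x)) = (LINT x|lborel. f x * cnj (g2 x))"
    and "(LINT x|lborel. f2 x * cnj (g x)) = - (LINT x|lborel. f1 x * cnj (g1 x))"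
proof -
  note F = is_C2c_D[OF f] and G = is_C2c_D[OF g]
  have cd: "((\<lambda>x. cnj (h x)) has_vector_derivative cnj (h' x)) (at x)"
    if "(h has_vector_derivative h' x) (at x)" for h h' :: "real \<Rightarrow> complex" and x
    using that by (rule has_vector_derivative_cnj)
  note C = F(1-3) G(1-3)
  show 2: "(LINT x|lborel. f2 x * cnj (g x)) = - (LINT x|lborel. f1 x * cnj (g1 x))"
    by (rule ibp[OF F(2) F(5)]) (auto intro!: cd G Cc_continuous F continuous_intros)
  have "(LINT x|lborel. f1 x * cnj (g1 x)) = - (LINT x|lborel. f x * cnj (g2 x))"
    by (rule ibp[OF F(1) F(4)]) (auto intro!: cd G Cc_continuous F continuous_intros)
  with 2 show "(LINT x|lborel. f2 x * cnj (g x)) = (LINT x|lborel. f x * cnj (g2 x))" by simp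
qed

definition schrop :: "real \<Rightarrow> (real \<Rightarrow> real) \<Rightarrow> (real \<Rightarrow> complex) \<Rightarrow> (real \<Rightarrow> complex) \<Rightarrow> real \<Rightarrow> complex" where
  "schrop \<epsilon> V f f2 = (\<lambda>x. - of_real (\<epsilon>\<^sup>2 / 2) * f2 x + of_real (V x) * f x)"

lemma schrop_Cc:
  assumes "is_C2c f f1 f2" "continuous_on UNIV V" shows "Cc (schrop \<epsilon> V f f2)"
  unfolding schrop_def
  by (intro Cc_add Cc_cmult Cc_mult is_C2c_D(1,3)[OF assms(1)] continuous_intros assms(2))

text \<open>One integration by parts turns <f'', f> into minus the squared norm of f', and the
  potential is real; so the expectation is real.\<close>

lemma schrop_symmetric:
  assumes f: "is_C2c f f1 f2" and V: "continuous_on UNIV V"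
  shows "Im (ip (schrop \<epsilon> V f f2) f) = 0"
proof -
  note F = is_C2c_D[OF f]
  have i: "integrable lborel (\<lambda>x. g x * h x * cnj (f x))" if "continuous_on UNIV g" "Cc h" for g h
    using Cc_integrable[OF Cc_mult[OF Cc_mult[OF that(2,1)] continuous_on_cnj[OF Cc_continuous[OF F(1)]]]]
    by (simp add: mult_ac)
  have "ip (schrop \<epsilon> V f f2) f =
      - of_real (\<epsilon>\<^sup>2 / 2) * (LINT x|lborel. f2 x * cnj (f x)) + (LINT x|lborel. of_real (V x) * f x * cnj (f x))"
  proof -
    have "ip (schrop \<epsilon> V f f2) f = (LINT x|lborel. - of_real (\<epsilon>\<^sup>2 / 2) * (f2 x * cnj (f x)) + of_real (V x) * f x * cnj (f x))"
      unfolding ip_def schrop_def by (intro Bochner_Integration.integral_cong refl) (simp add: algebra_simps)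
    also have "\<dots> = (LINT x|lborel. - of_real (\<epsilon>\<^sup>2 / 2) * (f2 x * cnj (f x))) + (LINT x|lborel. of_real (V x) * f x * cnj (f x))"
      using i[of "\<lambda>_. 1" f2] i[of "\<lambda>x. of_real (V x)" f] F V
      by (intro Bochner_Integration.integral_add integrable_mult_right) (auto intro!: continuous_intros)
    finally show ?thesis by (simp only: integral_mult_right_zero)
  qed
  also have "(LINT x|lborel. of_real (V x) * f x * cnj (f x)) = of_real (LINT x|lborel. V x * (norm (f x))\<^sup>2)"
    by (simp flip: integral_complex_of_real add: complex_norm_square mult.assoc del: of_real_power)
  also have "(LINT x|lborel. f2 x * cnj (f x)) = - (ip f1 f1)" unfolding ip_def by (rule ibp2(2)[OF f f])
  finally show ?thesis by (simp add: ip_self del: of_real_power)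
qed

section \<open>Test functions and the graph closure\<close>

lemma test_function_derivative:
  fixes f :: "real \<Rightarrow> complex"
  assumes "test_function f"
  shows "test_function (\<lambda>x. vector_derivative f (at x))"
    "(f has_vector_derivative vector_derivative f (at x)) (at x)" "Cc f"
proof -
  let ?g = "\<lambda>x. vector_derivative f (at x)"
  have ck: "Ck k f" for k using assms by (simp add: test_function_def)
  have d: "f differentiable (at x)" for x using ck[of "Suc 0"] by simp
  then show *: "(f has_vector_derivative ?g x) (at x)" for x
    by (simp add: vector_derivative_works)
  have g: "frechet_derivative f (at x) 1 = ?g x" for x
    using frechet_derivative_eq_vector_derivative[OF d[of x]] by simp
  have ckg: "Ck k ?g" for k using ck[of "Suc k"] unfolding Ck.simps g[symmetric] by blast
  have "supp ?g \<subseteq> supp f" unfolding supp_def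
  proof (rule closure_minimal)
    show "{x. ?g x \<noteq> 0} \<subseteq> closure {x. f x \<noteq> 0}"
    proof (rule ccontr)
      assume "\<not> ?thesis"
      then obtain x where x: "?g x \<noteq> 0" "x \<in> - closure {x. f x \<noteq> 0}" by auto
      have "((\<lambda>_. 0) has_vector_derivative ?g x) (at x)"
        by (rule has_vector_derivative_transform_within_open[OF * _ x(2)])
          (use closure_subset[of "{x. f x \<noteq> 0}"] in auto)
      then show False using x(1) vector_derivative_unique_at has_vector_derivative_const by metis
    qed
  qed auto
  moreover have "compact (supp f)" using assms by (simp add: test_function_def)
  ultimately have "compact (supp ?g)"
    by (metis compact_Int_closed inf.absorb_iff2 supp_def closed_closure)
  with ckg show "test_function ?g" by (simp add: test_function_def)
  have "continuous_on UNIV f" using ck[of 0] by simp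
  moreover have "\<exists>R. \<forall>x. R < \<bar>x\<bar> \<longrightarrow> f x = 0"
  proof -
    have "bounded (supp f)" using \<open>compact (supp f)\<close> compact_imp_bounded by auto
    then obtain R where R: "\<And>x. x \<in> supp f \<Longrightarrow> norm x \<le> R" using bounded_iff by metis
    have "f x = 0" if "R < \<bar>x\<bar>" for x
      using R[of x] that closure_subset[of "{x. f x \<noteq> 0}"] unfolding supp_def by force
    then show ?thesis by auto
  qed
  ultimately show "Cc f" by (simp add: Cc_def)
qed

lemma test_function_C2c:
  assumes "test_function f"
  obtains f1 f2 where "is_C2c f f1 f2" "\<And>\<epsilon> V. schroedinger_op \<epsilon> V f = schrop \<epsilon> V f f2"
    "test_function f1" "test_function f2"
proof -
  let ?f1 = "\<lambda>x. vector_derivative f (at x)"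
  let ?f2 = "\<lambda>x. vector_derivative ?f1 (at x)"
  note a = test_function_derivative[OF assms]
  note b = test_function_derivative[OF a(1)]
  note c = test_function_derivative[OF b(1)]
  have "is_C2c f ?f1 ?f2" unfolding is_C2c_def using a b c Cc_continuous by blast
  moreover have "schroedinger_op \<epsilon> V f = schrop \<epsilon> V f ?f2" for \<epsilon> V
    by (simp add: schroedinger_op_def schrop_def fun_eq_iff)
  ultimately show ?thesis using that a b by blast
qed

lemma hamiltonian_approx:
  assumes "(u, v) \<in> hamiltonian \<epsilon> V"
  obtains \<phi> \<phi>1 \<phi>2 where "\<And>n::nat. is_C2c (\<phi> n) (\<phi>1 n) (\<phi>2 n)"
    "(\<lambda>n. l2norm (\<lambda>x. \<phi> n x - u x)) \<longlonglongrightarrow> 0"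
    "(\<lambda>n. l2norm (\<lambda>x. schrop \<epsilon> V (\<phi> n) (\<phi>2 n) x - v x)) \<longlonglongrightarrow> 0"
proof -
  from assms obtain \<phi> :: "nat \<Rightarrow> real \<Rightarrow> complex" where
    t: "\<And>n. test_function (\<phi> n)" and l: "(\<lambda>n. l2norm (\<lambda>x. \<phi> n x - u x)) \<longlonglongrightarrow> 0"
    "(\<lambda>n. l2norm (\<lambda>x. schroedinger_op \<epsilon> V (\<phi> n) x - v x)) \<longlonglongrightarrow> 0"
    by (auto simp: hamiltonian_def)
  have "\<exists>f1 f2. is_C2c (\<phi> n) f1 f2 \<and> schroedinger_op \<epsilon> V (\<phi> n) = schrop \<epsilon> V (\<phi> n) f2" for n
    using test_function_C2c[OF t[of n]] by metis
  then obtain \<phi>1 \<phi>2 where "\<And>n. is_C2c (\<phi> n) (\<phi>1 n) (\<phi>2 n)"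
    "\<And>n. schroedinger_op \<epsilon> V (\<phi> n) = schrop \<epsilon> V (\<phi> n) (\<phi>2 n)" by metis
  with l show ?thesis by (intro that[of \<phi> \<phi>1 \<phi>2]) auto
qed

lemma hamiltonian_L2: "(u, v) \<in> hamiltonian \<epsilon> V \<Longrightarrow> u \<in> L2" "(u, v) \<in> hamiltonian \<epsilon> V \<Longrightarrow> v \<in> L2"
  by (auto simp: hamiltonian_def)

text \<open>Approximability by continuous functions of compact support is all that is needed of a
  function for its translates to be continuous in $L^2$.\<close>

definition Cc_approx :: "(real \<Rightarrow> complex) \<Rightarrow> bool" where
  "Cc_approx f \<longleftrightarrow> f \<in> L2 \<and> (\<forall>e>0. \<exists>\<phi>. Cc \<phi> \<and> l2norm (\<lambda>x. \<phi> x - f x) < e)"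

text \<open>The image \<open>v\<close> is covered too, since for a continuous potential the
  Schroedinger operator maps C^2 functions of compact support into \<open>Cc\<close>. Hence both a
  solution and its time derivative have translates that are continuous in L^2.\<close>

lemma hamiltonian_Cc_approx:
  assumes "(u, v) \<in> hamiltonian \<epsilon> V" "continuous_on UNIV V"
  shows "Cc_approx u" "Cc_approx v"
proof -
  obtain \<phi> \<phi>1 \<phi>2 where a: "\<And>n::nat. is_C2c (\<phi> n) (\<phi>1 n) (\<phi>2 n)"
    and l: "(\<lambda>n. l2norm (\<lambda>x. \<phi> n x - u x)) \<longlonglongrightarrow> 0"
    "(\<lambda>n. l2norm (\<lambda>x. schrop \<epsilon> V (\<phi> n) (\<phi>2 n) x - v x)) \<longlonglongrightarrow> 0"
    by (rule hamiltonian_approx[OF assms(1)]) (rule that)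
  show "Cc_approx u" unfolding Cc_approx_def
  proof (intro conjI allI impI)
    fix e :: real assume "e > 0"
    from LIMSEQ_D[OF l(1) this] obtain n where "\<forall>m\<ge>n. \<bar>l2norm (\<lambda>x. \<phi> m x - u x)\<bar> < e" by auto
    then have "l2norm (\<lambda>x. \<phi> n x - u x) < e" by (auto simp: l2norm_nonneg)
    then show "\<exists>\<phi>. Cc \<phi> \<and> l2norm (\<lambda>x. \<phi> x - u x) < e" using is_C2c_D(1)[OF a] by blast
  qed (rule hamiltonian_L2(1)[OF assms(1)])
  show "Cc_approx v" unfolding Cc_approx_def
  proof (intro conjI allI impI)
    fix e :: real assume "e > 0"
    from LIMSEQ_D[OF l(2) this] obtain n where
      "\<forall>m\<ge>n. \<bar>l2norm (\<lambda>x. schrop \<epsilon> V (\<phi> m) (\<phi>2 m) x - v x)\<bar> < e" by auto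
    then have "l2norm (\<lambda>x. schrop \<epsilon> V (\<phi> n) (\<phi>2 n) x - v x) < e" by (auto simp: l2norm_nonneg)
    then show "\<exists>\<phi>. Cc \<phi> \<and> l2norm (\<lambda>x. \<phi> x - v x) < e" using schrop_Cc[OF a assms(2)] by blast
  qed (rule hamiltonian_L2(2)[OF assms(1)])
qed

lemma Cc_approx_cmult: assumes "Cc_approx f" shows "Cc_approx (\<lambda>x. c * f x)"
proof (cases "c = 0")
  case True
  have "Cc (\<lambda>_. 0)" by (auto simp: Cc_def)
  then show ?thesis using True L2_zero by (auto simp: Cc_approx_def l2norm_def)
next
  case False
  show ?thesis unfolding Cc_approx_def
  proof (intro conjI allI impI)
    fix e :: real assume "e > 0"
    then obtain \<phi> where p: "Cc \<phi>" "l2norm (\<lambda>x. \<phi> x - f x) < e / norm c"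
      using assms False unfolding Cc_approx_def by (metis divide_pos_pos zero_less_norm_iff)
    have "l2norm (\<lambda>x. c * \<phi> x - c * f x) = norm c * l2norm (\<lambda>x. \<phi> x - f x)"
      by (simp flip: l2norm_cmult add: right_diff_distrib)
    also have "\<dots> < e" using p(2) False by (simp add: field_simps)
    finally show "\<exists>\<phi>. Cc \<phi> \<and> l2norm (\<lambda>x. \<phi> x - c * f x) < e" using Cc_cmult[OF p(1)] by blast
  qed (use assms L2_cmult in \<open>auto simp: Cc_approx_def\<close>)
qed

lemma Cc_translate_tendsto:
  assumes "Cc f"
  shows "((\<lambda>h. l2norm (\<lambda>x. f (x - h) - f x)) \<longlongrightarrow> 0) (at 0)"
proof -
  obtain R where R: "R > 0" "\<And>x. R < \<bar>x\<bar> \<Longrightarrow> f x = 0" using Cc_E[OF assms] by metis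
  have "uniformly_continuous_on {-R-2..R+2} f"
    by (rule compact_uniformly_continuous) (use Cc_continuous[OF assms] continuous_on_subset in auto)
  show ?thesis
  proof (rule LIM_I)
    fix e :: real assume e: "e > 0"
    define e' where "e' = e / (2 * sqrt (2 * (R + 1)))"
    have e': "e' > 0" using e R by (simp add: e'_def)
    from \<open>uniformly_continuous_on _ f\<close> e' obtain d where d: "d > 0"
      "\<And>x y. x \<in> {-R-2..R+2} \<Longrightarrow> y \<in> {-R-2..R+2} \<Longrightarrow> dist y x < d \<Longrightarrow> dist (f y) (f x) < e'"
      unfolding uniformly_continuous_on_def by metis
    show "\<exists>s>0. \<forall>h. h \<noteq> 0 \<and> norm (h - 0) < s \<longrightarrow> norm (l2norm (\<lambda>x. f (x - h) - f x) - 0) < e"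
    proof (intro exI conjI allI impI)
      show "min d 1 > 0" using d by simp
      fix h :: real assume h: "h \<noteq> 0 \<and> norm (h - 0) < min d 1"
      have b: "norm (f (x - h) - f x) \<le> e'" for x
      proof (cases "\<bar>x\<bar> \<le> R + 1")
        case True
        then have "dist (f (x - h)) (f x) < e'" using h by (intro d) (auto simp: dist_real_def)
        then show ?thesis by (simp add: dist_norm)
      next
        case False
        then have "f x = 0" "f (x - h) = 0" using h by (auto intro!: R)
        then show ?thesis using e' by simp
      qed
      have z: "f (x - h) - f x = 0" if "R + 1 < \<bar>x\<bar>" for x
        using that h R(2)[of x] R(2)[of "x - h"] by auto
      have "l2norm (\<lambda>x. f (x - h) - f x) \<le> sqrt (2 * (R + 1)) * e'"
        by (rule l2norm_le_of_bounded_support(2)[OF _ b z])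
          (use R Cc_measurable[OF Cc_diff[OF Cc_translate[OF assms] assms]] in auto)
      also have "\<dots> < e" using e R by (simp add: e'_def)
      finally show "norm (l2norm (\<lambda>x. f (x - h) - f x) - 0) < e" by (simp add: l2norm_nonneg)
    qed
  qed
qed

lemma translate_tendsto:
  assumes "Cc_approx f"
  shows "((\<lambda>h. l2norm (\<lambda>x. f (x - h) - f x)) \<longlongrightarrow> 0) (at 0)"
proof (rule LIM_I)
  fix e :: real assume "e > 0"
  then have "e / 3 > 0" by simp
  then obtain \<phi> where p: "Cc \<phi>" "l2norm (\<lambda>x. \<phi> x - f x) < e / 3"
    using assms unfolding Cc_approx_def by metis
  have f: "f \<in> L2" using assms by (simp add: Cc_approx_def)
  note ph = Cc_L2[OF p(1)]
  from LIM_D[OF Cc_translate_tendsto[OF p(1)] \<open>e/3 > 0\<close>] obtain s where s: "s > 0"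
    "\<And>h. h \<noteq> 0 \<Longrightarrow> \<bar>h\<bar> < s \<Longrightarrow> l2norm (\<lambda>x. \<phi> (x - h) - \<phi> x) < e / 3"
    by (auto simp: l2norm_nonneg)
  show "\<exists>s>0. \<forall>h. h \<noteq> 0 \<and> norm (h - 0) < s \<longrightarrow> norm (l2norm (\<lambda>x. f (x - h) - f x) - 0) < e"
  proof (intro exI conjI allI impI)
    show "s > 0" by fact
    fix h :: real assume h: "h \<noteq> 0 \<and> norm (h - 0) < s"
    have "l2norm (\<lambda>x. f (x - h) - f x) \<le> l2norm (\<lambda>x. f (x - h) - \<phi> (x - h)) + l2norm (\<lambda>x. \<phi> (x - h) - f x)"
      by (rule l2norm_triangle[OF L2_translate[OF f] L2_translate[OF ph] f])
    also have "l2norm (\<lambda>x. \<phi> (x - h) - f x) \<le> l2norm (\<lambda>x. \<phi> (x - h) - \<phi> x) + l2norm (\<lambda>x. \<phi> x - f x)"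
      by (rule l2norm_triangle[OF L2_translate[OF ph] ph f])
    also have "l2norm (\<lambda>x. f (x - h) - \<phi> (x - h)) = l2norm (\<lambda>x. \<phi> x - f x)"
      using l2norm_translate[of "\<lambda>x. f x - \<phi> x" h] l2norm_minus_commute[of f \<phi>] by simp
    finally show "norm (l2norm (\<lambda>x. f (x - h) - f x) - 0) < e"
      using p(2) s(2)[of h] h by (simp add: l2norm_nonneg)
  qed
qed

lemma tform_isCont:
  assumes f: "Cc_approx f" and g: "g \<in> L2" and h: "h \<in> borel_measurable borel" "\<And>x. norm (h x) \<le> C"
  shows "isCont (\<lambda>r. tform h r f g) r"
proof -
  have fL: "f \<in> L2" using f by (simp add: Cc_approx_def)
  have le: "norm (tform h (r + s) f g - tform h r f g) \<le> C * (l2norm (\<lambda>x. f (x - s) - f x) * l2norm g)" for s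
  proof -
    have "tform h (r + s) f g = tform h r (\<lambda>x. f (x - s)) g" by (simp add: tform_def diff_diff_eq)
    then have "tform h (r + s) f g - tform h r f g = tform h r (\<lambda>x. f (x - s) - f x) g"
      using tform_diff[OF L2_translate[OF fL, of s] g fL g h, of r]
      by (simp add: tform_def)
    then show ?thesis using tform_le[OF L2_diff[OF L2_translate[OF fL] fL] g h] by simp
  qed
  have "((\<lambda>s. tform h (r + s) f g - tform h r f g) \<longlongrightarrow> 0) (at 0)"
  proof (rule Lim_null_comparison)
    show "\<forall>\<^sub>F s in at 0. norm (tform h (r + s) f g - tform h r f g) \<le> C * (l2norm (\<lambda>x. f (x - s) - f x) * l2norm g)"
      using le by simp
    have "((\<lambda>s. C * (l2norm (\<lambda>x. f (x - s) - f x) * l2norm g)) \<longlongrightarrow> C * (0 * l2norm g)) (at 0)"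
      by (intro tendsto_intros translate_tendsto[OF f])
    then show "((\<lambda>s. C * (l2norm (\<lambda>x. f (x - s) - f x) * l2norm g)) \<longlongrightarrow> 0) (at 0)" by simp
  qed
  then have "((\<lambda>s. tform h (r + s) f g) \<longlongrightarrow> tform h r f g) (at 0)" by (simp add: LIM_zero_iff)
  then show ?thesis by (simp add: isCont_iff)
qed

section \<open>Differentiation in $L^2$\<close>

definition l2_deriv :: "(real \<Rightarrow> real \<Rightarrow> complex) \<Rightarrow> (real \<Rightarrow> complex) \<Rightarrow> real \<Rightarrow> bool" where
  "l2_deriv f f' t \<longleftrightarrow> ((\<lambda>h. l2norm (\<lambda>x. (f (t + h) x - f t x) / of_real h - f' x)) \<longlongrightarrow> 0) (at 0)"

lemma l2_deriv_const: "l2_deriv (\<lambda>_. f) (\<lambda>_. 0) t"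
  by (simp add: l2_deriv_def l2norm_def)

lemma has_vector_derivative_iff_quotient:
  fixes f :: "real \<Rightarrow> complex"
  shows "(f has_vector_derivative D) (at t) \<longleftrightarrow> ((\<lambda>h. (f (t + h) - f t) / of_real h) \<longlongrightarrow> D) (at 0)"
proof -
  have "(f has_vector_derivative D) (at t) \<longleftrightarrow>
      ((\<lambda>h. norm (f (t + h) - f t - h *\<^sub>R D) / norm h) \<longlongrightarrow> 0) (at 0)"
    by (simp add: has_vector_derivative_def has_derivative_at bounded_linear_scaleR_left)
  also have "\<dots> \<longleftrightarrow> ((\<lambda>h. norm ((f (t + h) - f t) / of_real h - D)) \<longlongrightarrow> 0) (at 0)"
  proof (rule filterlim_cong[OF refl refl], rule eventually_at_filter[THEN iffD2], intro always_eventually allI impI)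
    fix h :: real assume "h \<noteq> 0"
    then have "(f (t + h) - f t) / of_real h - D = (f (t + h) - f t - h *\<^sub>R D) / of_real h"
      by (simp add: field_simps scaleR_conv_of_real)
    then show "norm (f (t + h) - f t - h *\<^sub>R D) / norm h = norm ((f (t + h) - f t) / of_real h - D)"
      by (simp add: norm_divide)
  qed
  also have "\<dots> \<longleftrightarrow> ((\<lambda>h. (f (t + h) - f t) / of_real h) \<longlongrightarrow> D) (at 0)"
    by (simp add: tendsto_norm_zero_iff LIM_zero_iff)
  finally show ?thesis .
qed

lemma l2_deriv_quotient_L2:
  assumes "\<And>s. f s \<in> L2"
  shows "(\<lambda>x. (f s x - f t x) / of_real h) \<in> L2"
  using L2_cmult[OF L2_diff[OF assms[of s] assms[of t]], of "1 / of_real h"] by simp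

lemma l2_deriv_continuous:
  assumes f: "\<And>s. f s \<in> L2" "f' \<in> L2" and d: "l2_deriv f f' t"
  shows "((\<lambda>h. l2norm (\<lambda>x. f (t + h) x - f t x)) \<longlongrightarrow> 0) (at 0)"
proof (rule tendsto_sandwich)
  let ?q = "\<lambda>h x. (f (t + h) x - f t x) / of_real h"
  show "\<forall>\<^sub>F h in at 0. 0 \<le> l2norm (\<lambda>x. f (t + h) x - f t x)" by (simp add: l2norm_nonneg)
  show "\<forall>\<^sub>F h in at 0. l2norm (\<lambda>x. f (t + h) x - f t x) \<le> \<bar>h\<bar> * (l2norm (\<lambda>x. ?q h x - f' x) + l2norm f')"
  proof (rule eventually_at_filter[THEN iffD2], intro always_eventually allI impI)
    fix h :: real assume h: "h \<noteq> 0"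
    then have "l2norm (\<lambda>x. f (t + h) x - f t x) = l2norm (\<lambda>x. of_real h * ?q h x)" by simp
    also have "\<dots> = \<bar>h\<bar> * l2norm (?q h)" unfolding l2norm_cmult by simp
    also have "l2norm (?q h) \<le> l2norm (\<lambda>x. ?q h x - f' x) + l2norm f'"
      using l2norm_add_le[OF L2_diff[OF l2_deriv_quotient_L2[of f, OF f(1)] f(2)] f(2)] by simp
    finally show "l2norm (\<lambda>x. f (t + h) x - f t x) \<le> \<bar>h\<bar> * (l2norm (\<lambda>x. ?q h x - f' x) + l2norm f')"
      by (simp add: mult_left_mono)
  qed
  have "((\<lambda>h. \<bar>h\<bar> * (l2norm (\<lambda>x. ?q h x - f' x) + l2norm f')) \<longlongrightarrow> \<bar>0\<bar> * (0 + l2norm f')) (at 0)"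
    using d unfolding l2_deriv_def by (intro tendsto_intros)
  then show "((\<lambda>h. \<bar>h\<bar> * (l2norm (\<lambda>x. ?q h x - f' x) + l2norm f')) \<longlongrightarrow> 0) (at 0)" by simp
qed auto

lemma tform_cmult_left: "tform h r (\<lambda>x. c * f x) g = c * tform h r f g"
proof -
  have "(\<lambda>x. h x * (c * f (x - r)) * cnj (g x)) = (\<lambda>x. c * (h x * f (x - r) * cnj (g x)))"
    by (simp add: mult_ac)
  then show ?thesis by (simp add: tform_def)
qed

lemma tform_cmult_right: "tform h r f (\<lambda>x. c * g x) = cnj c * tform h r f g"
proof -
  have "(\<lambda>x. h x * f (x - r) * cnj (c * g x)) = (\<lambda>x. cnj c * (h x * f (x - r) * cnj (g x)))"
    by (simp add: mult_ac)
  then show ?thesis by (simp add: tform_def)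
qed

text \<open>Translation of a general L^2 function is continuous but not differentiable. The
  derivative in the translation parameter, with both functions frozen, is therefore the separate
  hypothesis \<open>K\<close>; the time derivatives of the functions ask only for the continuity in
  \<open>c1\<close> and \<open>c2\<close>.\<close>

lemma tform_product_rule:
  assumes f: "\<And>s. f s \<in> L2" "f' \<in> L2" "l2_deriv f f' t"
    and g: "\<And>s. g s \<in> L2" "g' \<in> L2" "l2_deriv g g' t"
    and h: "h \<in> borel_measurable borel" "\<And>x. norm (h x) \<le> C"
    and K: "((\<lambda>s. tform h (\<rho> s) (f t) (g t)) has_vector_derivative K') (at t)"
    and c1: "isCont (\<lambda>s. tform h (\<rho> s) f' (g t)) t"
    and c2: "isCont (\<lambda>s. tform h (\<rho> s) (f t) g') t"
  shows "((\<lambda>s. tform h (\<rho> s) (f s) (g s)) has_vector_derivative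
      K' + tform h (\<rho> t) f' (g t) + tform h (\<rho> t) (f t) g') (at t)"
  unfolding has_vector_derivative_iff_quotient
proof -
  let ?qf = "\<lambda>\<eta> x. (f (t + \<eta>) x - f t x) / of_real \<eta>"
  let ?qg = "\<lambda>\<eta> x. (g (t + \<eta>) x - g t x) / of_real \<eta>"
  let ?r = "\<lambda>\<eta>. \<rho> (t + \<eta>)"
  let ?k = "\<lambda>\<eta>. (tform h (?r \<eta>) (f t) (g t) - tform h (\<rho> t) (f t) (g t)) / of_real \<eta>"
  note qf = l2_deriv_quotient_L2[of f, OF f(1)] and qg = l2_deriv_quotient_L2[of g, OF g(1)]
  have C: "C \<ge> 0" using h(2)[of 0] norm_ge_zero order_trans by blast
  note gc = l2_deriv_continuous[OF g(1) g(2) g(3)]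
  have 1: "((\<lambda>\<eta>. tform h (?r \<eta>) (?qf \<eta>) (g (t + \<eta>)) - tform h (?r \<eta>) f' (g t)) \<longlongrightarrow> 0) (at 0)"
  proof (rule Lim_null_comparison)
    show "\<forall>\<^sub>F \<eta> in at 0. norm (tform h (?r \<eta>) (?qf \<eta>) (g (t + \<eta>)) - tform h (?r \<eta>) f' (g t)) \<le>
       C * (l2norm (\<lambda>x. ?qf \<eta> x - f' x) * (l2norm (g t) + l2norm (\<lambda>x. g (t + \<eta>) x - g t x)) +
            l2norm f' * l2norm (\<lambda>x. g (t + \<eta>) x - g t x))"
    proof (intro always_eventually allI)
      fix \<eta>
      have "l2norm (g (t + \<eta>)) \<le> l2norm (g t) + l2norm (\<lambda>x. g (t + \<eta>) x - g t x)"
        using l2norm_add_le[OF g(1)[of t] L2_diff[OF g(1)[of "t + \<eta>"] g(1)[of t]]] by simp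
      then show "norm (tform h (?r \<eta>) (?qf \<eta>) (g (t + \<eta>)) - tform h (?r \<eta>) f' (g t)) \<le>
       C * (l2norm (\<lambda>x. ?qf \<eta> x - f' x) * (l2norm (g t) + l2norm (\<lambda>x. g (t + \<eta>) x - g t x)) +
            l2norm f' * l2norm (\<lambda>x. g (t + \<eta>) x - g t x))"
        by (intro order_trans[OF tform_diff_le[OF qf g(1) f(2) g(1) h]] mult_left_mono add_right_mono l2norm_nonneg C)
    qed
    have "((\<lambda>\<eta>. C * (l2norm (\<lambda>x. ?qf \<eta> x - f' x) * (l2norm (g t) + l2norm (\<lambda>x. g (t + \<eta>) x - g t x)) +
            l2norm f' * l2norm (\<lambda>x. g (t + \<eta>) x - g t x))) \<longlongrightarrow> C * (0 * (l2norm (g t) + 0) + l2norm f' * 0)) (at 0)"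
      using f(3) gc unfolding l2_deriv_def by (intro tendsto_intros)
    then show "((\<lambda>\<eta>. C * (l2norm (\<lambda>x. ?qf \<eta> x - f' x) * (l2norm (g t) + l2norm (\<lambda>x. g (t + \<eta>) x - g t x)) +
            l2norm f' * l2norm (\<lambda>x. g (t + \<eta>) x - g t x))) \<longlongrightarrow> 0) (at 0)" by simp
  qed
  have 2: "((\<lambda>\<eta>. tform h (?r \<eta>) (f t) (?qg \<eta>) - tform h (?r \<eta>) (f t) g') \<longlongrightarrow> 0) (at 0)"
  proof (rule Lim_null_comparison)
    show "\<forall>\<^sub>F \<eta> in at 0. norm (tform h (?r \<eta>) (f t) (?qg \<eta>) - tform h (?r \<eta>) (f t) g') \<le>
       C * (l2norm (f t) * l2norm (\<lambda>x. ?qg \<eta> x - g' x))"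
      using tform_diff_le[OF f(1)[of t] qg f(1)[of t] g(2) h] by (simp add: l2norm_def)
    have "((\<lambda>\<eta>. C * (l2norm (f t) * l2norm (\<lambda>x. ?qg \<eta> x - g' x))) \<longlongrightarrow> C * (l2norm (f t) * 0)) (at 0)"
      using g(3) unfolding l2_deriv_def by (intro tendsto_intros)
    then show "((\<lambda>\<eta>. C * (l2norm (f t) * l2norm (\<lambda>x. ?qg \<eta> x - g' x))) \<longlongrightarrow> 0) (at 0)" by simp
  qed
  have c1': "((\<lambda>\<eta>. tform h (?r \<eta>) f' (g t)) \<longlongrightarrow> tform h (\<rho> t) f' (g t)) (at 0)"
    using c1 by (simp add: isCont_iff)
  have c2': "((\<lambda>\<eta>. tform h (?r \<eta>) (f t) g') \<longlongrightarrow> tform h (\<rho> t) (f t) g') (at 0)"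
    using c2 by (simp add: isCont_iff)
  have K'': "(?k \<longlongrightarrow> K') (at 0)"
    using K unfolding has_vector_derivative_iff_quotient .
  \<comment> \<open>The increment telescopes: the translation moves with both functions frozen
    (\<open>?k\<close>), then, at the new translation, the first function moves against the new
    second one, and finally the second against the old first one.\<close>
  have "((\<lambda>\<eta>. ?k \<eta> + tform h (?r \<eta>) (?qf \<eta>) (g (t + \<eta>)) + tform h (?r \<eta>) (f t) (?qg \<eta>))
      \<longlongrightarrow> K' + tform h (\<rho> t) f' (g t) + tform h (\<rho> t) (f t) g') (at 0)"
    using Lim_transform[OF c1' 1] Lim_transform[OF c2' 2] K'' by (intro tendsto_intros)
  then show "((\<lambda>\<eta>. (tform h (\<rho> (t + \<eta>)) (f (t + \<eta>)) (g (t + \<eta>)) - tform h (\<rho> t) (f t) (g t)) / of_real \<eta>)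
      \<longlongrightarrow> K' + tform h (\<rho> t) f' (g t) + tform h (\<rho> t) (f t) g') (at 0)"
  proof (rule Lim_transform_eventually, intro eventually_at_filter[THEN iffD2] always_eventually allI impI)
    fix \<eta> :: real assume \<eta>: "\<eta> \<noteq> 0"
    have a: "tform h (?r \<eta>) (?qf \<eta>) (g (t + \<eta>)) =
        tform h (?r \<eta>) (\<lambda>x. f (t + \<eta>) x - f t x) (g (t + \<eta>)) / of_real \<eta>"
      using tform_cmult_left[of h "?r \<eta>" "1 / of_real \<eta>" "\<lambda>x. f (t + \<eta>) x - f t x" "g (t + \<eta>)"] by simp
    have b: "tform h (?r \<eta>) (f t) (?qg \<eta>) =
        tform h (?r \<eta>) (f t) (\<lambda>x. g (t + \<eta>) x - g t x) / of_real \<eta>"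
      using tform_cmult_right[of h "?r \<eta>" "f t" "1 / of_real \<eta>" "\<lambda>x. g (t + \<eta>) x - g t x"] by simp
    have "tform h (?r \<eta>) (f (t + \<eta>)) (g (t + \<eta>)) - tform h (?r \<eta>) (f t) (g t) =
      tform h (?r \<eta>) (\<lambda>x. f (t + \<eta>) x - f t x) (g (t + \<eta>)) + tform h (?r \<eta>) (f t) (\<lambda>x. g (t + \<eta>) x - g t x)"
      by (rule tform_diff[OF f(1) g(1) f(1) g(1) h])
    then show "?k \<eta> + tform h (?r \<eta>) (?qf \<eta>) (g (t + \<eta>)) + tform h (?r \<eta>) (f t) (?qg \<eta>) =
      (tform h (\<rho> (t + \<eta>)) (f (t + \<eta>)) (g (t + \<eta>)) - tform h (\<rho> t) (f t) (g t)) / of_real \<eta>"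
      unfolding a b by (simp add: field_simps \<eta>)
  qed
qed

text \<open>The support is bounded uniformly for times within 1 of \<open>t\<close>. Uniform
  continuity of \<open>f'\<close> on a compact box and the mean value inequality then give uniform
  convergence of the difference quotients, hence convergence in L^2.\<close>

lemma l2_deriv_smooth:
  fixes f f' :: "real \<Rightarrow> real \<Rightarrow> complex"
  assumes d: "\<And>s x. ((\<lambda>s. f s x) has_vector_derivative f' s x) (at s)"
    and c: "continuous_on UNIV (\<lambda>p. f' (fst p) (snd p))"
    and z: "\<And>s x. \<bar>s - t\<bar> \<le> 1 \<Longrightarrow> R < \<bar>x\<bar> \<Longrightarrow> f s x = 0"
    and m: "\<And>s. f s \<in> borel_measurable borel"
  shows "l2_deriv f (f' t) t"
proof -
  define S where "S = max R 0 + 1"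
  have S: "S > 0" "R < S" by (auto simp: S_def)
  have m': "f' t \<in> borel_measurable borel"
    by (rule borel_measurable_continuous_onI, rule continuous_on_compose2[OF c, of _ "\<lambda>x. (t, x)", simplified])
      (auto intro!: continuous_intros)
  have z': "f' t x = 0" if "R < \<bar>x\<bar>" for x
  proof -
    have "((\<lambda>_. 0) has_vector_derivative f' t x) (at t)"
      by (rule has_vector_derivative_transform_within_open[OF d, where S = "ball t 1"])
        (use z that in \<open>auto simp: dist_real_def abs_minus_commute\<close>)
    then show ?thesis using vector_derivative_unique_at has_vector_derivative_const by metis
  qed
  have "uniformly_continuous_on ({t-1..t+1} \<times> {-S..S}) (\<lambda>p. f' (fst p) (snd p))"
    by (rule compact_uniformly_continuous) (use c continuous_on_subset in \<open>auto intro: compact_Times\<close>)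
  note uc = this
  show ?thesis unfolding l2_deriv_def
  proof (rule LIM_I)
    fix e :: real assume e: "e > 0"
    define e' where "e' = e / (2 * sqrt (2 * S))"
    have e': "e' > 0" using e S by (simp add: e'_def)
    from uc e' obtain d0 where d0: "d0 > 0"
      "\<And>p q. p \<in> {t-1..t+1} \<times> {-S..S} \<Longrightarrow> q \<in> {t-1..t+1} \<times> {-S..S} \<Longrightarrow> dist q p < d0 \<Longrightarrow>
        dist (f' (fst q) (snd q)) (f' (fst p) (snd p)) < e'"
      unfolding uniformly_continuous_on_def by metis
    define s where "s = min d0 1"
    show "\<exists>s>0. \<forall>h. h \<noteq> 0 \<and> norm (h - 0) < s \<longrightarrow>
        norm (l2norm (\<lambda>x. (f (t + h) x - f t x) / of_real h - f' t x) - 0) < e"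
    proof (intro exI conjI allI impI)
      show "s > 0" using d0 by (simp add: s_def)
      fix h :: real assume h: "h \<noteq> 0 \<and> norm (h - 0) < s"
      then have hs: "\<bar>h\<bar> < d0" "\<bar>h\<bar> < 1" "h \<noteq> 0" by (auto simp: s_def)
      have zz: "(f (t + h) x - f t x) / of_real h - f' t x = 0" if "S < \<bar>x\<bar>" for x
        using z[of t x] z[of "t + h" x] z'[of x] that S hs by auto
      have b: "norm ((f (t + h) x - f t x) / of_real h - f' t x) \<le> e'" for x
      proof (cases "\<bar>x\<bar> \<le> S")
        case True
        have "norm (f (t + h) x - f t x - ((t + h) - t) *\<^sub>R f' t x) \<le> norm ((t + h) - t) * e'"
        proof (rule vector_differentiable_bound_linearization[where S = "closed_segment t (t + h)" and f' = "\<lambda>s. f' s x" and ?x0.0 = t])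
          show "((\<lambda>s. f s x) has_vector_derivative f' s x) (at s within closed_segment t (t + h))" for s
            using d has_vector_derivative_at_within by blast
          fix s assume "s \<in> closed_segment t (t + h)"
          then have "\<bar>s - t\<bar> \<le> \<bar>h\<bar>"
            by (auto simp: closed_segment_eq_real_ivl split: if_splits)
          then have "dist (f' (fst (s, x)) (snd (s, x))) (f' (fst (t, x)) (snd (t, x))) < e'"
            using hs True by (intro d0) (auto simp: dist_Pair_Pair dist_real_def)
          then show "norm (f' s x - f' t x) \<le> e'" by (simp add: dist_norm)
        qed auto
        moreover have "(f (t + h) x - f t x) / of_real h - f' t x = (f (t + h) x - f t x - h *\<^sub>R f' t x) / of_real h"
          using hs by (simp add: field_simps scaleR_conv_of_real)
        ultimately show ?thesis using hs by (simp add: norm_divide field_simps)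
      next
        case False then show ?thesis using zz e' by simp
      qed
      have "l2norm (\<lambda>x. (f (t + h) x - f t x) / of_real h - f' t x) \<le> sqrt (2 * S) * e'"
        by (rule l2norm_le_of_bounded_support(2)[OF _ b zz less_imp_le[OF S(1)]]) (use m m' in measurable)
      also have "\<dots> < e" using e S by (simp add: e'_def)
      finally show "norm (l2norm (\<lambda>x. (f (t + h) x - f t x) / of_real h - f' t x) - 0) < e"
        by (simp add: l2norm_nonneg)
    qed
  qed
qed

section \<open>Weyl operators and the Hamiltonian\<close>

definition character :: "real \<Rightarrow> real \<Rightarrow> complex" where
  "character k x = exp (\<i> * of_real (k * x))"

lemma norm_character [simp]: "norm (character k x) = 1"
  by (simp add: character_def)

lemma continuous_character: "continuous_on UNIV (character k)"
  unfolding character_def by (intro continuous_intros)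

lemma measurable_character [measurable]: "character k \<in> borel_measurable borel"
  by (rule borel_measurable_continuous_onI[OF continuous_character])

lemma character_has_derivative: "(character k has_vector_derivative \<i> * of_real k * character k x) (at x)"
proof -
  have "((\<lambda>x. exp (\<i> * of_real k * of_real x)) has_vector_derivative (\<i> * of_real k) * exp (\<i> * of_real k * of_real x)) (at x)"
    by (rule has_vector_derivative_real_field) (auto intro!: derivative_eq_intros)
  then show ?thesis by (simp add: character_def[abs_def] mult.assoc)
qed

lemma is_C2c_translate:
  assumes "is_C2c f f1 f2"
  shows "is_C2c (\<lambda>x. f (x - r)) (\<lambda>x. f1 (x - r)) (\<lambda>x. f2 (x - r))"
proof -
  note F = is_C2c_D[OF assms]
  have d: "((\<lambda>x. g (x - r)) has_vector_derivative g' (x - r)) (at x)"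
    if "\<And>x. (g has_vector_derivative g' x) (at x)" for g g' :: "real \<Rightarrow> complex" and x
  proof -
    have "((\<lambda>x. x - r) has_vector_derivative 1) (at x)"
      by (auto simp flip: has_real_derivative_iff_has_vector_derivative intro!: derivative_eq_intros)
    from vector_diff_chain_at[OF this that] show ?thesis by (simp add: o_def)
  qed
  show ?thesis unfolding is_C2c_def
    using Cc_translate[OF F(1)] Cc_continuous[OF Cc_translate[OF F(3)]] d[OF F(4)] d[OF F(5)] by blast
qed

lemma is_C2c_character:
  assumes "is_C2c f f1 f2"
  shows "is_C2c (\<lambda>x. character k x * f x) (\<lambda>x. character k x * (f1 x + \<i> * of_real k * f x))
     (\<lambda>x. character k x * (f2 x + 2 * \<i> * of_real k * f1 x - of_real (k\<^sup>2) * f x))"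
proof -
  note F = is_C2c_D[OF assms]
  have d1: "((\<lambda>x. character k x * f x) has_vector_derivative character k x * (f1 x + \<i> * of_real k * f x)) (at x)" for x
    by (rule has_vector_derivative_eq_rhs[OF has_vector_derivative_mult[OF character_has_derivative F(4)]])
      (simp add: algebra_simps)
  have d2: "((\<lambda>x. character k x * (f1 x + \<i> * of_real k * f x)) has_vector_derivative
      character k x * (f2 x + 2 * \<i> * of_real k * f1 x - of_real (k\<^sup>2) * f x)) (at x)" for x
    by (rule has_vector_derivative_eq_rhs[OF has_vector_derivative_mult[OF character_has_derivative
          has_vector_derivative_add[OF F(5) has_vector_derivative_mult_right[OF F(4)]]]])
      (simp add: algebra_simps power2_eq_square)
  show ?thesis unfolding is_C2c_def
    using d1 d2 Cc_mult[OF F(1) continuous_character]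
    by (intro conjI allI continuous_on_mult continuous_on_add continuous_on_diff continuous_on_const
        continuous_character Cc_continuous F(1-3)) auto
qed

text \<open>The kinetic term is quadratic in the derivative, so its commutator with a Weyl operator
  is of first order, while the translation displaces the potential and leaves \<open>Q\<close>. Read
  backwards, the identity expresses the form with \<open>f1\<close> through the operator itself; in
  that shape it survives the passage to the closure.\<close>

lemma commutator_C2c:
  fixes k r :: real and V :: "real \<Rightarrow> real"
  assumes f: "is_C2c f f1 f2" and V: "continuous_on UNIV V"
  defines "Q \<equiv> \<lambda>x. character k x * of_real (V (x - r) - V x)"
  shows "tform (character k) r (schrop \<epsilon> V f f2) f - tform (character k) r f (schrop \<epsilon> V f f2) =
    of_real (\<epsilon>\<^sup>2) * \<i> * of_real k * tform (character k) r f1 f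
    - of_real (\<epsilon>\<^sup>2 * k\<^sup>2 / 2) * tform (character k) r f f + tform Q r f f"
proof -
  note F = is_C2c_D[OF f]
  let ?e = "character k"
  let ?c = "complex_of_real (\<epsilon>\<^sup>2 / 2)"
  have i: "integrable lborel (\<lambda>x. u x * (g (x - r) * cnj (h x)))" if "continuous_on UNIV u" "Cc g" "Cc h" for u g h
    using Cc_integrable[OF Cc_mult[OF Cc_mult[OF Cc_translate[OF that(2)] continuous_on_cnj[OF Cc_continuous[OF that(3)]]] that(1)]]
    by (simp add: mult_ac)
  have cV: "continuous_on UNIV (\<lambda>x. complex_of_real (V x))" using V by (intro continuous_intros)
  have cVr: "continuous_on UNIV (\<lambda>x. complex_of_real (V (x - r)))"
    by (intro continuous_intros continuous_on_compose2[OF V]) auto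
  define I where "I = (\<lambda>u g h. LINT x|lborel. u x * (g (x - r) * cnj (h x)))"
  have lin: "I u g h = (LINT x|lborel. u x * (g (x - r) * cnj (h x)))" for u g h by (simp add: I_def)
  have t1: "tform ?e r (schrop \<epsilon> V f f2) f = - ?c * I ?e f2 f + I (\<lambda>x. ?e x * of_real (V (x - r))) f f"
  proof -
    have "tform ?e r (schrop \<epsilon> V f f2) f = (LINT x|lborel. - ?c * (?e x * (f2 (x - r) * cnj (f x))) +
        (?e x * of_real (V (x - r))) * (f (x - r) * cnj (f x)))"
      unfolding tform_def schrop_def by (intro Bochner_Integration.integral_cong refl) (simp add: algebra_simps)
    also have "\<dots> = (LINT x|lborel. - ?c * (?e x * (f2 (x - r) * cnj (f x)))) +
        (LINT x|lborel. (?e x * of_real (V (x - r))) * (f (x - r) * cnj (f x)))"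
      using i[OF continuous_character F(3) F(1)] i[OF continuous_on_mult[OF continuous_character cVr] F(1) F(1)]
      by (intro Bochner_Integration.integral_add integrable_mult_right)
    finally show ?thesis unfolding I_def by (simp only: integral_mult_right_zero)
  qed
  have t2: "tform ?e r f (schrop \<epsilon> V f f2) = - ?c * I ?e f f2 + I (\<lambda>x. ?e x * of_real (V x)) f f"
  proof -
    have "tform ?e r f (schrop \<epsilon> V f f2) = (LINT x|lborel. - ?c * (?e x * (f (x - r) * cnj (f2 x))) +
        (?e x * of_real (V x)) * (f (x - r) * cnj (f x)))"
      unfolding tform_def schrop_def by (intro Bochner_Integration.integral_cong refl) (simp add: algebra_simps)
    also have "\<dots> = (LINT x|lborel. - ?c * (?e x * (f (x - r) * cnj (f2 x)))) +
        (LINT x|lborel. (?e x * of_real (V x)) * (f (x - r) * cnj (f x)))"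
      using i[OF continuous_character F(1) F(3)] i[OF continuous_on_mult[OF continuous_character cV] F(1) F(1)]
      by (intro Bochner_Integration.integral_add integrable_mult_right)
    finally show ?thesis unfolding I_def by (simp only: integral_mult_right_zero)
  qed
  \<comment> \<open>Both derivatives are moved onto the character times the translate; the product
    rule there produces the term with \<open>2 * \<i> * k\<close> and the term with k^2.\<close>
  have t3: "I ?e f f2 = I ?e f2 f + (2 * \<i> * of_real k) * I ?e f1 f - of_real (k\<^sup>2) * I ?e f f"
  proof -
    have "I ?e f f2 = (LINT x|lborel. (?e x * (f2 (x - r) + 2 * \<i> * of_real k * f1 (x - r) - of_real (k\<^sup>2) * f (x - r))) * cnj (f x))"
      unfolding I_def using ibp2(1)[OF is_C2c_character[OF is_C2c_translate[OF f, of r], of k] f]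
      by (simp add: mult.assoc)
    also have "\<dots> = (LINT x|lborel. ?e x * (f2 (x - r) * cnj (f x)) + (2 * \<i> * of_real k) * (?e x * (f1 (x - r) * cnj (f x)))
        - of_real (k\<^sup>2) * (?e x * (f (x - r) * cnj (f x))))"
      by (intro Bochner_Integration.integral_cong refl) (simp add: algebra_simps)
    also have "\<dots> = (LINT x|lborel. ?e x * (f2 (x - r) * cnj (f x))) + (LINT x|lborel. (2 * \<i> * of_real k) * (?e x * (f1 (x - r) * cnj (f x))))
        - (LINT x|lborel. of_real (k\<^sup>2) * (?e x * (f (x - r) * cnj (f x))))"
      using i[OF continuous_character F(3) F(1)] i[OF continuous_character F(2) F(1)] i[OF continuous_character F(1) F(1)]
      by (subst Bochner_Integration.integral_diff; (subst Bochner_Integration.integral_add)?)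
        (auto intro!: integrable_mult_right Bochner_Integration.integrable_add simp del: of_real_power)
    finally show ?thesis unfolding I_def by (simp only: integral_mult_right_zero)
  qed
  have t4: "tform Q r f f = I (\<lambda>x. ?e x * of_real (V (x - r))) f f - I (\<lambda>x. ?e x * of_real (V x)) f f"
  proof -
    have "tform Q r f f = (LINT x|lborel. (?e x * of_real (V (x - r))) * (f (x - r) * cnj (f x))
      - (?e x * of_real (V x)) * (f (x - r) * cnj (f x)))"
      unfolding tform_def Q_def by (intro Bochner_Integration.integral_cong refl) (simp add: algebra_simps)
    then show ?thesis unfolding I_def
      using i[OF continuous_on_mult[OF continuous_character cVr] F(1) F(1)]
        i[OF continuous_on_mult[OF continuous_character cV] F(1) F(1)]
      by (simp add: Bochner_Integration.integral_diff)
  qed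
  have t5: "tform ?e r f1 f = I ?e f1 f" "tform ?e r f f = I ?e f f"
    unfolding tform_def I_def by (simp_all add: mult.assoc)
  show ?thesis unfolding t1 t2 t3 t4 t5 by (simp add: field_simps)
qed

text \<open>The translation is hidden in the first argument as a smooth family, while the form keeps
  the translation parameter 0; the hypothesis on the translation in the product rule then becomes
  trivial.\<close>

lemma tform_translation_derivative:
  assumes f: "is_C2c f f1 f2" and h: "h \<in> borel_measurable borel" "\<And>x. norm (h x) \<le> C"
  shows "((\<lambda>r. tform h r f f) has_vector_derivative - tform h r f1 f) (at r)"
proof -
  note F = is_C2c_D[OF f]
  obtain R where R: "\<And>x. R < \<bar>x\<bar> \<Longrightarrow> f x = 0" using Cc_E[OF F(1)] by metis
  have d: "l2_deriv (\<lambda>s x. f (x - s)) (\<lambda>x. - f1 (x - r)) r"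
  proof (rule l2_deriv_smooth[where R = "R + \<bar>r\<bar> + 1"])
    fix s x
    show "((\<lambda>s. f (x - s)) has_vector_derivative - f1 (x - s)) (at s)"
    proof -
      have "((\<lambda>s. x - s) has_vector_derivative - 1) (at s)"
        by (auto simp flip: has_real_derivative_iff_has_vector_derivative intro!: derivative_eq_intros)
      from vector_diff_chain_at[OF this F(4)] show ?thesis by (simp add: o_def)
    qed
    show "\<bar>s - r\<bar> \<le> 1 \<Longrightarrow> R + \<bar>r\<bar> + 1 < \<bar>x\<bar> \<Longrightarrow> f (x - s) = 0" by (rule R) auto
    show "(\<lambda>x. f (x - s)) \<in> borel_measurable borel" by (rule Cc_measurable[OF Cc_translate[OF F(1)]])
  next
    show "continuous_on UNIV (\<lambda>p. - f1 (snd p - fst p))"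
      by (intro continuous_intros continuous_on_compose2[OF Cc_continuous[OF F(2)]]) auto
  qed
  have "((\<lambda>s. tform h 0 (\<lambda>x. f (x - s)) f) has_vector_derivative
      0 + tform h 0 (\<lambda>x. - f1 (x - r)) f + tform h 0 (\<lambda>x. f (x - r)) (\<lambda>_. 0)) (at r)"
    by (rule tform_product_rule[OF _ _ d _ _ l2_deriv_const h])
      (use F(1,2) Cc_L2 in \<open>auto intro!: L2_translate L2_zero L2_cmult[of "\<lambda>x. f1 (x - r)" "-1", simplified]\<close>)
  then show ?thesis by (simp add: tform_def)
qed

text \<open>Approximants of class C^2 are allowed here, not only test functions, because the lemma
  is applied to approximants from which a fixed C^2 function has been subtracted.\<close>

lemma schrop_symmetric_limit:
  assumes a: "\<And>n::nat. is_C2c (\<phi> n) (\<phi>1 n) (\<phi>2 n)"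
    and l: "(\<lambda>n. l2norm (\<lambda>x. \<phi> n x - u x)) \<longlonglongrightarrow> 0"
    "(\<lambda>n. l2norm (\<lambda>x. schrop \<epsilon> V (\<phi> n) (\<phi>2 n) x - v x)) \<longlonglongrightarrow> 0"
    and uL: "u \<in> L2" and vL: "v \<in> L2" and V: "continuous_on UNIV V"
  shows "Im (ip v u) = 0"
proof -
  let ?H = "\<lambda>n. schrop \<epsilon> V (\<phi> n) (\<phi>2 n)"
  note pL = Cc_L2[OF is_C2c_D(1)[OF a]] and HL = Cc_L2[OF schrop_Cc[OF a V]]
  have "(\<lambda>n. Im (ip (?H n) (\<phi> n)) - Im (ip v u)) \<longlonglongrightarrow> 0"
  proof (rule Lim_null_comparison)
    show "\<forall>\<^sub>F n in sequentially. norm (Im (ip (?H n) (\<phi> n)) - Im (ip v u)) \<le>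
      l2norm (\<lambda>x. ?H n x - v x) * (l2norm u + l2norm (\<lambda>x. \<phi> n x - u x)) + l2norm v * l2norm (\<lambda>x. \<phi> n x - u x)"
    proof (intro always_eventually allI)
      fix n
      have "ip (?H n) (\<phi> n) - ip v u = ip (\<lambda>x. ?H n x - v x) (\<phi> n) + ip v (\<lambda>x. \<phi> n x - u x)"
        by (simp add: ip_diff_left ip_diff_right pL HL uL vL)
      then have "\<bar>Im (ip (?H n) (\<phi> n)) - Im (ip v u)\<bar> \<le> norm (ip (\<lambda>x. ?H n x - v x) (\<phi> n)) + norm (ip v (\<lambda>x. \<phi> n x - u x))"
        by (metis abs_Im_le_cmod minus_complex.sel(2) norm_triangle_ineq order_trans)
      also have "\<dots> \<le> l2norm (\<lambda>x. ?H n x - v x) * l2norm (\<phi> n) + l2norm v * l2norm (\<lambda>x. \<phi> n x - u x)"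
        by (intro add_mono ip_le L2_diff pL HL uL vL)
      also have "l2norm (\<phi> n) \<le> l2norm u + l2norm (\<lambda>x. \<phi> n x - u x)"
        using l2norm_add_le[OF uL L2_diff[OF pL[of n] uL]] by simp
      finally show "norm (Im (ip (?H n) (\<phi> n)) - Im (ip v u)) \<le>
        l2norm (\<lambda>x. ?H n x - v x) * (l2norm u + l2norm (\<lambda>x. \<phi> n x - u x)) + l2norm v * l2norm (\<lambda>x. \<phi> n x - u x)"
        by (simp add: mult_left_mono l2norm_nonneg)
    qed
    have "(\<lambda>n. l2norm (\<lambda>x. ?H n x - v x) * (l2norm u + l2norm (\<lambda>x. \<phi> n x - u x)) + l2norm v * l2norm (\<lambda>x. \<phi> n x - u x))
      \<longlonglongrightarrow> 0 * (l2norm u + 0) + l2norm v * 0"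
      by (intro tendsto_intros l)
    then show "(\<lambda>n. l2norm (\<lambda>x. ?H n x - v x) * (l2norm u + l2norm (\<lambda>x. \<phi> n x - u x)) + l2norm v * l2norm (\<lambda>x. \<phi> n x - u x))
      \<longlonglongrightarrow> 0" by simp
  qed
  moreover have "Im (ip (?H n) (\<phi> n)) = 0" for n
    by (rule schrop_symmetric[OF a V])
  ultimately show ?thesis by (simp add: LIMSEQ_const_iff)
qed

lemma is_C2c_cmult:
  assumes "is_C2c f f1 f2" shows "is_C2c (\<lambda>x. c * f x) (\<lambda>x. c * f1 x) (\<lambda>x. c * f2 x)"
  using is_C2c_D[OF assms] unfolding is_C2c_def
  by (intro conjI allI has_vector_derivative_mult_right Cc_continuous Cc_cmult)

lemma is_C2c_add:
  assumes "is_C2c f f1 f2" "is_C2c g g1 g2"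
  shows "is_C2c (\<lambda>x. f x + g x) (\<lambda>x. f1 x + g1 x) (\<lambda>x. f2 x + g2 x)"
  using is_C2c_D[OF assms(1)] is_C2c_D[OF assms(2)] unfolding is_C2c_def
  by (intro conjI allI has_vector_derivative_add Cc_continuous Cc_add)

text \<open>Made for comparing a solution with an explicit approximate one of class C^2. The pair of
  \<open>f\<close> and its image is never placed in \<open>hamiltonian\<close>: it suffices to
  approximate \<open>u\<close>, since subtracting \<open>f\<close> from the approximants keeps them
  C^2 with compact support.\<close>

lemma hamiltonian_diff_symmetric:
  assumes uv: "(u, v) \<in> hamiltonian \<epsilon> V" and V: "continuous_on UNIV V" and f: "is_C2c f f1 f2"
  shows "Im (ip (\<lambda>x. v x - schrop \<epsilon> V f f2 x) (\<lambda>x. u x - f x)) = 0"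
proof -
  obtain \<phi> \<phi>1 \<phi>2 where a: "\<And>n::nat. is_C2c (\<phi> n) (\<phi>1 n) (\<phi>2 n)"
    and l: "(\<lambda>n. l2norm (\<lambda>x. \<phi> n x - u x)) \<longlonglongrightarrow> 0"
    "(\<lambda>n. l2norm (\<lambda>x. schrop \<epsilon> V (\<phi> n) (\<phi>2 n) x - v x)) \<longlonglongrightarrow> 0"
    by (rule hamiltonian_approx[OF uv]) (rule that)
  have b: "is_C2c (\<lambda>x. \<phi> n x - f x) (\<lambda>x. \<phi>1 n x - f1 x) (\<lambda>x. \<phi>2 n x - f2 x)" for n
    using is_C2c_add[OF a is_C2c_cmult[OF f, of "-1"], of n] by simp
  have H: "schrop \<epsilon> V (\<lambda>x. \<phi> n x - f x) (\<lambda>x. \<phi>2 n x - f2 x) =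
      (\<lambda>x. schrop \<epsilon> V (\<phi> n) (\<phi>2 n) x - schrop \<epsilon> V f f2 x)" for n
    unfolding schrop_def fun_eq_iff right_diff_distrib by simp
  note fL = Cc_L2[OF is_C2c_D(1)[OF f]] Cc_L2[OF schrop_Cc[OF f V]]
  show ?thesis
    by (rule schrop_symmetric_limit[OF b _ _ _ _ V, where \<epsilon> = \<epsilon>])
      (use l L2_diff hamiltonian_L2[OF uv] fL in \<open>simp_all add: H\<close>)
qed

lemma hamiltonian_symmetric:
  assumes "(u, v) \<in> hamiltonian \<epsilon> V" "continuous_on UNIV V"
  shows "Im (ip v u) = 0"
proof -
  have "is_C2c (\<lambda>_. 0) (\<lambda>_. 0) (\<lambda>_. 0)" by (auto simp: is_C2c_def Cc_def)
  from hamiltonian_diff_symmetric[OF assms this] show ?thesis by (simp add: schrop_def)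
qed

section \<open>The singular potential: commutators on the domain of the Hamiltonian\<close>

abbreviation (input) absV :: "real \<Rightarrow> real" where "absV \<equiv> \<lambda>x. - \<bar>x\<bar>"

lemma continuous_absV: "continuous_on UNIV absV" by (intro continuous_intros)

definition commQ :: "real \<Rightarrow> real \<Rightarrow> real \<Rightarrow> complex" where
  "commQ k r x = character k x * of_real (absV (x - r) - absV x)"

lemma commQ_measurable [measurable]: "commQ k r \<in> borel_measurable borel"
  unfolding commQ_def[abs_def] by measurable

lemma norm_commQ: "norm (commQ k r x) \<le> \<bar>r\<bar>"
  by (auto simp: commQ_def norm_mult simp flip: of_real_diff of_real_minus)

text \<open>With \<open>g\<close> the image of \<open>f\<close>, this is the commutator identity
  solved for \<open>- \<epsilon> * k\<close> times the form containing the derivative of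
  \<open>f\<close>. No derivative of \<open>f\<close> is left, so the expression is continuous in
  the graph norm.\<close>

definition weylB :: "real \<Rightarrow> real \<Rightarrow> (real \<Rightarrow> complex) \<Rightarrow> (real \<Rightarrow> complex) \<Rightarrow> real \<Rightarrow> complex" where
  "weylB \<epsilon> k f g r = \<i> / of_real \<epsilon> * (tform (character k) r g f - tform (character k) r f g
     + of_real (\<epsilon>\<^sup>2 * k\<^sup>2 / 2) * tform (character k) r f f - tform (commQ k r) r f f)"

text \<open>On the domain of the Hamiltonian, the translation parameter can be differentiated along
  with the character: \<open>k \<epsilon> \<partial>\<^sub>r\<close> is a commutator with the Hamiltonian up to bounded terms.\<close>

lemma hamiltonian_translation_derivative:
  assumes uv: "(u, v) \<in> hamiltonian \<epsilon> absV" and eps: "\<epsilon> > 0"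
  shows "((\<lambda>s. tform (character k) (r0 + \<epsilon> * k * s) u u) has_vector_derivative
    weylB \<epsilon> k u v (r0 + \<epsilon> * k * t)) (at t)"
proof -
  obtain \<phi> \<phi>1 \<phi>2 where a: "\<And>n::nat. is_C2c (\<phi> n) (\<phi>1 n) (\<phi>2 n)"
    and l: "(\<lambda>n. l2norm (\<lambda>x. \<phi> n x - u x)) \<longlonglongrightarrow> 0"
    "(\<lambda>n. l2norm (\<lambda>x. schrop \<epsilon> absV (\<phi> n) (\<phi>2 n) x - v x)) \<longlonglongrightarrow> 0"
    by (rule hamiltonian_approx[OF uv]) (rule that)
  let ?H = "\<lambda>n. schrop \<epsilon> absV (\<phi> n) (\<phi>2 n)"
  let ?e = "character k"
  let ?r = "\<lambda>s. r0 + \<epsilon> * k * s"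
  define al where "al = (\<lambda>n. l2norm (\<lambda>x. \<phi> n x - u x))"
  define be where "be = (\<lambda>n. l2norm (\<lambda>x. ?H n x - v x))"
  have al0: "al n \<ge> 0" and be0: "be n \<ge> 0" for n by (simp_all add: al_def be_def l2norm_nonneg)
  note uL = hamiltonian_L2(1)[OF uv] and vL = hamiltonian_L2(2)[OF uv]
  note pL = Cc_L2[OF is_C2c_D(1)[OF a]] and HL = Cc_L2[OF schrop_Cc[OF a continuous_absV, where \<epsilon> = \<epsilon>]]
  have pn: "l2norm (\<phi> n) \<le> l2norm u + al n" for n
    using l2norm_add_le[OF uL L2_diff[OF pL[of n] uL]] by (simp add: al_def)
  have hn: "l2norm (?H n) \<le> l2norm v + be n" for n
    using l2norm_add_le[OF vL L2_diff[OF HL[of n] vL]] by (simp add: be_def)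
  \<comment> \<open>The multiplier \<open>commQ k r\<close> is bounded by |r| only. Convergence of
    the derivatives is therefore shown uniformly on the unit ball around \<open>t\<close>, where |r|
    \<le> \<open>R0\<close>.\<close>
  define R0 where "R0 = \<bar>r0\<bar> + \<bar>\<epsilon> * k\<bar> * (\<bar>t\<bar> + 1)"
  have R0: "\<bar>?r s\<bar> \<le> R0" if "s \<in> ball t 1" for s
  proof -
    have "\<bar>s\<bar> \<le> \<bar>t\<bar> + 1" using that by (auto simp: dist_real_def)
    then have "\<bar>\<epsilon> * k\<bar> * \<bar>s\<bar> \<le> \<bar>\<epsilon> * k\<bar> * (\<bar>t\<bar> + 1)" by (rule mult_left_mono) simp
    then show ?thesis using abs_triangle_ineq[of r0 "\<epsilon> * k * s"] by (simp add: R0_def abs_mult)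
  qed
  have R00: "R0 \<ge> 0" by (simp add: R0_def)
  define g1 where "g1 = (\<lambda>n. al n * (l2norm u + al n) + l2norm u * al n)"
  define g2 where "g2 = (\<lambda>n. be n * (l2norm u + al n) + l2norm v * al n + (al n * (l2norm v + be n) + l2norm u * be n))"
  have d1: "norm (tform h r (\<phi> n) (\<phi> n) - tform h r u u) \<le> C * g1 n"
    if "h \<in> borel_measurable borel" "\<And>x. norm (h x) \<le> C" for h r n and C :: real
  proof -
    have C: "C \<ge> 0" using that(2)[of 0] norm_ge_zero order_trans by blast
    have "C * (al n * l2norm (\<phi> n) + l2norm u * al n) \<le> C * g1 n"
      unfolding g1_def by (intro mult_left_mono add_right_mono pn C al0)
    then show ?thesis using tform_diff_le[OF pL[of n] pL[of n] uL uL that, of r]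
      unfolding al_def by linarith
  qed
  have d2: "norm ((tform ?e r (?H n) (\<phi> n) - tform ?e r (\<phi> n) (?H n)) - (tform ?e r v u - tform ?e r u v)) \<le> g2 n" for r n
  proof -
    have "norm (tform ?e r (?H n) (\<phi> n) - tform ?e r v u) \<le> be n * l2norm (\<phi> n) + l2norm v * al n"
      using tform_diff_le[OF HL[of n] pL[of n] vL uL measurable_character, of k 1 r] unfolding al_def be_def by simp
    moreover have "norm (tform ?e r (\<phi> n) (?H n) - tform ?e r u v) \<le> al n * l2norm (?H n) + l2norm u * be n"
      using tform_diff_le[OF pL[of n] HL[of n] uL vL measurable_character, of k 1 r] unfolding al_def be_def by simp
    moreover have "be n * l2norm (\<phi> n) \<le> be n * (l2norm u + al n)" "al n * l2norm (?H n) \<le> al n * (l2norm v + be n)"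
      using pn hn al0 be0 by (auto intro: mult_left_mono)
    moreover have "norm ((tform ?e r (?H n) (\<phi> n) - tform ?e r (\<phi> n) (?H n)) - (tform ?e r v u - tform ?e r u v))
      \<le> norm (tform ?e r (?H n) (\<phi> n) - tform ?e r v u) + norm (tform ?e r (\<phi> n) (?H n) - tform ?e r u v)"
      by (rule order_trans[OF eq_refl norm_triangle_ineq4]) (simp add: algebra_simps)
    ultimately show ?thesis unfolding g2_def by linarith
  qed
  define gg where "gg = (\<lambda>n. 1 / \<epsilon> * (g2 n + \<epsilon>\<^sup>2 * k\<^sup>2 / 2 * g1 n + R0 * g1 n))"
  have l': "al \<longlonglongrightarrow> 0" "be \<longlonglongrightarrow> 0" using l by (simp_all add: al_def be_def)
  have g1: "g1 \<longlonglongrightarrow> 0" unfolding g1_def by (rule tendsto_eq_intros l' refl | simp)+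
  have g2: "g2 \<longlonglongrightarrow> 0" unfolding g2_def by (rule tendsto_eq_intros l' refl | simp)+
  have gg: "gg \<longlonglongrightarrow> 0" unfolding gg_def by (rule tendsto_eq_intros g1 g2 refl | simp)+
  let ?B = "\<lambda>n s. weylB \<epsilon> k (\<phi> n) (?H n) (?r s)"
  have dB: "norm (?B n s - weylB \<epsilon> k u v (?r s)) \<le> gg n" if s: "s \<in> ball t 1" for n s
  proof -
    let ?r = "r0 + \<epsilon> * k * s"
    define X where "X = (tform ?e ?r (?H n) (\<phi> n) - tform ?e ?r (\<phi> n) (?H n)) - (tform ?e ?r v u - tform ?e ?r u v)"
    define Y where "Y = tform ?e ?r (\<phi> n) (\<phi> n) - tform ?e ?r u u"
    define Z where "Z = tform (commQ k ?r) ?r (\<phi> n) (\<phi> n) - tform (commQ k ?r) ?r u u"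
    have X: "norm X \<le> g2 n" unfolding X_def by (rule d2)
    have Y: "norm Y \<le> g1 n" unfolding Y_def using d1[of ?e 1] by simp
    have Z: "norm Z \<le> R0 * g1 n" unfolding Z_def
      by (rule d1) (use norm_commQ R0[OF s] order_trans in \<open>blast intro: commQ_measurable\<close>)+
    have "?B n s - weylB \<epsilon> k u v ?r = \<i> / of_real \<epsilon> * (X + of_real (\<epsilon>\<^sup>2 * k\<^sup>2 / 2) * Y - Z)"
      unfolding weylB_def X_def Y_def Z_def by (simp add: algebra_simps)
    then have "norm (?B n s - weylB \<epsilon> k u v ?r) = 1 / \<epsilon> * norm (X + of_real (\<epsilon>\<^sup>2 * k\<^sup>2 / 2) * Y - Z)"
      using eps by (simp add: norm_mult norm_divide)
    also have "norm (X + of_real (\<epsilon>\<^sup>2 * k\<^sup>2 / 2) * Y - Z) \<le> norm X + norm (complex_of_real (\<epsilon>\<^sup>2 * k\<^sup>2 / 2) * Y) + norm Z"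
      by (meson norm_triangle_ineq norm_triangle_ineq4 add_right_mono order_trans)
    also have "norm (complex_of_real (\<epsilon>\<^sup>2 * k\<^sup>2 / 2) * Y) = \<epsilon>\<^sup>2 * k\<^sup>2 / 2 * norm Y"
      by (simp add: norm_mult norm_divide norm_power power2_eq_square)
    also have "norm X + \<epsilon>\<^sup>2 * k\<^sup>2 / 2 * norm Y + norm Z \<le> g2 n + \<epsilon>\<^sup>2 * k\<^sup>2 / 2 * g1 n + R0 * g1 n"
      using X Y Z by (intro add_mono mult_left_mono) auto
    finally show ?thesis unfolding gg_def using eps by (simp add: divide_right_mono)
  qed
  have der: "((\<lambda>s. tform ?e (?r s) (\<phi> n) (\<phi> n)) has_vector_derivative ?B n s) (at s)" for n s
  proof -
    have "(?r has_vector_derivative \<epsilon> * k) (at s)"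
      by (auto simp flip: has_real_derivative_iff_has_vector_derivative intro!: derivative_eq_intros)
    from vector_diff_chain_at[OF this tform_translation_derivative[OF a measurable_character, of k 1 n "?r s"]]
    have "((\<lambda>s. tform ?e (?r s) (\<phi> n) (\<phi> n)) has_vector_derivative (\<epsilon> * k) *\<^sub>R - tform ?e (?r s) (\<phi>1 n) (\<phi> n)) (at s)"
      by (simp add: o_def)
    moreover have "(\<epsilon> * k) *\<^sub>R - tform ?e (?r s) (\<phi>1 n) (\<phi> n) = ?B n s"
    proof -
      have cq: "(\<lambda>x. character k x * of_real (absV (x - ?r s) - absV x)) = commQ k (?r s)"
        by (simp add: fun_eq_iff commQ_def)
      note c = commutator_C2c[OF a continuous_absV, of k "?r s" \<epsilon> n, unfolded cq]
      have "?B n s = \<i> / of_real \<epsilon> * (of_real (\<epsilon>\<^sup>2) * \<i> * of_real k * tform ?e (?r s) (\<phi>1 n) (\<phi> n))"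
        unfolding weylB_def c by simp
      also have "\<dots> = (\<i> * \<i>) * (of_real (\<epsilon>\<^sup>2) / of_real \<epsilon>) * of_real k * tform ?e (?r s) (\<phi>1 n) (\<phi> n)"
        by (simp add: mult_ac)
      also have "complex_of_real (\<epsilon>\<^sup>2) / of_real \<epsilon> = of_real \<epsilon>" using eps by (simp add: power2_eq_square)
      finally show ?thesis by (simp add: scaleR_conv_of_real)
    qed
    ultimately show ?thesis by simp
  qed
  have lim: "(\<lambda>n. tform ?e (?r s) (\<phi> n) (\<phi> n)) \<longlonglongrightarrow> tform ?e (?r s) u u" for s
  proof -
    have "(\<lambda>n. tform ?e (?r s) (\<phi> n) (\<phi> n) - tform ?e (?r s) u u) \<longlonglongrightarrow> 0"
      by (rule Lim_null_comparison[OF _ g1]) (use d1[of ?e 1] in simp)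
    then show ?thesis by (simp add: LIM_zero_iff)
  qed
  \<comment> \<open>Forms that converge pointwise with locally uniformly convergent derivatives: the
    limit is differentiable without any differentiability of \<open>u\<close> in x.\<close>
  have "\<exists>g. \<forall>s\<in>ball t 1. (\<lambda>n. tform ?e (?r s) (\<phi> n) (\<phi> n)) \<longlonglongrightarrow> g s \<and>
      (g has_derivative (\<lambda>h. h *\<^sub>R weylB \<epsilon> k u v (?r s))) (at s within ball t 1)"
  proof (rule has_derivative_sequence[where f' = "\<lambda>n s h. h *\<^sub>R ?B n s" and ?x0.0 = t])
    show "((\<lambda>s. tform ?e (?r s) (\<phi> n) (\<phi> n)) has_derivative (\<lambda>h. h *\<^sub>R ?B n s)) (at s within ball t 1)" for n s
      using der[of n s] has_derivative_at_withinI unfolding has_vector_derivative_def by blast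
    fix e :: real assume "e > 0"
    with gg have "\<forall>\<^sub>F n in sequentially. gg n < e" by (simp add: order_tendstoD)
    then show "\<forall>\<^sub>F n in sequentially. \<forall>s\<in>ball t 1. \<forall>h. norm (h *\<^sub>R ?B n s - h *\<^sub>R weylB \<epsilon> k u v (?r s)) \<le> e * norm h"
    proof eventually_elim
      case (elim n)
      show ?case
      proof (intro ballI allI)
        fix s h :: real assume "s \<in> ball t 1"
        then have "norm (?B n s - weylB \<epsilon> k u v (?r s)) \<le> e" using dB[of s n] elim by linarith
        then show "norm (h *\<^sub>R ?B n s - h *\<^sub>R weylB \<epsilon> k u v (?r s)) \<le> e * norm h"
          using mult_left_mono[of _ e "\<bar>h\<bar>"] by (simp flip: scaleR_diff_right add: mult.commute[of e])
      qed
    qed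
  qed (use lim in auto)
  then obtain g where g: "\<And>s. s \<in> ball t 1 \<Longrightarrow> (\<lambda>n. tform ?e (?r s) (\<phi> n) (\<phi> n)) \<longlonglongrightarrow> g s"
    "\<And>s. s \<in> ball t 1 \<Longrightarrow> (g has_derivative (\<lambda>h. h *\<^sub>R weylB \<epsilon> k u v (?r s))) (at s within ball t 1)"
    by blast
  have eq: "g s = tform ?e (?r s) u u" if "s \<in> ball t 1" for s
    using LIMSEQ_unique[OF g(1)[OF that] lim] .
  have "(g has_vector_derivative weylB \<epsilon> k u v (?r t)) (at t)"
    using g(2)[of t] at_within_open[of t "ball t 1"] unfolding has_vector_derivative_def by simp
  from has_vector_derivative_transform_within_open[OF this open_ball[of t 1]] eq
  show ?thesis by simp
qed

section \<open>Mass on the negative half-line and solutions as curves in L^2\<close>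

definition neg_part_norm :: "(real \<Rightarrow> complex) \<Rightarrow> real" where
  "neg_part_norm f = l2norm (\<lambda>x. indicator {..<0} x * f x)"

lemma neg_part_L2: "f \<in> L2 \<Longrightarrow> (\<lambda>x. indicator {..<0} x * f x) \<in> L2"
  by (rule L2_mult_bounded(1)[where C = 1]) (auto simp: indicator_def)

lemma neg_part_norm_le: "f \<in> L2 \<Longrightarrow> neg_part_norm f \<le> l2norm f"
  unfolding neg_part_norm_def using L2_mult_bounded(2)[where C = 1 and h = "indicator {..<0}"]
  by (auto simp: indicator_def)

lemma neg_part_norm_diff_le:
  assumes "f \<in> L2" "g \<in> L2"
  shows "\<bar>neg_part_norm f - neg_part_norm g\<bar> \<le> l2norm (\<lambda>x. f x - g x)"
proof -
  have "\<bar>neg_part_norm f - neg_part_norm g\<bar> \<le> neg_part_norm (\<lambda>x. f x - g x)"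
    using l2norm_diff_ge[OF neg_part_L2[OF assms(1)] neg_part_L2[OF assms(2)]]
    by (simp add: neg_part_norm_def right_diff_distrib)
  then show ?thesis using neg_part_norm_le[OF L2_diff[OF assms]] by linarith
qed

locale evolution =
  fixes \<epsilon> :: real and \<psi> \<psi>' :: "real \<Rightarrow> real \<Rightarrow> complex"
  assumes eps: "\<epsilon> > 0"
    and psi_L2: "\<And>t. \<psi> t \<in> L2" and psi'_L2: "\<And>t. \<psi>' t \<in> L2"
    and deriv: "\<And>t. l2_deriv \<psi> (\<psi>' t) t"
    and ham: "\<And>t. (\<psi> t, \<lambda>x. \<i> * of_real \<epsilon> * \<psi>' t x) \<in> hamiltonian \<epsilon> absV"
    and norm0: "l2norm (\<psi> 0) = 1"
begin

lemma psi_approx: "Cc_approx (\<psi> t)"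
  using hamiltonian_Cc_approx(1)[OF ham continuous_absV] .

lemma psi'_approx: "Cc_approx (\<psi>' t)"
  using Cc_approx_cmult[OF hamiltonian_Cc_approx(2)[OF ham continuous_absV], of "1 / (\<i> * of_real \<epsilon>)"] eps by simp

lemma tform_psi'_left: "tform h r (\<psi>' t) f = - (\<i> / of_real \<epsilon>) * tform h r (\<lambda>x. \<i> * of_real \<epsilon> * \<psi>' t x) f"
  unfolding tform_cmult_left using eps by simp

lemma tform_psi'_right: "tform h r f (\<psi>' t) = \<i> / of_real \<epsilon> * tform h r f (\<lambda>x. \<i> * of_real \<epsilon> * \<psi>' t x)"
  unfolding tform_cmult_right using eps by simp

text \<open>Conservation of mass: by the equation the derivative of the squared norm is a multiple
  of the imaginary part of <H \<psi>, \<psi>>, and this part vanishes by symmetry.\<close>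

lemma norm_psi: "l2norm (\<psi> t) = 1"
proof -
  let ?G = "\<lambda>s. tform (\<lambda>_. 1) 0 (\<psi> s) (\<psi> s)"
  have G: "?G s = of_real ((l2norm (\<psi> s))\<^sup>2)" for s
    unfolding ip_self[symmetric] by (simp add: tform_def ip_def)
  have "(?G has_vector_derivative 0) (at s)" for s
  proof -
    have "(?G has_vector_derivative 0 + tform (\<lambda>_. 1) 0 (\<psi>' s) (\<psi> s) + tform (\<lambda>_. 1) 0 (\<psi> s) (\<psi>' s)) (at s)"
      by (rule tform_product_rule[OF psi_L2 psi'_L2 deriv psi_L2 psi'_L2 deriv, where C = 1]) auto
    moreover have "tform (\<lambda>_. 1) 0 (\<psi>' s) (\<psi> s) + tform (\<lambda>_. 1) 0 (\<psi> s) (\<psi>' s) = 0"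
    proof -
      let ?v = "\<lambda>x. \<i> * of_real \<epsilon> * \<psi>' s x"
      have "tform (\<lambda>_. 1) 0 ?v (\<psi> s) = ip ?v (\<psi> s)" "tform (\<lambda>_. 1) 0 (\<psi> s) ?v = cnj (ip ?v (\<psi> s))"
        unfolding ip_cnj by (simp_all add: tform_def ip_def)
      moreover have "cnj (ip ?v (\<psi> s)) = ip ?v (\<psi> s)"
        using hamiltonian_symmetric[OF ham continuous_absV] by (simp add: complex_eq_iff)
      ultimately show ?thesis unfolding tform_psi'_left tform_psi'_right by simp
    qed
    ultimately show ?thesis by (simp add: add.assoc)
  qed
  then obtain c where "\<And>s. ?G s = c"
    using has_vector_derivative_zero_constant[of UNIV ?G] by auto
  then have "?G t = ?G 0" by metis
  then have "(l2norm (\<psi> t))\<^sup>2 = (l2norm (\<psi> 0))\<^sup>2" unfolding G of_real_eq_iff .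
  then show ?thesis using norm0 l2norm_nonneg[of "\<psi> t"] by (simp add: power2_eq_1_iff)
qed

abbreviation M :: "real \<Rightarrow> real" where "M s \<equiv> neg_part_norm (\<psi> s)"

lemma M_le_1: "M s \<le> 1" using neg_part_norm_le[OF psi_L2, of s] norm_psi by simp

lemma M_nonneg: "M s \<ge> 0" by (simp add: neg_part_norm_def l2norm_nonneg)

text \<open>Lets \<open>M\<close> be integrated twice and recovered by differentiation.\<close>

lemma M_continuous: "continuous_on UNIV M"
proof -
  have "isCont M t" for t
  proof -
    have "((\<lambda>h. M (t + h) - M t) \<longlongrightarrow> 0) (at 0)"
      by (rule Lim_null_comparison[OF _ l2_deriv_continuous[OF psi_L2 psi'_L2 deriv, of t]])
        (use neg_part_norm_diff_le[OF psi_L2 psi_L2] in simp)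
    then show ?thesis by (simp add: isCont_iff LIM_zero_iff)
  qed
  then show ?thesis by (simp add: continuous_on_eq_continuous_at)
qed

text \<open>\<open>y\<close> and \<open>c\<close> are translation parameter and phase of a Weyl
  operator carried along by the potential -x, prescribed at the final time \<open>T\<close>. In c' =
  y - \<epsilon> k^2 / 2 the first term compensates the linear potential and the second the k^2-term
  of the commutator. What remains is V(x - r) - V(x) - r, which would be 0 for V(x) = -x.\<close>

lemma weyl_derivative:
  fixes k yT cT T :: real
  defines "y \<equiv> \<lambda>s. yT + k * (s - T)"
  defines "c \<equiv> \<lambda>s. cT + yT * (s - T) + k * (s - T)\<^sup>2 / 2 - \<epsilon> * k\<^sup>2 * (s - T) / 2"
  defines "D \<equiv> \<lambda>r x. character k x * of_real (absV (x - r) - absV x - r)"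
  shows "((\<lambda>s. exp (\<i> * of_real (c s)) * tform (character k) (\<epsilon> * y s) (\<psi> s) (\<psi> s)) has_vector_derivative
    - (\<i> / of_real \<epsilon>) * exp (\<i> * of_real (c s)) * tform (D (\<epsilon> * y s)) (\<epsilon> * y s) (\<psi> s) (\<psi> s)) (at s)"
proof -
  let ?e = "character k"
  let ?r = "\<epsilon> * y s"
  let ?v = "\<lambda>x. \<i> * of_real \<epsilon> * \<psi>' s x"
  let ?E = "exp (\<i> * of_real (c s))"
  have yr: "\<epsilon> * y s = \<epsilon> * (yT - k * T) + \<epsilon> * k * s" for s by (simp add: y_def algebra_simps)
  have K: "((\<lambda>a. tform ?e (\<epsilon> * y a) (\<psi> s) (\<psi> s)) has_vector_derivative weylB \<epsilon> k (\<psi> s) ?v ?r) (at s)"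
    unfolding yr by (rule hamiltonian_translation_derivative[OF ham eps])
  have cy: "isCont (\<lambda>a. \<epsilon> * y a) s" unfolding y_def by (intro continuous_intros)
  have "((\<lambda>s. tform ?e (\<epsilon> * y s) (\<psi> s) (\<psi> s)) has_vector_derivative
      weylB \<epsilon> k (\<psi> s) ?v ?r + tform ?e ?r (\<psi>' s) (\<psi> s) + tform ?e ?r (\<psi> s) (\<psi>' s)) (at s)"
  proof (rule tform_product_rule[OF psi_L2 psi'_L2 deriv psi_L2 psi'_L2 deriv measurable_character, where C = 1])
    show "isCont (\<lambda>a. tform ?e (\<epsilon> * y a) (\<psi>' s) (\<psi> s)) s"
      by (rule isCont_o2[OF cy tform_isCont[OF psi'_approx psi_L2 measurable_character, where C = 1]]) simp
    show "isCont (\<lambda>a. tform ?e (\<epsilon> * y a) (\<psi> s) (\<psi>' s)) s"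
      by (rule isCont_o2[OF cy tform_isCont[OF psi_approx psi'_L2 measurable_character, where C = 1]]) simp
  qed (use K in auto)
  also have "weylB \<epsilon> k (\<psi> s) ?v ?r + tform ?e ?r (\<psi>' s) (\<psi> s) + tform ?e ?r (\<psi> s) (\<psi>' s) =
      \<i> / of_real \<epsilon> * (of_real (\<epsilon>\<^sup>2 * k\<^sup>2 / 2) * tform ?e ?r (\<psi> s) (\<psi> s) - tform (commQ k ?r) ?r (\<psi> s) (\<psi> s))"
    unfolding tform_psi'_left tform_psi'_right weylB_def by (simp add: algebra_simps)
  finally have A: "((\<lambda>s. tform ?e (\<epsilon> * y s) (\<psi> s) (\<psi> s)) has_vector_derivative
      \<i> / of_real \<epsilon> * (of_real (\<epsilon>\<^sup>2 * k\<^sup>2 / 2) * tform ?e ?r (\<psi> s) (\<psi> s) - tform (commQ k ?r) ?r (\<psi> s) (\<psi> s))) (at s)" .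
  have c: "(c has_real_derivative (y s - \<epsilon> * k\<^sup>2 / 2)) (at s)"
    unfolding c_def y_def by (auto intro!: derivative_eq_intros simp: field_simps)
  have ec: "((\<lambda>s. exp (\<i> * of_real (c s))) has_vector_derivative (\<i> * of_real (y s - \<epsilon> * k\<^sup>2 / 2)) * ?E) (at s)"
  proof -
    have "((\<lambda>z. exp (\<i> * of_real z)) has_vector_derivative \<i> * exp (\<i> * of_real (c s))) (at (c s))"
      using character_has_derivative[of 1 "c s"] by (simp add: character_def[abs_def])
    from vector_diff_chain_at[OF c[unfolded has_real_derivative_iff_has_vector_derivative] this]
    show ?thesis by (simp add: o_def scaleR_conv_of_real mult_ac)
  qed
  have DQ: "tform (D ?r) ?r (\<psi> s) (\<psi> s) = tform (commQ k ?r) ?r (\<psi> s) (\<psi> s) - of_real ?r * tform ?e ?r (\<psi> s) (\<psi> s)"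
  proof -
    have "tform (D ?r) ?r (\<psi> s) (\<psi> s) = (LINT x|lborel. commQ k ?r x * \<psi> s (x - ?r) * cnj (\<psi> s x)
       - of_real ?r * (?e x * \<psi> s (x - ?r) * cnj (\<psi> s x)))"
      unfolding tform_def D_def commQ_def
      by (intro Bochner_Integration.integral_cong refl) (simp add: algebra_simps)
    also have "\<dots> = (LINT x|lborel. commQ k ?r x * \<psi> s (x - ?r) * cnj (\<psi> s x))
       - (LINT x|lborel. of_real ?r * (?e x * \<psi> s (x - ?r) * cnj (\<psi> s x)))"
      by (intro Bochner_Integration.integral_diff integrable_mult_right
          tform_integrable[OF psi_L2 psi_L2 commQ_measurable norm_commQ]
          tform_integrable[OF psi_L2 psi_L2 measurable_character, where C = 1]) auto
    finally show ?thesis unfolding tform_def by (simp only: integral_mult_right_zero)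
  qed
  show ?thesis
  proof (rule has_vector_derivative_eq_rhs[OF has_vector_derivative_mult[OF ec A]])
    show "?E * (\<i> / of_real \<epsilon> * (of_real (\<epsilon>\<^sup>2 * k\<^sup>2 / 2) * tform ?e ?r (\<psi> s) (\<psi> s) - tform (commQ k ?r) ?r (\<psi> s) (\<psi> s)))
      + (\<i> * of_real (y s - \<epsilon> * k\<^sup>2 / 2)) * ?E * tform ?e ?r (\<psi> s) (\<psi> s)
      = - (\<i> / of_real \<epsilon>) * ?E * tform (D ?r) ?r (\<psi> s) (\<psi> s)"
      unfolding DQ using eps by (simp add: field_simps power2_eq_square)
  qed
qed

end

section \<open>Phase estimates and propagation of Weyl operators\<close>

lemma norm_iexp_minus_1_le: "norm (exp (\<i> * of_real b) - 1) \<le> \<bar>b\<bar>"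
  using iexp_approx1[of b 0] by simp

lemma norm_iexp_minus_1_le_2: "norm (exp (\<i> * of_real b) - 1) \<le> 2"
  using norm_triangle_ineq4[of "exp (\<i> * of_real b)" 1] by simp

lemma norm_iexp_minus_1_sq: "(norm (exp (\<i> * of_real b) - 1))\<^sup>2 = 2 * (1 - cos b)"
proof -
  have "exp (\<i> * of_real b) - 1 = Complex (cos b - 1) (sin b)"
    by (simp add: complex_eq_iff Re_exp Im_exp)
  then have "(norm (exp (\<i> * of_real b) - 1))\<^sup>2 = (cos b - 1)\<^sup>2 + (sin b)\<^sup>2" by (simp add: cmod_power2)
  also have "\<dots> = 2 * (1 - cos b)" using sin_cos_squared_add[of b] by (simp add: power2_eq_square algebra_simps)
  finally show ?thesis .
qed

text \<open>\<open>w\<close> may fail to be differentiable at its zeros, so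
  \<open>sqrt ((w s)\<^sup>2 + e\<^sup>2)\<close> is compared with \<open>K\<close> and e is sent to
  0.\<close>

lemma sqrt_gronwall:
  fixes w g k K :: "real \<Rightarrow> real"
  assumes T: "T \<ge> 0"
    and dw: "\<And>s. ((\<lambda>s. (w s)\<^sup>2) has_real_derivative g s) (at s)"
    and g: "\<And>s. 0 \<le> s \<Longrightarrow> s \<le> T \<Longrightarrow> \<bar>g s\<bar> \<le> 2 * k s * w s"
    and dK: "\<And>s. 0 \<le> s \<Longrightarrow> s \<le> T \<Longrightarrow> (K has_real_derivative k s) (at s)"
    and w0: "\<And>s. w s \<ge> 0" and k0: "\<And>s. 0 \<le> s \<Longrightarrow> s \<le> T \<Longrightarrow> k s \<ge> 0"
  shows "w T \<le> w 0 + (K T - K 0)"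
proof (rule field_le_epsilon)
  fix e :: real assume e: "e > 0"
  let ?S = "\<lambda>s. sqrt ((w s)\<^sup>2 + e\<^sup>2)"
  have "?S T - K T \<le> ?S 0 - K 0"
  proof (rule DERIV_nonpos_imp_nonincreasing[OF T])
    fix s assume s: "0 \<le> s" "s \<le> T"
    have pos: "(w s)\<^sup>2 + e\<^sup>2 > 0" using e by (simp add: add_nonneg_pos)
    have ws: "w s \<le> ?S s" using e by (simp add: real_le_rsqrt)
    have "((\<lambda>s. (w s)\<^sup>2 + e\<^sup>2) has_real_derivative g s) (at s)"
      using DERIV_add[OF dw DERIV_const[of "e\<^sup>2"], of s] by simp
    from DERIV_diff[OF DERIV_chain2[OF DERIV_real_sqrt[OF pos] this] dK[OF s]]
    have "((\<lambda>s. ?S s - K s) has_real_derivative g s * (inverse (?S s) / 2) - k s) (at s)"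
      by (simp only: mult.commute)
    moreover have "g s * (inverse (?S s) / 2) \<le> k s"
    proof -
      have "g s \<le> 2 * k s * w s" using g[OF s] by linarith
      also have "\<dots> \<le> 2 * k s * ?S s" using ws k0[OF s] by (intro mult_left_mono) auto
      finally have "g s * (inverse (?S s) / 2) \<le> 2 * k s * ?S s * (inverse (?S s) / 2)"
        using pos by (intro mult_right_mono) auto
      also have "\<dots> = k s * (?S s * inverse (?S s))" by simp
      also have "?S s * inverse (?S s) = 1" using e by (intro right_inverse) simp
      finally show ?thesis by simp
    qed
    ultimately show "\<exists>d. ((\<lambda>s. ?S s - K s) has_real_derivative d) (at s) \<and> d \<le> 0" by fastforce
  qed
  moreover have "w T \<le> ?S T" using e by (simp add: real_le_rsqrt)
  moreover have "?S 0 \<le> w 0 + e" using w0[of 0] e by (intro real_le_lsqrt) (auto simp: power2_sum)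
  ultimately show "w T \<le> w 0 + (K T - K 0) + e" by linarith
qed

context evolution
begin

text \<open>Gronwall for the square root: with \<open>w = U \<psi> - \<psi>\<close>, where \<open>U\<close> is the Weyl operator transported by the
  flow of the linear potential, the residual is supported where \<open>x - r < 0\<close>.\<close>

lemma weyl_estimate:
  fixes \<kappa> yT cT T :: real
  assumes T: "T \<ge> 0" and \<kappa>: "\<kappa> \<ge> 0" and yT: "yT \<ge> 0"
    and F1: "\<And>s. 0 \<le> s \<Longrightarrow> s \<le> T \<Longrightarrow> (F1 has_real_derivative M s) (at s)"
    and F: "\<And>s. 0 \<le> s \<Longrightarrow> s \<le> T \<Longrightarrow> (F has_real_derivative F1 s) (at s)"
    and F0: "F1 0 = 0" "F 0 = 0"
  shows "l2norm (\<lambda>x. exp (\<i> * of_real cT) * character (-\<kappa>) x * \<psi> T (x - \<epsilon> * yT) - \<psi> T x) \<le>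
    l2norm (\<lambda>x. exp (\<i> * of_real (cT - yT * T - \<kappa> * T\<^sup>2 / 2 + \<epsilon> * \<kappa>\<^sup>2 * T / 2)) * character (-\<kappa>) x *
      \<psi> 0 (x - \<epsilon> * (yT + \<kappa> * T)) - \<psi> 0 x) + 2 * (yT * F1 T + \<kappa> * F T)"
proof -
  \<comment> \<open>The slope is -\<kappa> \<le> 0 and the final value \<open>yT\<close> is
    nonnegative, so \<open>y\<close> stays nonnegative on [0, T]. This sign places the residual in
    the region where the translated solution is evaluated at negative points.\<close>
  define y where "y = (\<lambda>s. yT + (-\<kappa>) * (s - T))"
  define c where "c = (\<lambda>s. cT + yT * (s - T) + (-\<kappa>) * (s - T)\<^sup>2 / 2 - \<epsilon> * (-\<kappa>)\<^sup>2 * (s - T) / 2)"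
  define D where "D = (\<lambda>r x. character (-\<kappa>) x * of_real (absV (x - r) - absV x - r))"
  define U where "U = (\<lambda>s x. exp (\<i> * of_real (c s)) * character (-\<kappa>) x * \<psi> s (x - \<epsilon> * y s))"
  define J where "J = (\<lambda>s. exp (\<i> * of_real (c s)) * tform (character (-\<kappa>)) (\<epsilon> * y s) (\<psi> s) (\<psi> s))"
  define w where "w = (\<lambda>s. l2norm (\<lambda>x. U s x - \<psi> s x))"
  let ?X = "\<lambda>s. exp (\<i> * of_real (c s)) * tform (D (\<epsilon> * y s)) (\<epsilon> * y s) (\<psi> s) (\<psi> s)"
  have dJ: "(J has_vector_derivative - (\<i> / of_real \<epsilon>) * ?X s) (at s)" for s
    unfolding J_def y_def c_def D_def mult.assoc[symmetric] by (rule weyl_derivative)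
  have UL: "U s \<in> L2" for s
    unfolding U_def by (rule L2_mult_bounded(1)[where C = 1]) (auto intro!: L2_translate psi_L2 simp: norm_mult)
  have nU: "l2norm (U s) = 1" for s
  proof -
    have "l2norm (U s) = l2norm (\<lambda>x. \<psi> s (x - \<epsilon> * y s))"
      by (rule l2norm_cong_norm) (simp add: U_def norm_mult)
    then show ?thesis by (simp add: l2norm_translate norm_psi)
  qed
  have w2: "(w s)\<^sup>2 = 2 - 2 * Re (J s)" for s
  proof -
    have "ip (U s) (\<psi> s) = J s" unfolding ip_def U_def J_def tform_def
      by (simp flip: integral_mult_right_zero add: mult.assoc)
    then show ?thesis unfolding w_def using l2norm_diff_sq[OF UL psi_L2, of s s] nU norm_psi by simp
  qed
  have dw: "((\<lambda>s. (w s)\<^sup>2) has_real_derivative - (2 / \<epsilon>) * Im (?X s)) (at s)" for s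
  proof -
    have "((\<lambda>s. Re (J s)) has_vector_derivative Re (- (\<i> / of_real \<epsilon>) * ?X s)) (at s)"
      by (rule bounded_linear.has_vector_derivative[OF bounded_linear_Re dJ])
    moreover have "Re (- (\<i> / of_real \<epsilon>) * z) = Im z / \<epsilon>" for z
      by (simp add: Re_divide_of_real)
    ultimately have d: "((\<lambda>s. Re (J s)) has_real_derivative Im (?X s) / \<epsilon>) (at s)"
      by (simp only: has_real_derivative_iff_has_vector_derivative)
    show ?thesis unfolding w2 by (rule derivative_eq_intros d refl | simp)+
  qed
  have bound: "\<bar>(2 / \<epsilon>) * Im (?X s)\<bar> \<le> 4 * y s * M s * w s" if y0: "y s \<ge> 0" for s
  proof -
    let ?r = "\<epsilon> * y s"
    define d where "d = (\<lambda>x. of_real (absV (x - ?r) - absV x - ?r) * U s x)"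
    have r: "?r \<ge> 0" using y0 eps by simp
    have dle: "norm (d x) \<le> (2 * ?r) * norm (indicator {..<0} (x - ?r) * \<psi> s (x - ?r))" for x
    proof (cases "x - ?r < 0")
      case True
      have "\<bar>absV (x - ?r) - absV x - ?r\<bar> \<le> 2 * ?r" using r by linarith
      then show ?thesis using True
        by (simp add: d_def U_def norm_mult mult_right_mono del: of_real_diff of_real_minus)
    next
      case False
      then have "absV (x - ?r) - absV x - ?r = 0" using r by linarith
      then have "d x = 0" by (simp add: d_def del: of_real_diff of_real_minus)
      then show ?thesis using r by simp
    qed
    have dm: "d \<in> borel_measurable borel" unfolding d_def using L2_D(1)[OF UL] by measurable
    have r2: "2 * ?r \<ge> 0" using r by simp
    note dL = L2_dominated[OF dm L2_translate[OF neg_part_L2[OF psi_L2[of s]], of ?r] dle r2]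
    have dn: "l2norm d \<le> 2 * ?r * M s"
      using dL(2) unfolding l2norm_translate[of "\<lambda>x. indicator {..<0} x * \<psi> s x" ?r] neg_part_norm_def .
    have X: "?X s = ip d (\<psi> s)"
      unfolding ip_def d_def U_def tform_def D_def
      by (simp flip: integral_mult_right_zero add: mult_ac)
    \<comment> \<open>The multiplier in \<open>d\<close> is real, so pairing \<open>d\<close> with
      \<open>U s\<close> contributes nothing to the imaginary part. Hence \<open>\<psi> s\<close>
      may be replaced by its difference to \<open>U s\<close>, which supplies the factor
      \<open>w s\<close> and closes the Gronwall argument.\<close>
    have "Im (ip d (U s)) = 0"
    proof -
      have "ip d (U s) = (LINT x|lborel. complex_of_real ((absV (x - ?r) - absV x - ?r) * (norm (U s x))\<^sup>2))"
        unfolding ip_def d_def by (intro Bochner_Integration.integral_cong refl)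
          (simp add: complex_norm_square mult.assoc del: of_real_power of_real_diff of_real_minus)
      then show ?thesis unfolding integral_complex_of_real by simp
    qed
    moreover have "ip d (\<psi> s) = ip d (U s) - ip d (\<lambda>x. U s x - \<psi> s x)"
      by (simp add: ip_diff_right UL psi_L2 dL(1))
    ultimately have "\<bar>Im (?X s)\<bar> \<le> norm (ip d (\<lambda>x. U s x - \<psi> s x))"
      unfolding X using abs_Im_le_cmod[of "ip d (\<lambda>x. U s x - \<psi> s x)"] by simp
    also have "\<dots> \<le> l2norm d * w s" unfolding w_def by (rule ip_le[OF dL(1) L2_diff[OF UL psi_L2]])
    also have "\<dots> \<le> 2 * ?r * M s * w s" using dn by (intro mult_right_mono) (auto simp: w_def l2norm_nonneg)
    finally have "(2 / \<epsilon>) * \<bar>Im (?X s)\<bar> \<le> (2 / \<epsilon>) * (2 * ?r * M s * w s)"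
      using eps by (intro mult_left_mono) auto
    also have "\<dots> = 4 * y s * M s * w s" using eps by simp
    also have "(2 / \<epsilon>) * \<bar>z\<bar> = \<bar>(2 / \<epsilon>) * z\<bar>" for z using eps by (simp add: abs_mult)
    finally show ?thesis .
  qed
  \<comment> \<open>An antiderivative of 2 y M, by parts from F'' = M and y' = -\<kappa>.\<close>
  define G where "G = (\<lambda>s. 2 * (y s * F1 s + \<kappa> * F s))"
  have dG: "(G has_real_derivative 2 * y s * M s) (at s)" if "0 \<le> s" "s \<le> T" for s
    unfolding G_def y_def
    by (rule derivative_eq_intros F1[OF that] F[OF that] refl)+ (simp add: algebra_simps)
  have ys: "y s \<ge> 0" if "s \<le> T" for s
  proof -
    have "\<kappa> * (T - s) \<ge> 0" using \<kappa> that by simp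
    then show ?thesis using yT unfolding y_def by (simp add: algebra_simps)
  qed
  have w0: "w s \<ge> 0" for s by (simp add: w_def l2norm_nonneg)
  have "\<bar>- (2 / \<epsilon>) * Im (?X s)\<bar> \<le> 2 * (2 * y s * M s) * w s" if "0 \<le> s" "s \<le> T" for s
    using bound[OF ys[OF that(2)]] by (simp only: mult_minus_left abs_minus_cancel)
  then have "w T \<le> w 0 + (G T - G 0)"
    using ys M_nonneg by (intro sqrt_gronwall[OF T dw _ dG w0]) auto
  moreover have "G 0 = 0" by (simp add: G_def F0)
  moreover have "y T = yT" "y 0 = yT + \<kappa> * T" "c T = cT" "G T = 2 * (yT * F1 T + \<kappa> * F T)"
    by (simp_all add: y_def c_def G_def)
  moreover have "c 0 = cT - yT * T - \<kappa> * T\<^sup>2 / 2 + \<epsilon> * \<kappa>\<^sup>2 * T / 2"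
    by (simp add: c_def algebra_simps)
  ultimately show ?thesis unfolding w_def U_def by simp
qed

end

text \<open>A uniform average over \<open>\<kappa> \<in> [0, 2/\<eta>]\<close> turns smallness of $e^{-i\kappa(x-q)} f - f$ into a Chebyshev
  inequality; the point is the constant 4/3, which enters the growth exponent below.\<close>

lemma chebyshev_characters:
  assumes f: "f \<in> L2" and \<eta>: "\<eta> > 0"
    and le: "\<And>\<kappa>. 0 \<le> \<kappa> \<Longrightarrow> l2norm (\<lambda>x. exp (\<i> * of_real (\<kappa> * q)) * character (-\<kappa>) x * f x - f x) \<le> \<kappa> * D"
  shows "(l2norm (\<lambda>x. indicator {x. \<eta> \<le> \<bar>x - q\<bar>} x * f x))\<^sup>2 \<le> 4 / 3 * D\<^sup>2 / \<eta>\<^sup>2"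
proof -
  note [measurable] = L2_D(1)[OF f]
  \<comment> \<open>For |z| \<ge> \<eta> the oscillating term sin (K z) / z is then at most K / 2,
    so the integral of 2 (1 - cos (\<kappa> z)) over [0, K] is at least K; the integral K^3 / 3 of
    \<kappa>^2 on the other side gives 4 / 3 after division by K.\<close>
  define K where "K = 2 / \<eta>"
  have K: "K > 0" using \<eta> by (simp add: K_def)
  define g where "g = (\<lambda>\<kappa> x. 2 * (1 - cos (\<kappa> * (x - q))) * (norm (f x))\<^sup>2)"
  define A where "A = {x. \<eta> \<le> \<bar>x - q\<bar>}"
  have A[measurable]: "A \<in> sets borel" unfolding A_def by measurable
  have gm: "(\<lambda>(\<kappa>, x). ennreal (g \<kappa> x) * indicator {0..K} \<kappa>) \<in> borel_measurable (lborel \<Otimes>\<^sub>M lborel)"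
    unfolding g_def by measurable
  have g0: "g \<kappa> x \<ge> 0" for \<kappa> x by (simp add: g_def)
  have up: "(\<integral>\<^sup>+ x. ennreal (g \<kappa> x) \<partial>lborel) \<le> ennreal (\<kappa>\<^sup>2 * D\<^sup>2)" if "\<kappa> \<ge> 0" for \<kappa>
  proof -
    let ?h = "\<lambda>x. exp (\<i> * of_real (\<kappa> * q)) * character (-\<kappa>) x * f x - f x"
    have hL: "?h \<in> L2"
      by (intro L2_diff f L2_mult_bounded(1)[where C = 1]) (auto simp: norm_mult)
    have eq: "g \<kappa> x = (norm (?h x))\<^sup>2" for x
    proof -
      have e: "exp (\<i> * of_real (\<kappa> * q)) * character (-\<kappa>) x = exp (\<i> * of_real (- (\<kappa> * (x - q))))"
        unfolding character_def exp_add[symmetric] by (simp add: algebra_simps)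
      have "?h x = (exp (\<i> * of_real (- (\<kappa> * (x - q)))) - 1) * f x" unfolding e by (simp add: algebra_simps)
      then show ?thesis unfolding g_def by (simp only: norm_mult power_mult_distrib norm_iexp_minus_1_sq cos_minus)
    qed
    have "(\<integral>\<^sup>+ x. ennreal (g \<kappa> x) \<partial>lborel) = ennreal ((l2norm ?h)\<^sup>2)"
      unfolding eq l2norm_sq by (rule nn_integral_eq_integral[OF L2_D(2)[OF hL]]) auto
    also have "\<dots> \<le> ennreal ((\<kappa> * D)\<^sup>2)"
      using le[OF that] by (intro ennreal_leI power_mono l2norm_nonneg)
    finally show ?thesis by (simp add: power_mult_distrib)
  qed
  have low: "ennreal (K * (norm (indicator A x * f x))\<^sup>2) \<le> (\<integral>\<^sup>+ \<kappa>. ennreal (g \<kappa> x) * indicator {0..K} \<kappa> \<partial>lborel)" for x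
  proof (cases "x \<in> A")
    case True
    then have X: "\<eta> \<le> \<bar>x - q\<bar>" "x - q \<noteq> 0" using \<eta> by (auto simp: A_def)
    let ?P = "\<lambda>\<kappa>. 2 * (\<kappa> - sin (\<kappa> * (x - q)) / (x - q)) * (norm (f x))\<^sup>2"
    have "(\<integral>\<^sup>+ \<kappa>. ennreal (g \<kappa> x) * indicator {0..K} \<kappa> \<partial>lborel) = ennreal (?P K - ?P 0)"
    proof (rule nn_integral_FTC_Icc)
      show "(\<lambda>\<kappa>. g \<kappa> x) \<in> borel_measurable borel" unfolding g_def by measurable
      fix \<kappa> show "(?P has_real_derivative g \<kappa> x) (at \<kappa>)"
        unfolding g_def using X(2) by (auto intro!: derivative_eq_intros)
    qed (use K g0 in auto)
    moreover have "K * (norm (f x))\<^sup>2 \<le> ?P K - ?P 0"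
    proof -
      have "sin (K * (x - q)) / (x - q) \<le> \<bar>sin (K * (x - q))\<bar> / \<bar>x - q\<bar>"
        by (metis abs_divide abs_ge_self)
      also have "\<dots> \<le> 1 / \<eta>" using X \<eta> by (intro frac_le) auto
      finally have "K \<le> 2 * (K - sin (K * (x - q)) / (x - q))" by (simp add: K_def)
      from mult_right_mono[OF this zero_le_power2[of "norm (f x)"]] show ?thesis by simp
    qed
    ultimately show ?thesis using True by (simp add: ennreal_leI)
  qed auto
  have iL: "(\<lambda>x. indicator A x * f x) \<in> L2"
    by (rule L2_mult_bounded(1)[where C = 1]) (auto simp: f indicator_def)
  let ?N = "(l2norm (\<lambda>x. indicator A x * f x))\<^sup>2"
  have "ennreal (K * ?N) = (\<integral>\<^sup>+ x. ennreal (K * (norm (indicator A x * f x))\<^sup>2) \<partial>lborel)"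
  proof -
    have "(\<integral>\<^sup>+ x. ennreal (K * (norm (indicator A x * f x))\<^sup>2) \<partial>lborel)
        = ennreal (LINT x|lborel. K * (norm (indicator A x * f x))\<^sup>2)"
      using L2_D(2)[OF iL] K by (intro nn_integral_eq_integral) auto
    then show ?thesis by (simp add: l2norm_sq)
  qed
  also have "\<dots> \<le> (\<integral>\<^sup>+ x. (\<integral>\<^sup>+ \<kappa>. ennreal (g \<kappa> x) * indicator {0..K} \<kappa> \<partial>lborel) \<partial>lborel)"
    by (intro nn_integral_mono low)
  also have "\<dots> = (\<integral>\<^sup>+ \<kappa>. (\<integral>\<^sup>+ x. ennreal (g \<kappa> x) * indicator {0..K} \<kappa> \<partial>lborel) \<partial>lborel)"
    by (rule lborel_pair.Fubini'[OF gm])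
  also have "\<dots> \<le> (\<integral>\<^sup>+ \<kappa>. ennreal (\<kappa>\<^sup>2 * D\<^sup>2) * indicator {0..K} \<kappa> \<partial>lborel)"
  proof (intro nn_integral_mono)
    fix \<kappa> :: real
    show "(\<integral>\<^sup>+ x. ennreal (g \<kappa> x) * indicator {0..K} \<kappa> \<partial>lborel) \<le> ennreal (\<kappa>\<^sup>2 * D\<^sup>2) * indicator {0..K} \<kappa>"
      using up[of \<kappa>] by (cases "\<kappa> \<in> {0..K}") auto
  qed
  also have "\<dots> = ennreal (K ^ 3 / 3 * D\<^sup>2 - 0 ^ 3 / 3 * D\<^sup>2)"
  proof (rule nn_integral_FTC_Icc)
    fix \<kappa> show "((\<lambda>\<kappa>. \<kappa> ^ 3 / 3 * D\<^sup>2) has_real_derivative \<kappa>\<^sup>2 * D\<^sup>2) (at \<kappa>)"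
      by (auto intro!: derivative_eq_intros)
  qed (use K in auto)
  finally have "K * ?N \<le> K ^ 3 / 3 * D\<^sup>2" using K by (simp add: ennreal_le_iff)
  then have "K * ?N \<le> K * (K\<^sup>2 / 3 * D\<^sup>2)" by (simp add: power3_eq_cube power2_eq_square mult_ac)
  then have "?N \<le> K\<^sup>2 / 3 * D\<^sup>2" using K by (simp add: mult_le_cancel_left_pos)
  also have "\<dots> = 4 / 3 * D\<^sup>2 / \<eta>\<^sup>2" by (simp add: K_def power_divide)
  finally show ?thesis unfolding A_def .
qed

text \<open>Only two families of Weyl operators are asked for in \<open>init\<close>: pure
  translations (\<kappa> = 0), and those with y = \<kappa> T, which the linear flow turns into pure
  characters at time T. The phase contains the correction \<epsilon> \<kappa>^2 T / 2 accumulated on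
  the way; the factor sqrt \<epsilon> is the width of the packet.\<close>

locale wave_packet = evolution +
  fixes p0 A :: real
  assumes p0: "p0 \<ge> 0" and A: "A \<ge> 0"
    and init: "\<And>\<kappa> y T. \<kappa> \<ge> 0 \<Longrightarrow> y \<ge> 0 \<Longrightarrow> T \<ge> 0 \<Longrightarrow> \<kappa> = 0 \<or> y = \<kappa> * T \<Longrightarrow>
      l2norm (\<lambda>x. exp (\<i> * of_real (p0 * y + \<epsilon> * \<kappa>\<^sup>2 * T / 2)) * character (-\<kappa>) x * \<psi> 0 (x - \<epsilon> * y) - \<psi> 0 x)
       \<le> sqrt \<epsilon> * A * (\<kappa> * (1 + T) + y)"
begin

section \<open>Spread of a packet in position and momentum\<close>

definition q :: "real \<Rightarrow> real" where "q T = p0 * T + T\<^sup>2 / 2"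

text \<open>The integral of \<open>M\<close> from 0. The base point -1 makes it differentiable from
  both sides at 0, as the comparison and Gronwall lemmas require.\<close>

definition F1 :: "real \<Rightarrow> real" where
  "F1 s = integral {-1..s} M - integral {-1..0} M"

definition F :: "real \<Rightarrow> real" where
  "F s = integral {-1..s} F1 - integral {-1..0} F1"

text \<open>The defect of a character centred at \<open>q T\<close>, per unit of \<kappa>: an
  initial width of order sqrt \<epsilon> plus the contribution of the singularity. It plays the part
  of a standard deviation of position.\<close>

definition spread :: "real \<Rightarrow> real" where "spread T = sqrt \<epsilon> * A * (1 + 2 * T) + 2 * F T"

lemma integral_from_deriv:
  fixes g :: "real \<Rightarrow> real"
  assumes "continuous_on {-1<..} g" "continuous_on {-1..s+1} g" "s > -1"
  shows "((\<lambda>s. integral {-1..s} g - c) has_real_derivative g s) (at s)"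
proof -
  have "((\<lambda>s. integral {-1..s} g) has_real_derivative g s) (at s within {-1..s+1})"
    by (rule integral_has_real_derivative) (use assms in auto)
  then have "((\<lambda>s. integral {-1..s} g) has_real_derivative g s) (at s)"
    using assms(3) by (simp add: at_within_Icc_at)
  then show ?thesis by (auto intro!: derivative_eq_intros)
qed

lemma F1_0: "F1 0 = 0" and F_0: "F 0 = 0" by (simp_all add: F1_def F_def)

lemma F1_deriv: "s > -1 \<Longrightarrow> (F1 has_real_derivative M s) (at s)"
  unfolding F1_def[abs_def]
  by (rule integral_from_deriv) (auto intro: continuous_on_subset[OF M_continuous])

lemma F_deriv: "s > -1 \<Longrightarrow> (F has_real_derivative F1 s) (at s)"
proof -
  assume s: "s > -1"
  have c: "continuous_on {-1..b} F1" for b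
    unfolding F1_def[abs_def]
    by (intro continuous_on_diff continuous_on_const indefinite_integral_continuous_1
        integrable_continuous_interval continuous_on_subset[OF M_continuous]) auto
  have c': "continuous_on {-1<..} F1"
    using F1_deriv by (auto intro!: continuous_at_imp_continuous_on DERIV_isCont)
  show ?thesis unfolding F_def[abs_def] by (rule integral_from_deriv[OF c' c s])
qed

text \<open>The translation parameter is prescribed as 0 at time \<open>T\<close>, so that the Weyl
  operator is there a character, with phase centred at \<open>q T\<close>; at time 0 it translates
  by \<epsilon> \<kappa> T. This is the case y = \<kappa> T of \<open>init\<close>.\<close>

lemma position_spread:
  assumes T: "T \<ge> 0" and \<eta>: "\<eta> > 0"
  shows "(l2norm (\<lambda>x. indicator {x. \<eta> \<le> \<bar>x - q T\<bar>} x * \<psi> T x))\<^sup>2 \<le> 4 / 3 * (spread T)\<^sup>2 / \<eta>\<^sup>2"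
proof (rule chebyshev_characters[OF psi_L2 \<eta>])
  fix \<kappa> :: real assume \<kappa>: "0 \<le> \<kappa>"
  have "l2norm (\<lambda>x. exp (\<i> * of_real (\<kappa> * q T)) * character (-\<kappa>) x * \<psi> T (x - \<epsilon> * 0) - \<psi> T x) \<le>
    l2norm (\<lambda>x. exp (\<i> * of_real (\<kappa> * q T - 0 * T - \<kappa> * T\<^sup>2 / 2 + \<epsilon> * \<kappa>\<^sup>2 * T / 2)) * character (-\<kappa>) x *
      \<psi> 0 (x - \<epsilon> * (0 + \<kappa> * T)) - \<psi> 0 x) + 2 * (0 * F1 T + \<kappa> * F T)"
    by (rule weyl_estimate[OF T \<kappa>]) (auto intro: F1_deriv F_deriv simp: F1_0 F_0)
  also have "\<kappa> * q T - 0 * T - \<kappa> * T\<^sup>2 / 2 + \<epsilon> * \<kappa>\<^sup>2 * T / 2 = p0 * (\<kappa> * T) + \<epsilon> * \<kappa>\<^sup>2 * T / 2"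
    by (simp add: q_def algebra_simps)
  also have "l2norm (\<lambda>x. exp (\<i> * of_real (p0 * (\<kappa> * T) + \<epsilon> * \<kappa>\<^sup>2 * T / 2)) * character (-\<kappa>) x *
      \<psi> 0 (x - \<epsilon> * (0 + \<kappa> * T)) - \<psi> 0 x) \<le> sqrt \<epsilon> * A * (\<kappa> * (1 + T) + \<kappa> * T)"
    using init[OF \<kappa> _ T, of "\<kappa> * T"] \<kappa> T by simp
  also have "sqrt \<epsilon> * A * (\<kappa> * (1 + T) + \<kappa> * T) + 2 * (0 * F1 T + \<kappa> * F T) = \<kappa> * spread T"
    by (simp add: spread_def algebra_simps)
  finally show "l2norm (\<lambda>x. exp (\<i> * of_real (\<kappa> * q T)) * character (-\<kappa>) x * \<psi> T x - \<psi> T x) \<le> \<kappa> * spread T"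
    by simp
qed

text \<open>For \<kappa> = 0 the translation is constant along the flow and only the phase turns, at
  the rate v; this is the growth of the momentum from \<open>p0\<close> to
  \<open>p0 + T\<close>.\<close>

lemma momentum_spread:
  assumes T: "T \<ge> 0" and v: "v \<ge> 0"
  shows "l2norm (\<lambda>x. exp (\<i> * of_real ((p0 + T) * v)) * \<psi> T (x - \<epsilon> * v) - \<psi> T x) \<le> sqrt \<epsilon> * A * v + 2 * v * F1 T"
proof -
  have c: "character 0 x = 1" for x by (simp add: character_def)
  have "l2norm (\<lambda>x. exp (\<i> * of_real ((p0 + T) * v)) * character (-0) x * \<psi> T (x - \<epsilon> * v) - \<psi> T x) \<le>
    l2norm (\<lambda>x. exp (\<i> * of_real ((p0 + T) * v - v * T - 0 * T\<^sup>2 / 2 + \<epsilon> * 0\<^sup>2 * T / 2)) * character (-0) x *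
      \<psi> 0 (x - \<epsilon> * (v + 0 * T)) - \<psi> 0 x) + 2 * (v * F1 T + 0 * F T)"
    by (rule weyl_estimate[OF T order_refl v]) (auto intro: F1_deriv F_deriv simp: F1_0 F_0)
  moreover have "l2norm (\<lambda>x. exp (\<i> * of_real (p0 * v)) * \<psi> 0 (x - \<epsilon> * v) - \<psi> 0 x) \<le> sqrt \<epsilon> * A * v"
    using init[of 0 v T] v T by (simp add: c)
  moreover have "(p0 + T) * v - v * T = p0 * v" by (simp add: algebra_simps)
  ultimately show ?thesis by (simp add: c)
qed

lemma spread_nonneg: assumes "T \<ge> 0" shows "spread T \<ge> 0" "F T \<ge> 0" "F1 T \<ge> 0"
proof -
  have F1: "F1 s \<ge> 0" if "s \<ge> 0" for s
  proof -
    have "F1 0 \<le> F1 s"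
    proof (rule DERIV_nonneg_imp_nondecreasing[OF that])
      fix x :: real assume "0 \<le> x"
      with F1_deriv[of x] M_nonneg[of x] show "\<exists>d. (F1 has_real_derivative d) (at x) \<and> 0 \<le> d" by auto
    qed
    then show ?thesis by (simp add: F1_0)
  qed
  then show "F1 T \<ge> 0" using assms .
  have "F 0 \<le> F T"
  proof (rule DERIV_nonneg_imp_nondecreasing[OF assms])
    fix x :: real assume "0 \<le> x"
    with F_deriv[of x] F1[of x] show "\<exists>d. (F has_real_derivative d) (at x) \<and> 0 \<le> d" by auto
  qed
  then show "F T \<ge> 0" by (simp add: F_0)
  then show "spread T \<ge> 0" using A eps assms by (simp add: spread_def)
qed

text \<open>The decisive inequality: \<open>M = F''\<close> is controlled by \<open>F\<close> itself with a constant
  \<open>58/25 < 3\<close>, so that \<open>F\<close> grows at most cubically.\<close>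

lemma M_le_spread:
  assumes T: "T > 0"
  shows "M T \<le> (29/25) * (spread T / q T)"
proof -
  have q: "q T > 0" using T p0 by (auto simp: q_def intro!: add_nonneg_pos)
  \<comment> \<open>Negative points have distance at least \<open>q T\<close> from
    \<open>q T\<close>.\<close>
  have "M T \<le> 1 * l2norm (\<lambda>x. indicator {x. q T \<le> \<bar>x - q T\<bar>} x * \<psi> T x)"
    unfolding neg_part_norm_def
    by (rule L2_dominated(2)[OF L2_D(1)[OF neg_part_L2[OF psi_L2]]])
      (auto intro!: L2_mult_bounded(1)[where C = 1] psi_L2 simp: indicator_def)
  then have "(M T)\<^sup>2 \<le> (l2norm (\<lambda>x. indicator {x. q T \<le> \<bar>x - q T\<bar>} x * \<psi> T x))\<^sup>2"
    using M_nonneg by (intro power_mono) auto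
  also have "\<dots> \<le> 4 / 3 * (spread T)\<^sup>2 / (q T)\<^sup>2"
    by (rule position_spread) (use T q in auto)
  \<comment> \<open>29/25 is a rational bound for the square root of 4/3, as (29/25)^2 =
    841/625.\<close>
  also have "\<dots> \<le> ((29/25) * (spread T / q T))\<^sup>2"
  proof -
    have "4 / 3 * ((spread T)\<^sup>2 / (q T)\<^sup>2) \<le> (29/25)\<^sup>2 * ((spread T)\<^sup>2 / (q T)\<^sup>2)"
      by (intro mult_right_mono) (auto simp: power2_eq_square)
    then show ?thesis by (simp add: power_mult_distrib power_divide)
  qed
  finally show ?thesis
    by (rule power2_le_imp_le) (use spread_nonneg[of T] q T in auto)
qed

end

section \<open>Growth of the spread\<close>

text \<open>Before the first zero of L - F the hypothesis \<open>step\<close> makes this difference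
  convex; its slope starts nonnegative, so it cannot fall from its positive initial value to 0.
  \<open>step\<close> is asked for s > 0 only, because the bounds it is used with are singular at s
  = 0.\<close>

lemma second_order_comparison:
  fixes F F1 M L L1 N :: "real \<Rightarrow> real"
  assumes T: "T \<ge> 0"
    and F: "\<And>s. 0 \<le> s \<Longrightarrow> s \<le> T \<Longrightarrow> (F has_real_derivative F1 s) (at s)"
    and F1: "\<And>s. 0 \<le> s \<Longrightarrow> s \<le> T \<Longrightarrow> (F1 has_real_derivative M s) (at s)"
    and L: "\<And>s. 0 \<le> s \<Longrightarrow> s \<le> T \<Longrightarrow> (L has_real_derivative L1 s) (at s)"
    and L1: "\<And>s. 0 \<le> s \<Longrightarrow> s \<le> T \<Longrightarrow> (L1 has_real_derivative N s) (at s)"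
    and init: "F 0 < L 0" "F1 0 \<le> L1 0"
    and step: "\<And>s. 0 < s \<Longrightarrow> s \<le> T \<Longrightarrow> F s \<le> L s \<Longrightarrow> M s \<le> N s"
  shows "F T \<le> L T"
proof (rule ccontr)
  assume neg: "\<not> F T \<le> L T"
  define d where "d = (\<lambda>s. L s - F s)"
  define S where "S = {s \<in> {0..T}. d s \<le> 0}"
  have dd: "(d has_real_derivative L1 s - F1 s) (at s)" if "0 \<le> s" "s \<le> T" for s
    unfolding d_def using F[OF that] L[OF that] by (auto intro!: derivative_eq_intros)
  have cd: "continuous_on {0..T} d"
    using dd by (auto intro!: continuous_at_imp_continuous_on DERIV_isCont)
  have "closed S" unfolding S_def
    by (rule continuous_on_closed_Collect_le[OF cd continuous_on_const]) auto
  moreover have "T \<in> S" using neg T by (simp add: S_def d_def)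
  moreover have "bdd_below S" by (rule bdd_belowI[of _ 0]) (auto simp: S_def)
  ultimately have s1: "Inf S \<in> S" using closed_contains_Inf by blast
  define s1 where "s1 = Inf S"
  have s1S: "0 \<le> s1" "s1 \<le> T" "d s1 \<le> 0" using s1 by (auto simp: S_def s1_def)
  have before: "d s > 0" if "0 \<le> s" "s < s1" for s
  proof (rule ccontr)
    assume "\<not> d s > 0"
    then have "s \<in> S" using that s1S by (auto simp: S_def)
    then have "s1 \<le> s" unfolding s1_def using \<open>bdd_below S\<close> by (rule cInf_lower)
    then show False using that by simp
  qed
  have s1pos: "0 < s1" using s1S init(1) by (cases "s1 = 0") (auto simp: d_def)
  have d1: "L1 s - F1 s \<ge> 0" if s: "0 < s" "s < s1" for s
  proof -
    have "\<exists>z>0. z < s \<and> (L1 s - F1 s) - (L1 0 - F1 0) = (s - 0) * (N z - M z)"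
      by (rule MVT2[OF s(1)]) (use F1 L1 s s1S in \<open>auto intro!: DERIV_diff\<close>)
    then obtain z where z: "0 < z" "z < s" "(L1 s - F1 s) - (L1 0 - F1 0) = s * (N z - M z)" by auto
    have "M z \<le> N z" using before[of z] z s s1S by (intro step) (auto simp: d_def)
    then have "s * (N z - M z) \<ge> 0" using s by simp
    then show ?thesis using z(3) init(2) by linarith
  qed
  have "\<exists>z>0. z < s1 \<and> d s1 - d 0 = (s1 - 0) * (L1 z - F1 z)"
    by (rule MVT2[OF s1pos]) (use dd s1S in auto)
  then obtain z where "0 < z" "z < s1" "d s1 - d 0 = s1 * (L1 z - F1 z)" by auto
  moreover from this d1[of z] s1pos have "s1 * (L1 z - F1 z) \<ge> 0" by (intro mult_nonneg_nonneg) auto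
  ultimately have "d s1 \<ge> d 0" by linarith
  then show False using init(1) s1S(3) by (simp add: d_def)
qed

text \<open>In the time \<open>\<tau> = s / p0\<close> the trajectory is \<open>p0\<^sup>2 (\<tau> + \<tau>\<^sup>2 / 2)\<close>. The comparison function is
  \<open>\<surd>\<delta> (4 v\<^sup>3\<^sup>/\<^sup>2 + 60 v\<^sup>3)\<close>, \<open>v = \<tau> + \<delta>\<close>: its first term absorbs the trivial bound \<open>M \<le> 1\<close> near
  \<open>\<tau> = 0\<close> through \<open>min 1 X \<le> \<surd>X\<close>, its second term the cubic growth for large \<open>\<tau>\<close>.\<close>

lemma growth_inequality:
  fixes \<tau> \<delta> :: real
  assumes \<tau>: "\<tau> > 0" and \<delta>: "0 < \<delta>" "\<delta> \<le> 2/3"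
  defines "v \<equiv> \<tau> + \<delta>"
  shows "min 1 ((\<delta> + (58/25) * (sqrt \<delta> * (4 * (v * sqrt v) + 60 * v ^ 3))) / (\<tau> + \<tau>\<^sup>2 / 2))
    \<le> sqrt \<delta> * (3 / sqrt v + 360 * v)"
proof (cases "\<tau> \<le> \<delta>")
  \<comment> \<open>Here the entry 1 of the minimum suffices: v \<le> 2 \<delta> makes sqrt \<delta>
    * 3 / sqrt v at least 3 / sqrt 2 > 1.\<close>
  case True
  have v: "v > 0" "v \<le> 2 * \<delta>" using \<tau> \<delta> True by (auto simp: v_def)
  have "sqrt v \<le> sqrt (2 * \<delta>)" using v by simp
  also have "\<dots> = sqrt 2 * sqrt \<delta>" by (rule real_sqrt_mult)
  also have "\<dots> \<le> 3 * sqrt \<delta>" using \<delta> sqrt2_less_2 by (intro mult_right_mono) auto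
  finally have "1 \<le> sqrt \<delta> * (3 / sqrt v)" using v by (simp add: field_simps)
  also have "\<dots> \<le> sqrt \<delta> * (3 / sqrt v + 360 * v)" using v \<delta> by (intro mult_left_mono) auto
  finally show ?thesis by (rule min.coboundedI1)
next
  case False
  define w where "w = sqrt v"
  define P where "P = \<tau> + \<tau>\<^sup>2 / 2"
  have v: "v > 0" "v \<le> 2 * \<tau>" using \<tau> \<delta> False by (auto simp: v_def)
  have w: "w > 0" "w\<^sup>2 = v" using v by (auto simp: w_def)
  have P: "P > 0" "\<tau> \<le> P" using \<tau> by (auto simp: P_def add_pos_nonneg)
  \<comment> \<open>The origin of 2/3: v^2 \<le> \<tau>^2 + 3 \<tau> \<delta> for \<delta> < \<tau>,
    and 3 \<delta> \<le> 2.\<close>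
  have vP: "v\<^sup>2 \<le> 2 * P"
  proof -
    have "\<delta> * \<delta> \<le> \<tau> * \<delta>" using False \<delta> by (intro mult_right_mono) auto
    moreover have "\<tau> * \<delta> \<le> \<tau> * (2/3)" using \<tau> \<delta> by (intro mult_left_mono) auto
    moreover have "v\<^sup>2 = \<tau>\<^sup>2 + 2 * (\<tau> * \<delta>) + \<delta> * \<delta>" by (simp add: v_def power2_eq_square algebra_simps)
    moreover have "2 * P = 2 * \<tau> + \<tau>\<^sup>2" by (simp add: P_def)
    ultimately show ?thesis by linarith
  qed
  have a1: "\<delta> / P \<le> sqrt \<delta> * ((3/2) / w)"
  proof -
    have "sqrt \<delta> * w \<le> (3/2) * \<tau>"
    proof (rule power2_le_imp_le)
      have "(sqrt \<delta> * w)\<^sup>2 = \<delta> * v" using \<delta> w by (simp add: power_mult_distrib)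
      also have "\<dots> \<le> \<tau> * (2 * \<tau>)" using False v \<delta> \<tau> by (intro mult_mono) auto
      also have "\<dots> \<le> ((3/2) * \<tau>)\<^sup>2" using \<tau> by (simp add: power2_eq_square)
      finally show "(sqrt \<delta> * w)\<^sup>2 \<le> ((3/2) * \<tau>)\<^sup>2" .
    qed (use \<tau> in auto)
    also have "\<dots> \<le> (3/2) * P" using P by simp
    finally have "sqrt \<delta> / P \<le> (3/2) / w" using P w by (simp add: field_simps)
    from mult_left_mono[OF this, of "sqrt \<delta>"] show ?thesis using \<delta> by simp
  qed
  have a2: "v * sqrt v / P \<le> 2 * w"
    using mult_right_mono[OF order_trans[OF v(2) mult_left_mono[OF P(2), of 2]], of w] w P
    by (simp add: w_def[symmetric] field_simps)
  have a3: "v ^ 3 / P \<le> 2 * v"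
    using mult_right_mono[OF vP, of v] v P by (simp add: field_simps power3_eq_cube power2_eq_square)
  have "(\<delta> + (58/25) * (sqrt \<delta> * (4 * (v * sqrt v) + 60 * v ^ 3))) / P =
    \<delta> / P + sqrt \<delta> * ((232/25) * (v * sqrt v / P) + (696/5) * (v ^ 3 / P))"
    by (simp add: add_divide_distrib algebra_simps)
  also have "\<dots> \<le> sqrt \<delta> * ((3/2) / w) + sqrt \<delta> * ((232/25) * (2 * w) + (696/5) * (2 * v))"
    using \<delta> by (intro add_mono a1 a2 a3 mult_left_mono) auto
  also have "\<dots> = sqrt \<delta> * ((3/2) / w + (464/25) * w + (1392/5) * v)" by (simp add: algebra_simps)
  also have "\<dots> \<le> sqrt \<delta> * (3 / w + 360 * v)"
  proof (rule mult_left_mono)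
    \<comment> \<open>The middle term is absorbed into the slack of its neighbours: 3 - 3/2 = 3/2
      and 360 - 1392/5 = 408/5. Up to w = 7/25 the constant 3/2 dominates it, from there on the
      cubic term does.\<close>
    have "(464/25) * w\<^sup>2 \<le> (3/2) + (408/5) * w ^ 3"
    proof (cases "w \<le> (7/25)")
      case True
      then have "w\<^sup>2 \<le> (7/25)\<^sup>2" using w by (intro power_mono) auto
      then have "w\<^sup>2 \<le> 49/625" by (simp add: power2_eq_square)
      moreover have "w ^ 3 \<ge> 0" using w by simp
      ultimately show ?thesis by linarith
    next
      case False
      then have "(464/25) * w\<^sup>2 \<le> ((408/5) * w) * w\<^sup>2" by (intro mult_right_mono) auto
      then show ?thesis by (simp add: power3_eq_cube power2_eq_square)
    qed
    then have "(464/25) * w\<^sup>2 / w \<le> ((3/2) + (408/5) * w ^ 3) / w" using w by (intro divide_right_mono) auto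
    then have "(464/25) * w \<le> (3/2) / w + (408/5) * w\<^sup>2"
      using w by (simp add: add_divide_distrib power2_eq_square power3_eq_cube)
    moreover have "3 / w = (3/2) / w + (3/2) / w" by simp
    ultimately show "(3/2) / w + (464/25) * w + (1392/5) * v \<le> 3 / w + 360 * v" using w(2) by linarith
  qed (use \<delta> in simp)
  finally show ?thesis unfolding P_def w_def by (rule min.coboundedI2)
qed

context wave_packet
begin

text \<open>\<open>F1\<close> is nondecreasing, so its value is at most its mean over the following
  unit of time. Smallness of \<open>F\<close> at all times thus controls the momentum estimate as
  well.\<close>

lemma F1_le: assumes "T \<ge> 0" shows "F1 T \<le> F (T + 1)"
proof -
  have "\<exists>z>T. z < T + 1 \<and> F (T + 1) - F T = (T + 1 - T) * F1 z"
    by (rule MVT2) (use F_deriv assms in auto)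
  then obtain z where z: "z > T" "F (T + 1) - F T = F1 z" by auto
  have "F1 T \<le> F1 z"
  proof (rule DERIV_nonneg_imp_nondecreasing[where f = F1 and a = T and b = z])
    fix x :: real assume "T \<le> x"
    with F1_deriv[of x] M_nonneg[of x] assms show "\<exists>d. (F1 has_real_derivative d) (at x) \<and> 0 \<le> d" by auto
  qed (use z in auto)
  then show ?thesis using z spread_nonneg(2)[OF assms] by linarith
qed

text \<open>The \<epsilon>-term is frozen at the final time, so that a comparison function can work
  with a constant. \<open>A + 1\<close> in place of \<open>A\<close> makes this constant
  positive.\<close>

lemma M_le: assumes "0 < s" "s \<le> T"
  shows "M s \<le> ((29/25) * (A + 1) * (1 + 2 * T) * sqrt \<epsilon> + (58/25) * F s) / q s"
proof -
  have q: "q s > 0" using assms p0 by (auto simp: q_def intro!: add_nonneg_pos)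
  have "sqrt \<epsilon> * A * (1 + 2 * s) \<le> sqrt \<epsilon> * (A + 1) * (1 + 2 * T)"
    using A eps assms by (intro mult_mono) auto
  then have "(29/25) * spread s \<le> (29/25) * (A + 1) * (1 + 2 * T) * sqrt \<epsilon> + (58/25) * F s"
  proof -
    have "(29/25) * (A + 1) * (1 + 2 * T) * sqrt \<epsilon> = (29/25) * (sqrt \<epsilon> * (A + 1) * (1 + 2 * T))" by simp
    moreover have "(29/25) * spread s = (29/25) * (sqrt \<epsilon> * A * (1 + 2 * s)) + (58/25) * F s"
      by (simp add: spread_def)
    ultimately show ?thesis using \<open>sqrt \<epsilon> * A * (1 + 2 * s) \<le> sqrt \<epsilon> * (A + 1) * (1 + 2 * T)\<close> by linarith
  qed
  from divide_right_mono[OF this less_imp_le[OF q]] show ?thesis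
    using M_le_spread[OF assms(1)] by simp
qed

text \<open>Time is measured in units of \<open>p0\<close> and length in units of
  \<open>p0\<^sup>2\<close>; \<delta> is the initial spread in the latter unit. The factor 1 / p0 in
  the result is the price of cubic growth, from p0^2 (T / p0)^3.\<close>

lemma F_bound_momentum:
  assumes T: "T \<ge> 0" and p: "p0 > 0"
    and \<delta>: "\<delta> = (29/25) * (A + 1) * (1 + 2 * T) * sqrt \<epsilon> / p0\<^sup>2" "\<delta> \<le> 2/3"
  shows "F T \<le> sqrt \<delta> * (4 * p0\<^sup>2 + 64 * (T + \<delta> * p0) ^ 3 / p0)"
proof -
  define a where "a = (29/25) * (A + 1) * (1 + 2 * T)"
  have a: "a > 0" using A T by (simp add: a_def)
  have \<delta>0: "\<delta> > 0" unfolding \<delta>(1) a_def[symmetric] using a eps p by simp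
  have a\<delta>: "a * sqrt \<epsilon> = \<delta> * p0\<^sup>2" unfolding \<delta>(1) a_def using p by simp
  define v where "v = (\<lambda>s. s / p0 + \<delta>)"
  define L where "L = (\<lambda>s. p0\<^sup>2 * (sqrt \<delta> * (4 * (v s * sqrt (v s)) + 60 * v s ^ 3)))"
  define L1 where "L1 = (\<lambda>s. p0 * (sqrt \<delta> * (6 * sqrt (v s) + 180 * (v s)\<^sup>2)))"
  define N where "N = (\<lambda>s. sqrt \<delta> * (3 / sqrt (v s) + 360 * v s))"
  have v0: "v s > 0" if "0 \<le> s" for s using that p \<delta>0 by (simp add: v_def add_nonneg_pos)
  have dv: "(v has_real_derivative 1 / p0) (at s)" for s
    unfolding v_def using p by (auto intro!: derivative_eq_intros)
  have dsq: "((\<lambda>s. sqrt (v s)) has_real_derivative (inverse (sqrt (v s)) / 2) * (1 / p0)) (at s)" if "0 \<le> s" for s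
    by (rule DERIV_chain2[OF DERIV_real_sqrt[OF v0[OF that]] dv])
  have "F T \<le> L T"
  proof (rule second_order_comparison[OF T, where ?F1.0 = F1 and M = M and ?L1.0 = L1 and N = N])
    fix s assume s: "0 \<le> s" "s \<le> T"
    show "(F has_real_derivative F1 s) (at s)" "(F1 has_real_derivative M s) (at s)"
      using s F_deriv F1_deriv by auto
    have vs: "v s * inverse (sqrt (v s)) = sqrt (v s)"
      using v0[OF s(1)] by (metis divide_inverse less_imp_le real_div_sqrt)
    show "(L has_real_derivative L1 s) (at s)"
      unfolding L_def
    proof (rule DERIV_cong)
      show "((\<lambda>s. p0\<^sup>2 * (sqrt \<delta> * (4 * (v s * sqrt (v s)) + 60 * v s ^ 3))) has_real_derivative
         p0\<^sup>2 * (sqrt \<delta> * (4 * (1 / p0 * sqrt (v s) + (inverse (sqrt (v s)) / 2) * (1 / p0) * v s)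
           + 60 * (3 * (1 / p0 * v s ^ 2))))) (at s)"
        by (intro DERIV_cmult DERIV_add DERIV_mult dv dsq s(1)) (use DERIV_power[OF dv, of 3] in simp)
      have e1: "inverse (sqrt (v s)) / 2 * (1 / p0) * v s = sqrt (v s) / (2 * p0)"
      proof -
        have "i / 2 * (1 / p0) * x = (x * i) / (2 * p0)" for i x :: real by simp
        then show ?thesis using vs by metis
      qed
      show "p0\<^sup>2 * (sqrt \<delta> * (4 * (1 / p0 * sqrt (v s) + (inverse (sqrt (v s)) / 2) * (1 / p0) * v s)
           + 60 * (3 * (1 / p0 * v s ^ 2)))) = L1 s"
        unfolding e1 L1_def using p by (simp add: power2_eq_square field_simps)
    qed
    show "(L1 has_real_derivative N s) (at s)"
      unfolding L1_def
    proof (rule DERIV_cong)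
      show "((\<lambda>s. p0 * (sqrt \<delta> * (6 * sqrt (v s) + 180 * (v s)\<^sup>2))) has_real_derivative
         p0 * (sqrt \<delta> * (6 * ((inverse (sqrt (v s)) / 2) * (1 / p0)) + 180 * (2 * (1 / p0 * v s))))) (at s)"
        by (intro DERIV_cmult DERIV_add DERIV_mult dv dsq s(1)) (use DERIV_power[OF dv, of 2] in simp)
      show "p0 * (sqrt \<delta> * (6 * ((inverse (sqrt (v s)) / 2) * (1 / p0)) + 180 * (2 * (1 / p0 * v s)))) = N s"
        unfolding N_def using p by (simp add: field_simps)
    qed
  next
    show "F 0 < L 0" using \<delta>0 p by (simp add: F_0 L_def v_def add_pos_pos)
    show "F1 0 \<le> L1 0" using \<delta>0 p by (simp add: F1_0 L1_def v_def)
    fix s assume s: "0 < s" "s \<le> T" and FL: "F s \<le> L s"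
    let ?\<tau> = "s / p0"
    have \<tau>: "?\<tau> > 0" using s p by simp
    have q: "q s = p0\<^sup>2 * (?\<tau> + ?\<tau>\<^sup>2 / 2)" using p by (simp add: q_def field_simps power2_eq_square)
    have q0: "q s > 0" using s p by (simp add: q_def add_pos_pos)
    have "M s \<le> (a * sqrt \<epsilon> + (58/25) * F s) / q s" using M_le[OF s] unfolding a_def .
    also have "\<dots> \<le> (a * sqrt \<epsilon> + (58/25) * L s) / q s" using FL q0 by (intro divide_right_mono) auto
    also have "a * sqrt \<epsilon> + (58/25) * L s = p0\<^sup>2 * (\<delta> + (58/25) * (sqrt \<delta> * (4 * (v s * sqrt (v s)) + 60 * v s ^ 3)))"
      unfolding a\<delta> L_def by (simp add: algebra_simps)
    also have "\<dots> / q s = (\<delta> + (58/25) * (sqrt \<delta> * (4 * (v s * sqrt (v s)) + 60 * v s ^ 3))) / (?\<tau> + ?\<tau>\<^sup>2 / 2)"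
      unfolding q using p by (subst mult_divide_mult_cancel_left) auto
    finally have "M s \<le> min 1 ((\<delta> + (58/25) * (sqrt \<delta> * (4 * (v s * sqrt (v s)) + 60 * v s ^ 3))) / (?\<tau> + ?\<tau>\<^sup>2 / 2))"
      using M_le_1[of s] by simp
    also have "\<dots> \<le> N s" unfolding v_def N_def by (rule growth_inequality[OF \<tau> \<delta>0 \<delta>(2)])
    finally show "M s \<le> N s" .
  qed
  also have "L T \<le> p0\<^sup>2 * (sqrt \<delta> * (4 + 64 * v T ^ 3))"
  proof -
    have vT: "v T > 0" by (rule v0[OF T])
    have "v T * sqrt (v T) \<le> 1 + v T ^ 3"
    proof (cases "v T \<le> 1")
      case True
      then have "v T * sqrt (v T) \<le> 1 * 1" using vT by (intro mult_mono) auto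
      then show ?thesis using vT by (smt (verit) zero_le_power)
    next
      case False
      then have "sqrt (v T) \<le> v T" using sqrt_le_D by (intro real_le_lsqrt) (auto simp: power2_eq_square)
      then have "v T * sqrt (v T) \<le> v T * v T" using vT by (intro mult_left_mono) auto
      also have "\<dots> \<le> v T * v T * v T" using False vT by (simp add: mult_le_cancel_left1)
      finally show ?thesis by (simp add: power3_eq_cube)
    qed
    then have "4 * (v T * sqrt (v T)) + 60 * v T ^ 3 \<le> 4 + 64 * v T ^ 3" by simp
    then show ?thesis unfolding L_def using \<delta>0 by (intro mult_left_mono) auto
  qed
  also have "\<dots> = sqrt \<delta> * (4 * p0\<^sup>2 + 64 * (T + \<delta> * p0) ^ 3 / p0)"
  proof -
    have "v T = (T + \<delta> * p0) / p0" using p by (simp add: v_def field_simps)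
    then have "p0\<^sup>2 * v T ^ 3 = (T + \<delta> * p0) ^ 3 / p0"
      using p by (simp add: power_divide power2_eq_square power3_eq_cube)
    moreover have "p0\<^sup>2 * (sqrt \<delta> * (4 + 64 * v T ^ 3)) = sqrt \<delta> * (4 * p0\<^sup>2 + 64 * (p0\<^sup>2 * v T ^ 3))"
      by (simp add: algebra_simps)
    ultimately show ?thesis by simp
  qed
  finally show ?thesis .
qed

text \<open>Two regimes keep \<open>M s\<close> below \<open>lam * s\<close>. Up to
  \<open>s0\<close> the quadratic bound does, since C s^2 \<le> C s0 s; afterwards the spread
  inequality does, because s^3 is a strict supersolution. \<open>lam\<close> is the sum of what the
  two regimes require, and the added sqrt \<epsilon> provides the strict inequality at time
  0.\<close>

lemma F_bound_rest:
  assumes T: "T \<ge> 0" and p: "p0 = 0" and C: "C \<ge> 0" and s0: "s0 > 0"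
    and quad: "\<And>s. 0 \<le> s \<Longrightarrow> M s \<le> C * s\<^sup>2"
  defines "a \<equiv> (29/25) * (A + 1) * (1 + 2 * T)"
  defines "lam \<equiv> C * s0 + 5 * (2 * a + 5) * sqrt \<epsilon> / s0 ^ 3"
  shows "F T \<le> lam * T ^ 3 / 6 + sqrt \<epsilon>"
proof -
  have a: "a > 0" using A T by (simp add: a_def)
  have e: "sqrt \<epsilon> > 0" using eps by simp
  have lam0: "lam \<ge> 0" and lam1: "lam \<ge> C * s0" and lam2: "lam * s0 ^ 3 \<ge> 5 * (2 * a + 5) * sqrt \<epsilon>"
    unfolding lam_def using a e s0 C by (auto simp: field_simps)
  show ?thesis
  proof (rule second_order_comparison[OF T, where L = "\<lambda>s. lam * s ^ 3 / 6 + sqrt \<epsilon>" and ?F1.0 = F1 and M = M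
        and ?L1.0 = "\<lambda>s. lam * s\<^sup>2 / 2" and N = "\<lambda>s. lam * s"])
    fix s assume s: "0 \<le> s" "s \<le> T"
    show "(F has_real_derivative F1 s) (at s)" "(F1 has_real_derivative M s) (at s)"
      using s F_deriv F1_deriv by auto
    show "((\<lambda>s. lam * s ^ 3 / 6 + sqrt \<epsilon>) has_real_derivative lam * s\<^sup>2 / 2) (at s)"
      by (auto intro!: derivative_eq_intros)
    show "((\<lambda>s. lam * s\<^sup>2 / 2) has_real_derivative lam * s) (at s)"
      by (auto intro!: derivative_eq_intros)
  next
    fix s assume s: "0 < s" "s \<le> T" and FL: "F s \<le> lam * s ^ 3 / 6 + sqrt \<epsilon>"
    show "M s \<le> lam * s"
    proof (cases "s \<le> s0")
      case True
      have "M s \<le> C * s * s" using quad[of s] s by (simp add: power2_eq_square mult.assoc)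
      also have "\<dots> \<le> lam * s" using True C s lam1 mult_left_mono[OF True C] by (intro mult_right_mono) auto
      finally show ?thesis .
    next
      case False
      have q: "q s = s\<^sup>2 / 2" unfolding q_def using p by simp
      have "lam * s0 ^ 3 \<le> lam * s ^ 3" using False s0 lam0 by (intro mult_left_mono power_mono) auto
      then have l: "5 * (2 * a + 5) * sqrt \<epsilon> \<le> lam * s ^ 3" using lam2 by linarith
      have "M s \<le> (a * sqrt \<epsilon> + (58/25) * F s) / q s" using M_le[OF s] unfolding a_def .
      also have "\<dots> \<le> (lam * s ^ 3 / 2) / q s"
      proof (rule divide_right_mono)
        \<comment> \<open>After insertion of the bound for \<open>F s\<close> the term
          \<open>lam * s ^ 3\<close> occurs with the factor 58/150 < 1/2. The remaining 17/150 of it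
          must cover (a + 58/25) sqrt \<epsilon>, which the constant 5 (2 a + 5) ensures.\<close>
        have "5 * (2 * a + 5) * sqrt \<epsilon> = 10 * (a * sqrt \<epsilon>) + 25 * sqrt \<epsilon>" by (simp add: algebra_simps)
        moreover have "a * sqrt \<epsilon> \<ge> 0" using a e by simp
        ultimately show "a * sqrt \<epsilon> + (58/25) * F s \<le> lam * s ^ 3 / 2" using l FL e by linarith
      qed (use s in \<open>simp add: q\<close>)
      also have "\<dots> = lam * s" unfolding q using s by (simp add: power2_eq_square power3_eq_cube)
      finally show ?thesis .
    qed
  qed (use e lam0 in \<open>auto simp: F_0 F1_0\<close>)
qed

end

section \<open>Wave packets\<close>

lemma is_C2c_scale:
  assumes "is_C2c f f1 f2" "s \<noteq> 0"
  shows "is_C2c (\<lambda>x. f (x / s)) (\<lambda>x. of_real (1 / s) * f1 (x / s)) (\<lambda>x. of_real (1 / s\<^sup>2) * f2 (x / s))"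
proof -
  note F = is_C2c_D[OF assms(1)]
  have d: "((\<lambda>x. g (x / s)) has_vector_derivative of_real (1 / s) * g' (x / s)) (at x)"
    if "\<And>x. (g has_vector_derivative g' x) (at x)" for g g' :: "real \<Rightarrow> complex" and x
  proof -
    have "((\<lambda>x. x / s) has_vector_derivative 1 / s) (at x)"
      using assms(2) by (auto simp flip: has_real_derivative_iff_has_vector_derivative intro!: derivative_eq_intros)
    from vector_diff_chain_at[OF this that] show ?thesis by (simp add: o_def scaleR_conv_of_real)
  qed
  have d2: "((\<lambda>x. of_real (1 / s) * f1 (x / s)) has_vector_derivative of_real (1 / s\<^sup>2) * f2 (x / s)) (at x)" for x
    using has_vector_derivative_mult_right[OF d[OF F(5)], of "of_real (1 / s)"]
    by (simp add: power2_eq_square)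
  show ?thesis unfolding is_C2c_def
    using d[OF F(4)] d2 Cc_scale[OF F(1) assms(2)] Cc_continuous[OF Cc_cmult[OF Cc_scale[OF F(3) assms(2)]]]
    by blast
qed

lemma L2_scale:
  assumes "f \<in> L2" "s > 0"
  shows "(\<lambda>x. f (x / s)) \<in> L2" "l2norm (\<lambda>x. f (x / s)) = sqrt s * l2norm f"
proof -
  note [measurable] = L2_D(1)[OF assms(1)]
  have i: "integrable lborel (\<lambda>x. (norm (f (x / s)))\<^sup>2)"
    using lborel_integrable_real_affine[OF L2_D(2)[OF assms(1)], of "1 / s" 0] assms(2) by simp
  show "(\<lambda>x. f (x / s)) \<in> L2" by (rule L2_I[OF _ i]) measurable
  have "(LINT x|lborel. (norm (f (x / s)))\<^sup>2) = s * (LINT x|lborel. (norm (f x))\<^sup>2)"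
    using lborel_integral_real_affine[of s "\<lambda>x. (norm (f (x / s)))\<^sup>2" 0] assms(2) by simp
  then show "l2norm (\<lambda>x. f (x / s)) = sqrt s * l2norm f"
    by (simp add: l2norm_def real_sqrt_mult)
qed

definition rescale :: "real \<Rightarrow> (real \<Rightarrow> complex) \<Rightarrow> real \<Rightarrow> complex" where
  "rescale \<epsilon> f x = of_real (1 / \<epsilon> powr (1 / 4)) * f (x / sqrt \<epsilon>)"

lemma rescale_L2:
  assumes "f \<in> L2" "\<epsilon> > 0"
  shows "rescale \<epsilon> f \<in> L2" "l2norm (rescale \<epsilon> f) = l2norm f"
proof -
  have s: "sqrt \<epsilon> > 0" using assms(2) by simp
  show "rescale \<epsilon> f \<in> L2" unfolding rescale_def[abs_def] by (intro L2_cmult L2_scale(1)[OF assms(1) s])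
  have q: "sqrt (sqrt \<epsilon>) = \<epsilon> powr (1 / 4)"
    using assms(2) by (simp flip: powr_half_sqrt add: powr_powr)
  have "l2norm (rescale \<epsilon> f) = (1 / \<epsilon> powr (1 / 4)) * (\<epsilon> powr (1 / 4) * l2norm f)"
    unfolding rescale_def[abs_def] l2norm_cmult L2_scale(2)[OF assms(1) s] q
    by (simp only: norm_of_real abs_of_nonneg[OF divide_nonneg_nonneg[OF zero_le_one powr_ge_zero]])
  then show "l2norm (rescale \<epsilon> f) = l2norm f" using assms(2) by simp
qed

text \<open>The plane wave with wave number p0 / \<epsilon> carries the semiclassical momentum p0.
  The data with momentum -\<epsilon> powr \<beta> are brought to this form with a positive sign by
  conjugation or reflection.\<close>

definition packet :: "real \<Rightarrow> real \<Rightarrow> (real \<Rightarrow> complex) \<Rightarrow> real \<Rightarrow> complex" where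
  "packet \<epsilon> p0 f x = character (p0 / \<epsilon>) x * rescale \<epsilon> f x"

lemma packet_L2:
  assumes "f \<in> L2" "\<epsilon> > 0"
  shows "packet \<epsilon> p0 f \<in> L2" "l2norm (packet \<epsilon> p0 f) = l2norm f"
proof -
  show "packet \<epsilon> p0 f \<in> L2" unfolding packet_def[abs_def]
    by (rule L2_mult_bounded(1)[where C = 1]) (auto intro: rescale_L2 assms)
  have "l2norm (packet \<epsilon> p0 f) = l2norm (rescale \<epsilon> f)"
    by (rule l2norm_cong_norm) (simp add: packet_def norm_mult)
  then show "l2norm (packet \<epsilon> p0 f) = l2norm f" using rescale_L2 assms by simp
qed

text \<open>For |h| \<le> 1 the mean value inequality on a fixed support applies; for larger h the
  bound 2 \<open>l2norm f\<close> is itself at most a multiple of |h|.\<close>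

lemma translation_lipschitz:
  assumes f: "is_C2c f f1 f2"
  shows "\<exists>C\<ge>0. \<forall>h. l2norm (\<lambda>x. f (x - h) - f x) \<le> C * \<bar>h\<bar>"
proof -
  note F = is_C2c_D[OF f]
  obtain R where R: "R > 0" "\<And>x. R < \<bar>x\<bar> \<Longrightarrow> f x = 0" using Cc_E[OF F(1)] by metis
  obtain B where B: "B > 0" "\<And>x. norm (f1 x) \<le> B" using Cc_bounded[OF F(2)] by auto
  define C where "C = sqrt (2 * (R + 1)) * B + 2 * l2norm f"
  have C: "C \<ge> 0" using R B by (simp add: C_def l2norm_nonneg)
  have fL: "f \<in> L2" by (rule Cc_L2[OF F(1)])
  have "l2norm (\<lambda>x. f (x - h) - f x) \<le> C * \<bar>h\<bar>" for h
  proof (cases "\<bar>h\<bar> \<le> 1")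
    case True
    have b: "norm (f (x - h) - f x) \<le> B * \<bar>h\<bar>" for x
    proof -
      have "norm (f (x - h) - f x) \<le> B * norm ((x - h) - x)"
        by (rule differentiable_bound[where S = UNIV and f' = "\<lambda>x h. h *\<^sub>R f1 x"])
          (use F(4) B(2) in \<open>auto simp: has_vector_derivative_def mult.commute[of B] intro!: onorm_le mult_left_mono\<close>)
      then show ?thesis by simp
    qed
    have z: "f (x - h) - f x = 0" if "R + 1 < \<bar>x\<bar>" for x
      using that True R(2)[of x] R(2)[of "x - h"] by auto
    have "l2norm (\<lambda>x. f (x - h) - f x) \<le> sqrt (2 * (R + 1)) * (B * \<bar>h\<bar>)"
      by (rule l2norm_le_of_bounded_support(2)[OF _ b z])
        (use R Cc_measurable[OF Cc_diff[OF Cc_translate[OF F(1)] F(1)]] in auto)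
    also have "\<dots> = (sqrt (2 * (R + 1)) * B) * \<bar>h\<bar>" by simp
    also have "\<dots> \<le> C * \<bar>h\<bar>" by (rule mult_right_mono) (auto simp: C_def l2norm_nonneg)
    finally show ?thesis .
  next
    case False
    have "l2norm (\<lambda>x. f (x - h) - f x) \<le> l2norm f + l2norm f"
      using l2norm_diff_le[OF L2_translate[OF fL] fL, of h] by (simp add: l2norm_translate)
    also have "\<dots> \<le> C * 1" using B R by (simp add: C_def)
    also have "\<dots> \<le> C * \<bar>h\<bar>" using False C by (intro mult_left_mono) auto
    finally show ?thesis .
  qed
  with C show ?thesis by blast
qed

text \<open>In the variable x / sqrt \<epsilon> both the translation and the character are of size
  sqrt \<epsilon>, and the phase p0 y cancels what the translation does to the plane wave. Hence
  \<open>A\<close> depends on neither \<epsilon> nor p0.\<close>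

lemma packet_weyl_estimate:
  assumes f: "is_C2c f f1 f2"
  shows "\<exists>A\<ge>0. \<forall>\<epsilon> p0 \<kappa> y T. \<epsilon> > 0 \<longrightarrow> \<kappa> \<ge> 0 \<longrightarrow> y \<ge> 0 \<longrightarrow> T \<ge> 0 \<longrightarrow> \<kappa> = 0 \<or> y = \<kappa> * T \<longrightarrow>
    l2norm (\<lambda>x. exp (\<i> * of_real (p0 * y + \<epsilon> * \<kappa>\<^sup>2 * T / 2)) * character (-\<kappa>) x * packet \<epsilon> p0 f (x - \<epsilon> * y)
       - packet \<epsilon> p0 f x) \<le> sqrt \<epsilon> * A * (\<kappa> * (1 + T) + y)"
proof -
  note F = is_C2c_D[OF f]
  obtain R where R: "R > 0" "\<And>x. R < \<bar>x\<bar> \<Longrightarrow> f x = 0" using Cc_E[OF F(1)] by metis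
  obtain C where C: "C \<ge> 0" "\<And>h. l2norm (\<lambda>x. f (x - h) - f x) \<le> C * \<bar>h\<bar>"
    using translation_lipschitz[OF f] by auto
  define A where "A = (1 + R) * l2norm f + C"
  have A: "A \<ge> 0" "C \<le> A" "(1 + R) * l2norm f \<le> A"
    using C(1) R(1) by (auto simp: A_def l2norm_nonneg)
  have fL: "f \<in> L2" by (rule Cc_L2[OF F(1)])
  show ?thesis
  proof (intro exI[of _ A] conjI A(1) allI impI)
    fix \<epsilon> p0 \<kappa> y T :: real
    assume eps: "\<epsilon> > 0" and \<kappa>: "\<kappa> \<ge> 0" and y: "y \<ge> 0" and T: "T \<ge> 0" and or: "\<kappa> = 0 \<or> y = \<kappa> * T"
    let ?s = "sqrt \<epsilon>"
    have s: "?s > 0" using eps by simp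
    have ss: "?s * ?s = \<epsilon>" using eps by simp
    define \<theta> where "\<theta> = (\<lambda>z. \<epsilon> * \<kappa>\<^sup>2 * T / 2 - \<kappa> * (?s * z))"
    define f1 where "f1 = (\<lambda>z. (exp (\<i> * of_real (\<theta> z)) - 1) * f (z - ?s * y))"
    define f2 where "f2 = (\<lambda>z. f (z - ?s * y) - f z)"
    have f1L: "f1 \<in> L2" and f2L: "f2 \<in> L2"
    proof -
      have "(\<lambda>z. exp (\<i> * of_real (\<theta> z)) - 1) \<in> borel_measurable borel" unfolding \<theta>_def by measurable
      from L2_mult_bounded(1)[OF this L2_translate[OF fL] norm_iexp_minus_1_le_2] show "f1 \<in> L2" unfolding f1_def .
      show "f2 \<in> L2" unfolding f2_def by (intro L2_diff L2_translate fL)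
    qed
    have "l2norm (\<lambda>x. exp (\<i> * of_real (p0 * y + \<epsilon> * \<kappa>\<^sup>2 * T / 2)) * character (-\<kappa>) x * packet \<epsilon> p0 f (x - \<epsilon> * y)
       - packet \<epsilon> p0 f x) = l2norm (rescale \<epsilon> (\<lambda>z. f1 z + f2 z))"
    proof (rule l2norm_cong_norm)
      fix x
      have sc: "(x - \<epsilon> * y) / ?s = x / ?s - ?s * y" using s ss by (simp add: field_simps)
      have th: "\<theta> (x / ?s) = \<epsilon> * \<kappa>\<^sup>2 * T / 2 - \<kappa> * x" using s by (simp add: \<theta>_def)
      have ph: "exp (\<i> * of_real (p0 * y + \<epsilon> * \<kappa>\<^sup>2 * T / 2)) * character (-\<kappa>) x * character (p0 / \<epsilon>) (x - \<epsilon> * y)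
         = character (p0 / \<epsilon>) x * exp (\<i> * of_real (\<theta> (x / ?s)))"
        unfolding character_def exp_add[symmetric] th using eps by (simp add: algebra_simps)
      have "exp (\<i> * of_real (p0 * y + \<epsilon> * \<kappa>\<^sup>2 * T / 2)) * character (-\<kappa>) x * packet \<epsilon> p0 f (x - \<epsilon> * y)
          - packet \<epsilon> p0 f x
        = (exp (\<i> * of_real (p0 * y + \<epsilon> * \<kappa>\<^sup>2 * T / 2)) * character (-\<kappa>) x * character (p0 / \<epsilon>) (x - \<epsilon> * y))
            * rescale \<epsilon> f (x - \<epsilon> * y) - character (p0 / \<epsilon>) x * rescale \<epsilon> f x"
        by (simp add: packet_def)
      also have "\<dots> = character (p0 / \<epsilon>) x * rescale \<epsilon> (\<lambda>z. f1 z + f2 z) x"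
        unfolding ph rescale_def sc f1_def f2_def by (simp add: algebra_simps)
      finally show "norm (exp (\<i> * of_real (p0 * y + \<epsilon> * \<kappa>\<^sup>2 * T / 2)) * character (-\<kappa>) x * packet \<epsilon> p0 f (x - \<epsilon> * y)
          - packet \<epsilon> p0 f x) = norm (rescale \<epsilon> (\<lambda>z. f1 z + f2 z) x)" by (simp add: norm_mult)
    qed
    also have "\<dots> = l2norm (\<lambda>z. f1 z + f2 z)" by (rule rescale_L2(2)[OF L2_add[OF f1L f2L] eps])
    also have "\<dots> \<le> l2norm f1 + l2norm f2" by (rule l2norm_add_le[OF f1L f2L])
    also have "l2norm f2 \<le> C * (?s * y)" unfolding f2_def using C(2)[of "?s * y"] s y by (simp add: abs_mult)
    also have "l2norm f1 \<le> (?s * \<kappa> * (1 + T) * (1 + R)) * l2norm (\<lambda>z. f (z - ?s * y))"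
    proof (rule L2_dominated(2)[OF L2_D(1)[OF f1L] L2_translate[OF fL]])
      show "0 \<le> ?s * \<kappa> * (1 + T) * (1 + R)" using s \<kappa> T R by simp
      fix z
      show "norm (f1 z) \<le> (?s * \<kappa> * (1 + T) * (1 + R)) * norm (f (z - ?s * y))"
      proof (cases "f (z - ?s * y) = 0 \<or> \<kappa> = 0")
        case True then show ?thesis by (auto simp: f1_def \<theta>_def)
      next
        case False
        then have z: "\<bar>z - ?s * y\<bar> \<le> R" and yT: "y = \<kappa> * T" using R(2)[of "z - ?s * y"] or by (auto simp: not_less[symmetric])
        define a where "a = - (\<epsilon> * \<kappa>\<^sup>2 * T / 2)"
        define b where "b = - (\<kappa> * ?s * (z - ?s * y))"
        \<comment> \<open>Centring the character at the translated support costs the phase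
          -\<epsilon> \<kappa>^2 T, because y = \<kappa> T. This flips the sign of the phase
          \<epsilon> \<kappa>^2 T / 2, while \<open>b\<close> is now small on the support.\<close>
        have "\<theta> z = a + b"
        proof -
          have "\<kappa> * ?s * (?s * y) = \<epsilon> * \<kappa>\<^sup>2 * T" using ss unfolding yT power2_eq_square by (metis mult.assoc mult.commute)
          then show ?thesis by (simp add: \<theta>_def a_def b_def algebra_simps)
        qed
        then have "exp (\<i> * of_real (\<theta> z)) - 1 =
            exp (\<i> * of_real b) * (exp (\<i> * of_real a) - 1) + (exp (\<i> * of_real b) - 1)"
          by (simp add: exp_add algebra_simps)
        then have "norm (exp (\<i> * of_real (\<theta> z)) - 1) \<le>
            norm (exp (\<i> * of_real b) * (exp (\<i> * of_real a) - 1)) + norm (exp (\<i> * of_real b) - 1)"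
          using norm_triangle_ineq by metis
        also have "\<dots> = norm (exp (\<i> * of_real a) - 1) + norm (exp (\<i> * of_real b) - 1)"
          by (simp add: norm_mult)
        \<comment> \<open>\<open>a\<close> is quadratic in \<kappa> whereas a linear bound is
          required: multiplying the bounds |a| and 2 of the same norm gives its square at most 2
          |a|.\<close>
        also have "norm (exp (\<i> * of_real a) - 1) \<le> ?s * \<kappa> * (1 + T)"
        proof (rule power2_le_imp_le)
          have "(norm (exp (\<i> * of_real a) - 1))\<^sup>2 \<le> \<bar>a\<bar> * 2"
            unfolding power2_eq_square by (intro mult_mono norm_iexp_minus_1_le norm_iexp_minus_1_le_2) auto
          also have "\<dots> = \<epsilon> * \<kappa>\<^sup>2 * T" using eps T by (simp add: a_def abs_mult)
          also have "\<dots> \<le> \<epsilon> * \<kappa>\<^sup>2 * (1 + T)\<^sup>2"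
            using eps T by (intro mult_left_mono) (auto simp: power2_eq_square algebra_simps)
          also have "\<dots> = (?s * \<kappa> * (1 + T))\<^sup>2" using eps by (simp add: power_mult_distrib)
          finally show "(norm (exp (\<i> * of_real a) - 1))\<^sup>2 \<le> (?s * \<kappa> * (1 + T))\<^sup>2" .
        qed (use s \<kappa> T in simp)
        also have "norm (exp (\<i> * of_real b) - 1) \<le> \<kappa> * ?s * R"
        proof (rule order_trans[OF norm_iexp_minus_1_le])
          show "\<bar>b\<bar> \<le> \<kappa> * ?s * R" unfolding b_def using z \<kappa> s by (simp add: abs_mult mult_left_mono)
        qed
        also have "?s * \<kappa> * (1 + T) + \<kappa> * ?s * R \<le> ?s * \<kappa> * (1 + T) * (1 + R)"
        proof -
          have "?s * \<kappa> * R * 1 \<le> ?s * \<kappa> * R * (1 + T)" using s \<kappa> R T by (intro mult_left_mono) auto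
          then show ?thesis by (simp add: algebra_simps)
        qed
        finally show ?thesis unfolding f1_def norm_mult by (intro mult_right_mono) auto
      qed
    qed
    also have "l2norm (\<lambda>z. f (z - ?s * y)) = l2norm f" by (rule l2norm_translate)
    also have "(?s * \<kappa> * (1 + T) * (1 + R)) * l2norm f + C * (?s * y) =
        ?s * (\<kappa> * (1 + T)) * ((1 + R) * l2norm f) + ?s * y * C" by simp
    also have "\<dots> \<le> ?s * (\<kappa> * (1 + T)) * A + ?s * y * A"
      using s \<kappa> T y A by (intro add_mono mult_left_mono) auto
    also have "\<dots> = ?s * A * (\<kappa> * (1 + T) + y)" by (simp add: algebra_simps)
    finally show "l2norm (\<lambda>x. exp (\<i> * of_real (p0 * y + \<epsilon> * \<kappa>\<^sup>2 * T / 2)) * character (-\<kappa>) x * packet \<epsilon> p0 f (x - \<epsilon> * y)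
       - packet \<epsilon> p0 f x) \<le> ?s * A * (\<kappa> * (1 + T) + y)" by simp
  qed
qed

text \<open>The initial value is attained almost everywhere only, hence the difference is recorded
  through its norm.\<close>

lemma solution_evolution:
  assumes eps: "\<epsilon> > 0" and sol: "schroedinger_solution \<epsilon> absV g \<psi>"
    and g: "g \<in> L2" "l2norm g = 1"
  shows "\<exists>\<psi>'. evolution \<epsilon> \<psi> \<psi>'" "l2norm (\<lambda>x. \<psi> 0 x - g x) = 0"
proof -
  have AE: "AE x in lborel. \<psi> 0 x = g x" using sol by (simp add: schroedinger_solution_def)
  obtain \<psi>' where "\<forall>t. \<psi> t \<in> L2 \<and> \<psi>' t \<in> L2 \<and>
      ((\<lambda>h. l2norm (\<lambda>x. (\<psi> (t + h) x - \<psi> t x) / of_real h - \<psi>' t x)) \<longlongrightarrow> 0) (at 0) \<and>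
      (\<psi> t, \<lambda>x. \<i> * of_real \<epsilon> * \<psi>' t x) \<in> hamiltonian \<epsilon> absV"
    using sol unfolding schroedinger_solution_def by (elim conjE exE)
  then have p: "\<And>t. \<psi> t \<in> L2" "\<And>t. \<psi>' t \<in> L2"
    "\<And>t. ((\<lambda>h. l2norm (\<lambda>x. (\<psi> (t + h) x - \<psi> t x) / of_real h - \<psi>' t x)) \<longlongrightarrow> 0) (at 0)"
    "\<And>t. (\<psi> t, \<lambda>x. \<i> * of_real \<epsilon> * \<psi>' t x) \<in> hamiltonian \<epsilon> absV"
    by simp_all
  have "l2norm (\<psi> 0) = l2norm g"
    by (rule l2norm_cong_AE[OF AE L2_D(1)[OF p(1)] L2_D(1)[OF g(1)]])
  then have "evolution \<epsilon> \<psi> \<psi>'"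
    using eps p g by unfold_locales (auto simp: l2_deriv_def)
  then show "\<exists>\<psi>'. evolution \<epsilon> \<psi> \<psi>'" by blast
  have "l2norm (\<lambda>x. \<psi> 0 x - g x) = l2norm (\<lambda>x. 0)"
    by (rule l2norm_cong_AE) (use AE L2_D(1)[OF L2_diff[OF p(1) g(1)]] in auto)
  then show "l2norm (\<lambda>x. \<psi> 0 x - g x) = 0" by (simp add: l2norm_def)
qed

text \<open>The order of the quantifiers is the point: \<open>A\<close> depends on the profile
  alone, so the estimates remain uniform as \<epsilon> tends to 0.\<close>

lemma wave_packets:
  assumes f: "is_C2c f f1 f2" "l2norm f = 1"
  shows "\<exists>A. \<forall>\<epsilon> p0 \<psi>. \<epsilon> > 0 \<longrightarrow> p0 \<ge> 0 \<longrightarrow> schroedinger_solution \<epsilon> absV (packet \<epsilon> p0 f) \<psi> \<longrightarrow>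
    (\<exists>\<psi>'. wave_packet \<epsilon> \<psi> \<psi>' p0 A)"
proof -
  obtain A where A: "A \<ge> 0" "\<And>\<epsilon> p0 \<kappa> y T. \<epsilon> > 0 \<Longrightarrow> \<kappa> \<ge> 0 \<Longrightarrow> y \<ge> 0 \<Longrightarrow> T \<ge> 0 \<Longrightarrow> \<kappa> = 0 \<or> y = \<kappa> * T \<Longrightarrow>
    l2norm (\<lambda>x. exp (\<i> * of_real (p0 * y + \<epsilon> * \<kappa>\<^sup>2 * T / 2)) * character (-\<kappa>) x * packet \<epsilon> p0 f (x - \<epsilon> * y)
       - packet \<epsilon> p0 f x) \<le> sqrt \<epsilon> * A * (\<kappa> * (1 + T) + y)"
    using packet_weyl_estimate[OF f(1)] by blast
  have fL: "f \<in> L2" by (rule Cc_L2[OF is_C2c_D(1)[OF f(1)]])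
  show ?thesis
  proof (intro exI[of _ A] allI impI)
    fix \<epsilon> p0 :: real and \<psi>
    assume eps: "\<epsilon> > 0" and p0: "p0 \<ge> 0" and sol: "schroedinger_solution \<epsilon> absV (packet \<epsilon> p0 f) \<psi>"
    let ?g = "packet \<epsilon> p0 f"
    note g = packet_L2[OF fL eps, of p0]
    obtain \<psi>' where ev: "evolution \<epsilon> \<psi> \<psi>'"
      using solution_evolution(1)[OF eps sol] g f(2) by auto
    have z: "l2norm (\<lambda>x. \<psi> 0 x - ?g x) = 0" using solution_evolution(2)[OF eps sol] g f(2) by auto
    interpret evolution \<epsilon> \<psi> \<psi>' by fact
    have "wave_packet \<epsilon> \<psi> \<psi>' p0 A"
    proof
      fix \<kappa> y T :: real assume h: "\<kappa> \<ge> 0" "y \<ge> 0" "T \<ge> 0" "\<kappa> = 0 \<or> y = \<kappa> * T"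
      define c where "c = (\<lambda>x. exp (\<i> * of_real (p0 * y + \<epsilon> * \<kappa>\<^sup>2 * T / 2)) * character (-\<kappa>) x)"
      have c: "c \<in> borel_measurable borel" "norm (c x) \<le> 1" for x unfolding c_def by (auto simp: norm_mult)
      have L: "(\<lambda>x. c x * u (x - \<epsilon> * y)) \<in> L2" if "u \<in> L2" for u
        by (rule L2_mult_bounded(1)[OF c(1) L2_translate[OF that] c(2)])
      have d: "(\<lambda>x. \<psi> 0 x - ?g x) \<in> L2" by (rule L2_diff[OF psi_L2 g(1)])
      have "l2norm (\<lambda>x. c x * \<psi> 0 (x - \<epsilon> * y) - \<psi> 0 x) \<le>
          l2norm (\<lambda>x. c x * \<psi> 0 (x - \<epsilon> * y) - c x * ?g (x - \<epsilon> * y)) + l2norm (\<lambda>x. c x * ?g (x - \<epsilon> * y) - \<psi> 0 x)"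
        by (rule l2norm_triangle[OF L[OF psi_L2] L[OF g(1)] psi_L2])
      also have "l2norm (\<lambda>x. c x * ?g (x - \<epsilon> * y) - \<psi> 0 x) \<le>
          l2norm (\<lambda>x. c x * ?g (x - \<epsilon> * y) - ?g x) + l2norm (\<lambda>x. ?g x - \<psi> 0 x)"
        by (rule l2norm_triangle[OF L[OF g(1)] g(1) psi_L2])
      also have "l2norm (\<lambda>x. ?g x - \<psi> 0 x) = 0" using z l2norm_minus_commute[of ?g "\<psi> 0"] by simp
      also have "l2norm (\<lambda>x. c x * \<psi> 0 (x - \<epsilon> * y) - c x * ?g (x - \<epsilon> * y)) \<le> 1 * l2norm (\<lambda>x. \<psi> 0 (x - \<epsilon> * y) - ?g (x - \<epsilon> * y))"
        using L2_mult_bounded(2)[OF c(1) L2_translate[OF d] c(2), of "\<epsilon> * y"] by (simp add: right_diff_distrib)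
      also have "l2norm (\<lambda>x. \<psi> 0 (x - \<epsilon> * y) - ?g (x - \<epsilon> * y)) = 0"
        using z l2norm_translate[of "\<lambda>x. \<psi> 0 x - ?g x" "\<epsilon> * y"] by simp
      finally show "l2norm (\<lambda>x. exp (\<i> * of_real (p0 * y + \<epsilon> * \<kappa>\<^sup>2 * T / 2)) * character (-\<kappa>) x * \<psi> 0 (x - \<epsilon> * y) - \<psi> 0 x)
         \<le> sqrt \<epsilon> * A * (\<kappa> * (1 + T) + y)"
        using A(2)[OF eps h, of p0] unfolding c_def by linarith
    qed (use p0 A in auto)
    then show "\<exists>\<psi>'. wave_packet \<epsilon> \<psi> \<psi>' p0 A" by blast
  qed
qed

lemma l2_deriv_diff:
  assumes f: "\<And>s. f s \<in> L2" "f' \<in> L2" "l2_deriv f f' t" and g: "\<And>s. g s \<in> L2" "g' \<in> L2" "l2_deriv g g' t"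
  shows "l2_deriv (\<lambda>s x. f s x - g s x) (\<lambda>x. f' x - g' x) t"
  unfolding l2_deriv_def
proof (rule Lim_null_comparison)
  let ?f = "\<lambda>h x. (f (t + h) x - f t x) / of_real h - f' x"
  let ?g = "\<lambda>h x. (g (t + h) x - g t x) / of_real h - g' x"
  show "\<forall>\<^sub>F h in at 0. norm (l2norm (\<lambda>x. (f (t + h) x - g (t + h) x - (f t x - g t x)) / of_real h - (f' x - g' x)))
      \<le> l2norm (?f h) + l2norm (?g h)"
  proof (intro always_eventually allI)
    fix h :: real
    have "(\<lambda>x. (f (t + h) x - g (t + h) x - (f t x - g t x)) / of_real h - (f' x - g' x)) = (\<lambda>x. ?f h x - ?g h x)"
      by (simp add: fun_eq_iff diff_divide_distrib)
    then show "norm (l2norm (\<lambda>x. (f (t + h) x - g (t + h) x - (f t x - g t x)) / of_real h - (f' x - g' x)))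
      \<le> l2norm (?f h) + l2norm (?g h)"
      using l2norm_diff_le[OF L2_diff[OF l2_deriv_quotient_L2[of f, OF f(1)] f(2)]
          L2_diff[OF l2_deriv_quotient_L2[of g, OF g(1)] g(2)]]
      by (simp add: l2norm_nonneg)
  qed
  show "((\<lambda>h. l2norm (?f h) + l2norm (?g h)) \<longlongrightarrow> 0) (at 0)"
    using f(3) g(3) tendsto_add[of _ 0 _ _ 0] unfolding l2_deriv_def by fastforce
qed

text \<open>Short times for \<open>p0 = 0\<close>. The first-order Taylor polynomial (in \<open>s\<close>) of the free evolution,
  transported along the trajectory \<open>(s\<^sup>2/2, s)\<close>, keeps the support of the data and therefore never
  meets the singularity; its residual is \<open>O(\<epsilon> s)\<close>.\<close>

lemma (in evolution) short_time:
  assumes c1: "is_C2c f f1 f2" and c2: "is_C2c f2 f3 f4"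
    and z: "\<And>x. x < 0 \<Longrightarrow> f x = 0"
    and ini: "l2norm (\<lambda>x. \<psi> 0 x - packet \<epsilon> 0 f x) = 0" and T: "T \<ge> 0"
  shows "M T \<le> l2norm f4 / 8 * T\<^sup>2"
proof -
  note F = is_C2c_D[OF c1] and F2 = is_C2c_D[OF c2]
  let ?r = "sqrt \<epsilon>"
  have r: "?r > 0" "?r\<^sup>2 = \<epsilon>" using eps by auto
  have zd: "g' x = 0" if "x < 0" "\<And>x. x < 0 \<Longrightarrow> g x = 0" "\<And>x. (g has_vector_derivative g' x) (at x)"
    for g g' :: "real \<Rightarrow> complex" and x
  proof -
    have "((\<lambda>_. 0) has_vector_derivative g' x) (at x)"
      by (rule has_vector_derivative_transform_within_open[OF that(3), where S = "{..<0}"]) (use that in auto)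
    then show ?thesis using vector_derivative_unique_at has_vector_derivative_const by metis
  qed
  have z1: "f1 x = 0" if "x < 0" for x using zd[OF that z F(4)] .
  have z2: "f2 x = 0" if "x < 0" for x using zd[OF that z1 F(5)] .
  have z3: "f3 x = 0" if "x < 0" for x using zd[OF that z2 F2(4)] .
  have z4: "f4 x = 0" if "x < 0" for x using zd[OF that z3 F2(5)] .
  define c0 where "c0 = complex_of_real (1 / \<epsilon> powr (1 / 4))"
  define Z where "Z = (\<lambda>s x. (x - s\<^sup>2 / 2) / ?r)"
  \<comment> \<open>Momentum s and position s^2 / 2 of the trajectory from rest under the potential
    -x; its action contributes -s^3 / 6.\<close>
  define P where "P = (\<lambda>s x. exp (\<i> * of_real ((s * x - s ^ 3 / 6) / \<epsilon>)))"
  define G where "G = (\<lambda>s x. c0 * (f (Z s x) + \<i> * of_real s / 2 * f2 (Z s x)))"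
  define H1 where "H1 = (\<lambda>s x. c0 * (f1 (Z s x) + \<i> * of_real s / 2 * f3 (Z s x)))"
  define H2 where "H2 = (\<lambda>s x. c0 * (f2 (Z s x) + \<i> * of_real s / 2 * f4 (Z s x)))"
  define \<phi> where "\<phi> = (\<lambda>s x. P s x * G s x)"
  define \<phi>' where "\<phi>' = (\<lambda>s x. P s x * (\<i> * of_real (x - s\<^sup>2 / 2) / of_real \<epsilon> * G s x
      + (\<i> / 2 * (c0 * f2 (Z s x)) - of_real s * of_real (1 / ?r) * H1 s x)))"
  define \<phi>2 where "\<phi>2 = (\<lambda>s x. P s x * (of_real (1 / \<epsilon>) * H2 s x
      + 2 * \<i> * of_real (s / \<epsilon>) * (of_real (1 / ?r) * H1 s x) - of_real ((s / \<epsilon>)\<^sup>2) * G s x))"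
  \<comment> \<open>In the scaled moving frame the equation is i g' = - g_zz / 2. The polynomial g =
    f + (i s / 2) f'' leaves the residual (i s / 4) f'''', and the scale sqrt \<epsilon> supplies
    the factor \<epsilon>.\<close>
  define R where "R = (\<lambda>s x. P s x * (of_real \<epsilon> * (\<i> * of_real s / 4) * (c0 * f4 (Z s x))))"
  have C2: "\<exists>g1. is_C2c (\<phi> s) g1 (\<phi>2 s)" for s
  proof -
    note a = is_C2c_add[OF c1 is_C2c_cmult[OF c2, of "\<i> * of_real s / 2"]]
    note b = is_C2c_translate[OF is_C2c_cmult[OF is_C2c_scale[OF a, of ?r], of c0], of "s\<^sup>2 / 2"]
    note c = is_C2c_cmult[OF is_C2c_character[OF b, of "s / \<epsilon>"], of "exp (\<i> * of_real (- (s ^ 3 / 6) / \<epsilon>))"]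
    have P: "exp (\<i> * of_real (- (s ^ 3 / 6) / \<epsilon>)) * (character (s / \<epsilon>) x * u) = P s x * u" for x u
      unfolding P_def character_def mult.assoc[symmetric] exp_add[symmetric]
      by (simp add: diff_divide_distrib algebra_simps)
    have e: "1 / ?r\<^sup>2 = 1 / \<epsilon>" using r by simp
    have "is_C2c (\<phi> s) (\<lambda>x. P s x * (of_real (1 / ?r) * H1 s x + \<i> * of_real (s / \<epsilon>) * G s x)) (\<phi>2 s)"
      using c r unfolding P e \<phi>_def \<phi>2_def G_def H1_def H2_def Z_def by (simp add: mult_ac)
    then show ?thesis by blast
  qed
  have PL: "norm (P s x) = 1" for s x unfolding P_def by (rule norm_exp_i_times)
  have cZ: "continuous_on UNIV (\<lambda>p. g (Z (fst p) (snd p)))" if "continuous_on UNIV g" for g :: "real \<Rightarrow> complex"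
    unfolding Z_def using r by (intro continuous_on_compose2[OF that] continuous_intros) auto
  have cP: "continuous_on UNIV (\<lambda>p. P (fst p) (snd p))"
    unfolding P_def using eps by (intro continuous_intros) auto
  have c\<phi>': "continuous_on UNIV (\<lambda>p. \<phi>' (fst p) (snd p))"
    unfolding \<phi>'_def G_def H1_def using eps r
    by (intro continuous_on_mult continuous_on_add continuous_on_diff continuous_on_const cP cZ
        Cc_continuous F F2 continuous_on_divide continuous_on_of_real continuous_intros) auto
  have dZ: "((\<lambda>s. g (Z s x)) has_vector_derivative - (of_real s * of_real (1 / ?r)) * g' (Z s x)) (at s)"
    if "\<And>x. (g has_vector_derivative g' x) (at x)" for g g' :: "real \<Rightarrow> complex" and s x
  proof -
    have "((\<lambda>s. x - s\<^sup>2 / 2) has_real_derivative - s) (at s)" by (auto intro!: derivative_eq_intros)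
    from DERIV_cdivide[OF this, of ?r] have "((\<lambda>s. Z s x) has_vector_derivative - s / ?r) (at s)"
      by (simp only: Z_def has_real_derivative_iff_has_vector_derivative)
    from vector_diff_chain_at[OF this that] show ?thesis by (simp add: o_def scaleR_conv_of_real)
  qed
  have dP: "((\<lambda>s. P s x) has_vector_derivative \<i> * of_real (x - s\<^sup>2 / 2) / of_real \<epsilon> * P s x) (at s)" for s x
  proof -
    have "((\<lambda>s. (s * x - s ^ 3 / 6) / \<epsilon>) has_vector_derivative (x - s\<^sup>2 / 2) / \<epsilon>) (at s)" using eps
      by (auto simp flip: has_real_derivative_iff_has_vector_derivative intro!: derivative_eq_intros)
    from vector_diff_chain_at[OF this character_has_derivative[of 1]]
    show ?thesis unfolding P_def by (simp add: o_def character_def scaleR_conv_of_real mult_ac)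
  qed
  have d\<phi>: "((\<lambda>s. \<phi> s x) has_vector_derivative \<phi>' s x) (at s)" for s x
  proof -
    have "((\<lambda>s. complex_of_real s) has_vector_derivative of_real 1) (at s)"
      by (rule has_vector_derivative_of_real[OF DERIV_ident])
    from has_vector_derivative_mult_right[OF this, of "\<i> / 2"]
    have ds: "((\<lambda>s. \<i> * of_real s / 2) has_vector_derivative \<i> / 2) (at s)" by simp
    have "((\<lambda>s. G s x) has_vector_derivative \<i> / 2 * (c0 * f2 (Z s x)) - of_real s * of_real (1 / ?r) * H1 s x) (at s)"
      unfolding G_def H1_def
      by (rule has_vector_derivative_eq_rhs[OF has_vector_derivative_mult_right[OF has_vector_derivative_add[OF dZ[OF F(4)]
            has_vector_derivative_mult[OF ds dZ[OF F2(4)]]]]]) (simp add: algebra_simps)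
    from has_vector_derivative_mult[OF dP this] show ?thesis
      unfolding \<phi>_def \<phi>'_def by (rule has_vector_derivative_eq_rhs) (simp add: algebra_simps)
  qed
  have id: "\<i> * of_real \<epsilon> * \<phi>' s x - schrop \<epsilon> absV (\<phi> s) (\<phi>2 s) x = R s x" if s: "s \<ge> 0" for s x
  proof (cases "x < 0")
    case True
    then have "Z s x < 0" unfolding Z_def using zero_le_power2[of s] by (intro divide_neg_pos r(1)) linarith
    then show ?thesis using z z1 z2 z3 z4
      by (simp add: \<phi>'_def schrop_def \<phi>_def \<phi>2_def R_def G_def H1_def H2_def)
  next
    case False
    have alg: "\<i> * e * (p * (\<i> * (y - t\<^sup>2 / 2) / e * g + (\<i> / 2 * u - t * k * h)))
      - (- (e\<^sup>2 / 2) * (p * (1 / e * (u + \<i> * t / 2 * v) + 2 * \<i> * (t / e) * (k * h) - (t / e)\<^sup>2 * g)) + (- y) * (p * g))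
      = p * (e * (\<i> * t / 4) * v)" if "e \<noteq> 0" for e p y t g u k h v :: complex
      using that by (simp add: field_simps power2_eq_square)
    have x: "- \<bar>x\<bar> = - x" using False by simp
    have H2: "H2 s x = c0 * f2 (Z s x) + \<i> * of_real s / 2 * (c0 * f4 (Z s x))"
      unfolding H2_def by (simp add: algebra_simps)
    show ?thesis
      unfolding \<phi>'_def schrop_def \<phi>_def \<phi>2_def R_def x H2
      using alg[of "of_real \<epsilon>" "P s x" "of_real x" "of_real s" "G s x" "c0 * f2 (Z s x)" "of_real (1 / ?r)" "H1 s x" "c0 * f4 (Z s x)"] eps
      by (simp only: of_real_diff of_real_divide of_real_power of_real_minus of_real_1 of_real_numeral) simp
  qed
  have RL: "R s \<in> L2" "l2norm (R s) = \<epsilon> * \<bar>s\<bar> / 4 * l2norm f4" for s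
  proof -
    have f4: "f4 \<in> L2" by (rule Cc_L2[OF F2(3)])
    have eq: "norm (R s x) = norm (of_real \<epsilon> * (\<i> * of_real s / 4) * rescale \<epsilon> f4 (x - s\<^sup>2 / 2))" for x
      unfolding R_def norm_mult PL by (simp add: rescale_def c0_def Z_def norm_mult norm_divide)
    have L: "(\<lambda>x. of_real \<epsilon> * (\<i> * of_real s / 4) * rescale \<epsilon> f4 (x - s\<^sup>2 / 2)) \<in> L2"
      by (intro L2_cmult L2_translate rescale_L2 f4 eps)
    have cR: "continuous_on UNIV (R s)" unfolding R_def P_def Z_def using eps r
      by (intro continuous_intros continuous_on_compose2[OF Cc_continuous[OF F2(3)]]) auto
    have "norm (R s x) \<le> 1 * norm (of_real \<epsilon> * (\<i> * of_real s / 4) * rescale \<epsilon> f4 (x - s\<^sup>2 / 2))" for x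
      unfolding eq by simp
    from L2_dominated(1)[OF borel_measurable_continuous_onI[OF cR] L this] show "R s \<in> L2" by simp
    have "l2norm (R s) = l2norm (\<lambda>x. of_real \<epsilon> * (\<i> * of_real s / 4) * rescale \<epsilon> f4 (x - s\<^sup>2 / 2))"
      by (rule l2norm_cong_norm[OF eq])
    also have "\<dots> = \<epsilon> * \<bar>s\<bar> / 4 * l2norm f4"
      unfolding l2norm_cmult l2norm_translate rescale_L2(2)[OF f4 eps] using eps by (simp add: norm_mult norm_divide)
    finally show "l2norm (R s) = \<epsilon> * \<bar>s\<bar> / 4 * l2norm f4" .
  qed
  have \<phi>C: "Cc (\<phi> s)" and SC: "Cc (schrop \<epsilon> absV (\<phi> s) (\<phi>2 s))" for s
    using C2[of s] is_C2c_D(1) schrop_Cc[OF _ continuous_absV] by blast+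
  have \<phi>L: "\<phi> s \<in> L2" for s by (rule Cc_L2[OF \<phi>C])
  have \<phi>'C: "Cc (\<phi>' s)" for s
  proof -
    have "continuous_on UNIV (\<lambda>x. (s, x :: real))"
      by (intro continuous_on_Pair continuous_on_const continuous_on_id)
    from continuous_on_compose2[OF c\<phi>' this] have c: "continuous_on UNIV (\<phi>' s)" by simp
    obtain B where B: "B > 0" "\<And>x. B < \<bar>x\<bar> \<Longrightarrow> f x = 0" using Cc_E[OF F(1)] by metis
    obtain B1 where B1: "B1 > 0" "\<And>x. B1 < \<bar>x\<bar> \<Longrightarrow> f1 x = 0" using Cc_E[OF F(2)] by metis
    obtain B2 where B2: "B2 > 0" "\<And>x. B2 < \<bar>x\<bar> \<Longrightarrow> f2 x = 0" using Cc_E[OF F(3)] by metis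
    obtain B3 where B3: "B3 > 0" "\<And>x. B3 < \<bar>x\<bar> \<Longrightarrow> f3 x = 0" using Cc_E[OF F2(2)] by metis
    have "\<phi>' s x = 0" if "?r * (B + B1 + B2 + B3) + s\<^sup>2 / 2 < \<bar>x\<bar>" for x
    proof -
      have "?r * (B + B1 + B2 + B3) < \<bar>x - s\<^sup>2 / 2\<bar>" using that zero_le_power2[of s] by linarith
      then have "B + B1 + B2 + B3 < \<bar>Z s x\<bar>" using r by (simp add: Z_def abs_divide field_simps)
      then have "f (Z s x) = 0" "f1 (Z s x) = 0" "f2 (Z s x) = 0" "f3 (Z s x) = 0"
        using B B1 B2 B3 by auto
      then show ?thesis by (simp add: \<phi>'_def G_def H1_def)
    qed
    with c show ?thesis unfolding Cc_def by blast
  qed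
  have \<phi>'L: "\<phi>' s \<in> L2" for s by (rule Cc_L2[OF \<phi>'C])
  have ld: "l2_deriv \<phi> (\<phi>' s) s" for s
  proof -
    obtain B where B: "B > 0" "\<And>x. B < \<bar>x\<bar> \<Longrightarrow> f x = 0" using Cc_E[OF F(1)] by metis
    obtain B2 where B2: "B2 > 0" "\<And>x. B2 < \<bar>x\<bar> \<Longrightarrow> f2 x = 0" using Cc_E[OF F(3)] by metis
    have "\<phi> t x = 0" if t: "\<bar>t - s\<bar> \<le> 1" and x: "?r * (B + B2) + (\<bar>s\<bar> + 1)\<^sup>2 / 2 < \<bar>x\<bar>" for t x
    proof -
      have "t\<^sup>2 \<le> (\<bar>s\<bar> + 1)\<^sup>2" using t by (intro abs_le_square_iff[THEN iffD1]) auto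
      then have "?r * (B + B2) < \<bar>x - t\<^sup>2 / 2\<bar>" using x zero_le_power2[of t] by linarith
      then have "B + B2 < \<bar>Z t x\<bar>" using r by (simp add: Z_def abs_divide field_simps)
      then show ?thesis using B B2 by (simp add: \<phi>_def G_def)
    qed
    from l2_deriv_smooth[OF d\<phi> c\<phi>' this Cc_measurable[OF \<phi>C]] show ?thesis .
  qed
  define w where "w = (\<lambda>s x. \<psi> s x - \<phi> s x)"
  define w' where "w' = (\<lambda>s x. \<psi>' s x - \<phi>' s x)"
  have wL: "w s \<in> L2" and w'L: "w' s \<in> L2" for s
    unfolding w_def w'_def by (intro L2_diff psi_L2 psi'_L2 \<phi>L \<phi>'L)+
  have wd: "l2_deriv w (w' s) s" for s
    unfolding w_def w'_def by (rule l2_deriv_diff[OF psi_L2 psi'_L2 deriv \<phi>L \<phi>'L ld])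
  have dw: "((\<lambda>s. (l2norm (w s))\<^sup>2) has_real_derivative 2 * Re (ip (w' s) (w s))) (at s)" for s
  proof -
    have t: "tform (\<lambda>_. 1) 0 u v = ip u v" for u v by (simp add: tform_def ip_def)
    have "((\<lambda>s. tform (\<lambda>_. 1) 0 (w s) (w s)) has_vector_derivative
       0 + tform (\<lambda>_. 1) 0 (w' s) (w s) + tform (\<lambda>_. 1) 0 (w s) (w' s)) (at s)"
      by (rule tform_product_rule[OF wL w'L wd wL w'L wd, where C = 1]) auto
    from bounded_linear.has_vector_derivative[OF bounded_linear_Re this]
    have "((\<lambda>s. Re (ip (w s) (w s))) has_real_derivative Re (ip (w' s) (w s)) + Re (ip (w s) (w' s))) (at s)"
      unfolding t by (simp add: has_real_derivative_iff_has_vector_derivative)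
    moreover have "Re (ip (w s) (w' s)) = Re (ip (w' s) (w s))" using ip_cnj[of "w' s" "w s"] by (metis complex_cnj(1) cnj.sel(1))
    ultimately show ?thesis by (simp add: ip_self del: of_real_power)
  qed
  \<comment> \<open>The factor \<epsilon> of the residual cancels the 1 / \<epsilon> of the
    equation, so the resulting bound is uniform in \<epsilon>.\<close>
  have est: "\<bar>2 * Re (ip (w' s) (w s))\<bar> \<le> 2 * (l2norm f4 * s / 4) * l2norm (w s)" if s: "0 \<le> s" for s
  proof -
    obtain g1 where C: "is_C2c (\<phi> s) g1 (\<phi>2 s)" using C2 by blast
    let ?v = "\<lambda>x. \<i> * of_real \<epsilon> * \<psi>' s x"
    define X where "X = (\<lambda>x. ?v x - schrop \<epsilon> absV (\<phi> s) (\<phi>2 s) x)"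
    have XL: "X \<in> L2" unfolding X_def by (intro L2_diff L2_cmult psi'_L2 Cc_L2[OF SC])
    have im: "Im (ip X (w s)) = 0"
      unfolding X_def w_def by (rule hamiltonian_diff_symmetric[OF ham continuous_absV C])
    have "w' s x = - (\<i> / of_real \<epsilon>) * (X x - R s x)" for x
    proof -
      have "X x - R s x = \<i> * of_real \<epsilon> * w' s x"
        unfolding X_def id[OF s, symmetric] w'_def by (simp add: algebra_simps)
      then show ?thesis using eps by simp
    qed
    then have "ip (w' s) (w s) = ip (\<lambda>x. - (\<i> / of_real \<epsilon>) * (X x - R s x)) (w s)" by presburger
    also have "\<dots> = - (\<i> / of_real \<epsilon>) * (ip X (w s) - ip (R s) (w s))"
      unfolding ip_cmult_left by (simp add: ip_diff_left XL RL(1) wL)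
    finally have "Re (ip (w' s) (w s)) = - Im (ip (R s) (w s)) / \<epsilon>"
      using im by (simp add: Re_divide_of_real)
    then have "\<bar>Re (ip (w' s) (w s))\<bar> = \<bar>Im (ip (R s) (w s))\<bar> / \<epsilon>" using eps by (simp add: abs_divide)
    also have "\<dots> \<le> (l2norm (R s) * l2norm (w s)) / \<epsilon>"
      using ip_le[OF RL(1) wL, of s s] abs_Im_le_cmod[of "ip (R s) (w s)"] eps by (intro divide_right_mono) auto
    also have "\<dots> = (l2norm f4 * s / 4) * l2norm (w s)" unfolding RL(2) using eps s by simp
    finally show ?thesis by (simp only: abs_mult abs_numeral mult.assoc mult_left_mono zero_le_numeral)
  qed
  have "l2norm (w T) \<le> l2norm (w 0) + (l2norm f4 * T\<^sup>2 / 8 - l2norm f4 * 0\<^sup>2 / 8)"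
  proof (rule sqrt_gronwall[OF T dw _ _ l2norm_nonneg, where k = "\<lambda>s. l2norm f4 * s / 4"])
    fix s :: real assume "0 \<le> s" "s \<le> T"
    then show "\<bar>2 * Re (ip (w' s) (w s))\<bar> \<le> 2 * (l2norm f4 * s / 4) * l2norm (w s)" "0 \<le> l2norm f4 * s / 4"
      using est l2norm_nonneg by auto
    show "((\<lambda>s. l2norm f4 * s\<^sup>2 / 8) has_real_derivative l2norm f4 * s / 4) (at s)"
      by (auto intro!: derivative_eq_intros)
  qed
  also have "w 0 = (\<lambda>x. \<psi> 0 x - packet \<epsilon> 0 f x)"
    by (simp add: fun_eq_iff w_def \<phi>_def P_def G_def Z_def packet_def character_def rescale_def c0_def)
  finally have wT: "l2norm (w T) \<le> l2norm f4 / 8 * T\<^sup>2" using ini by simp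
  have "indicator {..<0} x * \<phi> T x = 0" for x :: real
  proof (cases "x < 0")
    case True
    then have "Z T x < 0" unfolding Z_def using zero_le_power2[of T] by (intro divide_neg_pos r(1)) linarith
    then show ?thesis using z z2 by (simp add: \<phi>_def G_def)
  qed auto
  then have "neg_part_norm (\<phi> T) = 0" unfolding neg_part_norm_def l2norm_def by (simp only:) simp
  then show ?thesis
    using neg_part_norm_diff_le[OF psi_L2[of T] \<phi>L[of T]] wT by (simp add: w_def)
qed


section \<open>Concentration at a point of phase space\<close>

text \<open>The second clause localizes the momentum without derivatives: a translation by
  \<epsilon> v multiplies a wave of momentum p by the phase of angle -p v. Only v \<ge> 0 is
  recorded; negative values are recovered by taking adjoints.\<close>

definition concentrates :: "(real \<Rightarrow> real \<Rightarrow> complex) \<Rightarrow> real \<Rightarrow> real \<Rightarrow> bool" where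
  "concentrates \<Phi> q p \<longleftrightarrow> (\<forall>\<epsilon>>0. \<Phi> \<epsilon> \<in> L2 \<and> l2norm (\<Phi> \<epsilon>) = 1) \<and>
    (\<forall>v\<ge>0. ((\<lambda>\<epsilon>. l2norm (\<lambda>x. exp (\<i> * of_real (p * v)) * \<Phi> \<epsilon> (x - \<epsilon> * v) - \<Phi> \<epsilon> x)) \<longlongrightarrow> 0) (at_right 0)) \<and>
    (\<forall>\<eta>>0. ((\<lambda>\<epsilon>. l2norm (\<lambda>x. indicator {x. \<eta> \<le> \<bar>x - q\<bar>} x * \<Phi> \<epsilon> x)) \<longlongrightarrow> 0) (at_right 0))"

lemma eventually_at_right_0: "(\<And>\<epsilon>::real. \<epsilon> > 0 \<Longrightarrow> P \<epsilon>) \<Longrightarrow> \<forall>\<^sub>F \<epsilon> in at_right 0. P \<epsilon>"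
  by (simp add: eventually_at_right_less eventually_at_filter)

lemma powr_tendsto_0: "c > 0 \<Longrightarrow> ((\<lambda>\<epsilon>::real. \<epsilon> powr c) \<longlongrightarrow> 0) (at_right 0)"
  by (rule tendsto_zero_powrI[OF tendsto_ident_at tendsto_const]) (auto intro: eventually_at_right_0)

lemma sqrt_tendsto_0: "((\<lambda>\<epsilon>::real. sqrt \<epsilon>) \<longlongrightarrow> 0) (at_right 0)"
  using tendsto_real_sqrt[OF tendsto_ident_at[of 0 "{0<..}"]] by simp

text \<open>All work is reduced to \<open>F\<close> tending to 0 at each time. The initial momentum
  \<open>b \<epsilon>\<close> shifts position by \<open>b \<epsilon> * T\<close> and phase by
  \<open>b \<epsilon> * v\<close>, and both disappear in the limit.\<close>

lemma concentrates_wave_packets: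
  assumes wp: "\<And>\<epsilon>. \<epsilon> > 0 \<Longrightarrow> wave_packet \<epsilon> (\<psi> \<epsilon>) (\<psi>' \<epsilon>) (b \<epsilon>) A"
    and b: "(b \<longlongrightarrow> 0) (at_right 0)" and T: "T \<ge> 0"
    and F: "\<And>t. t \<ge> 0 \<Longrightarrow> ((\<lambda>\<epsilon>. wave_packet.F (\<psi> \<epsilon>) t) \<longlongrightarrow> 0) (at_right 0)"
  shows "concentrates (\<lambda>\<epsilon>. \<psi> \<epsilon> T) (T\<^sup>2 / 2) T"
  unfolding concentrates_def
proof (intro conjI allI impI)
  note ev = wave_packet.axioms(1)[OF wp]
  show L: "\<psi> \<epsilon> T \<in> L2" and n: "l2norm (\<psi> \<epsilon> T) = 1" if "\<epsilon> > 0" for \<epsilon>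
    using evolution.psi_L2[OF ev[OF that]] evolution.norm_psi[OF ev[OF that]] by auto
  show "((\<lambda>\<epsilon>. l2norm (\<lambda>x. exp (\<i> * of_real (T * v)) * \<psi> \<epsilon> T (x - \<epsilon> * v) - \<psi> \<epsilon> T x)) \<longlongrightarrow> 0) (at_right 0)"
    if v: "v \<ge> 0" for v
  proof (rule tendsto_sandwich[where f = "\<lambda>_. 0"])
    show "\<forall>\<^sub>F \<epsilon> in at_right 0. l2norm (\<lambda>x. exp (\<i> * of_real (T * v)) * \<psi> \<epsilon> T (x - \<epsilon> * v) - \<psi> \<epsilon> T x)
      \<le> sqrt \<epsilon> * A * v + 2 * v * wave_packet.F (\<psi> \<epsilon>) (T + 1) + b \<epsilon> * v"
    proof (rule eventually_at_right_0)
      fix \<epsilon> :: real assume e: "\<epsilon> > 0"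
      interpret wave_packet \<epsilon> "\<psi> \<epsilon>" "\<psi>' \<epsilon>" "b \<epsilon>" A by (rule wp[OF e])
      let ?u = "\<lambda>x. \<psi> \<epsilon> T (x - \<epsilon> * v)"
      let ?e1 = "exp (\<i> * of_real (T * v))" and ?e2 = "exp (\<i> * of_real ((b \<epsilon> + T) * v))"
      have u: "?u \<in> L2" "l2norm ?u = 1" using L2_translate[OF psi_L2] norm_psi by (auto simp: l2norm_translate)
      have "l2norm (\<lambda>x. ?e1 * ?u x - \<psi> \<epsilon> T x) \<le> l2norm (\<lambda>x. ?e1 * ?u x - ?e2 * ?u x) + l2norm (\<lambda>x. ?e2 * ?u x - \<psi> \<epsilon> T x)"
        by (intro l2norm_triangle L2_cmult u psi_L2)
      also have "l2norm (\<lambda>x. ?e1 * ?u x - ?e2 * ?u x) = norm (?e1 - ?e2)"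
        using u(2) by (simp flip: left_diff_distrib add: l2norm_cmult)
      also have "?e1 - ?e2 = - (?e1 * (exp (\<i> * of_real (b \<epsilon> * v)) - 1))"
        by (simp add: algebra_simps exp_add[symmetric])
      also have "norm (- (?e1 * (exp (\<i> * of_real (b \<epsilon> * v)) - 1))) \<le> b \<epsilon> * v"
        using norm_iexp_minus_1_le[of "b \<epsilon> * v"] v p0 by (simp add: norm_mult del: of_real_mult)
      also have "l2norm (\<lambda>x. ?e2 * ?u x - \<psi> \<epsilon> T x) \<le> sqrt \<epsilon> * A * v + 2 * v * F1 T" by (rule momentum_spread[OF T v])
      also have "2 * v * F1 T \<le> 2 * v * F (T + 1)" using F1_le[OF T] v by (intro mult_left_mono) auto
      finally show "l2norm (\<lambda>x. ?e1 * ?u x - \<psi> \<epsilon> T x) \<le> sqrt \<epsilon> * A * v + 2 * v * F (T + 1) + b \<epsilon> * v" by simp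
    qed
    have "((\<lambda>\<epsilon>. sqrt \<epsilon> * A * v + 2 * v * wave_packet.F (\<psi> \<epsilon>) (T + 1) + b \<epsilon> * v) \<longlongrightarrow> 0 * A * v + 2 * v * 0 + 0 * v) (at_right 0)"
      using T by (intro tendsto_intros b F sqrt_tendsto_0) auto
    then show "((\<lambda>\<epsilon>. sqrt \<epsilon> * A * v + 2 * v * wave_packet.F (\<psi> \<epsilon>) (T + 1) + b \<epsilon> * v) \<longlongrightarrow> 0) (at_right 0)" by simp
  qed (auto simp: l2norm_nonneg)
  show "((\<lambda>\<epsilon>. l2norm (\<lambda>x. indicator {x. \<eta> \<le> \<bar>x - T\<^sup>2 / 2\<bar>} x * \<psi> \<epsilon> T x)) \<longlongrightarrow> 0) (at_right 0)" if \<eta>: "\<eta> > 0" for \<eta>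
  proof (rule tendsto_sandwich[where f = "\<lambda>_. 0"])
    have "((\<lambda>\<epsilon>. b \<epsilon> * T) \<longlongrightarrow> 0 * T) (at_right 0)" by (intro tendsto_intros b)
    then have "\<forall>\<^sub>F \<epsilon> in at_right 0. b \<epsilon> * T < \<eta> / 2" using \<eta> by (intro order_tendstoD(2)) auto
    then show "\<forall>\<^sub>F \<epsilon> in at_right 0. l2norm (\<lambda>x. indicator {x. \<eta> \<le> \<bar>x - T\<^sup>2 / 2\<bar>} x * \<psi> \<epsilon> T x)
       \<le> sqrt (4 / 3 * (sqrt \<epsilon> * A * (1 + 2 * T) + 2 * wave_packet.F (\<psi> \<epsilon>) T)\<^sup>2 / (\<eta> / 2)\<^sup>2)"
      using eventually_at_right_less[of "0::real"]
    proof eventually_elim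
      case (elim \<epsilon>)
      interpret wave_packet \<epsilon> "\<psi> \<epsilon>" "\<psi>' \<epsilon>" "b \<epsilon>" A by (rule wp[OF elim(2)])
      have sub: "\<eta> / 2 \<le> \<bar>x - q T\<bar>" if "\<eta> \<le> \<bar>x - T\<^sup>2 / 2\<bar>" for x
      proof -
        have "0 \<le> b \<epsilon> * T" using p0 T by simp
        then show ?thesis using that elim(1) unfolding q_def by linarith
      qed
      have "l2norm (\<lambda>x. indicator {x. \<eta> \<le> \<bar>x - T\<^sup>2 / 2\<bar>} x * \<psi> \<epsilon> T x) \<le> 1 * l2norm (\<lambda>x. indicator {x. \<eta> / 2 \<le> \<bar>x - q T\<bar>} x * \<psi> \<epsilon> T x)"
      proof (rule L2_dominated(2))
        show "(\<lambda>x. indicator {x. \<eta> \<le> \<bar>x - T\<^sup>2 / 2\<bar>} x * \<psi> \<epsilon> T x) \<in> borel_measurable borel"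
          using L2_D(1)[OF psi_L2] by measurable
        show "(\<lambda>x. indicator {x. \<eta> / 2 \<le> \<bar>x - q T\<bar>} x * \<psi> \<epsilon> T x) \<in> L2"
          by (rule L2_mult_bounded(1)[where C = 1]) (auto intro: psi_L2 simp: indicator_def)
      qed (use sub in \<open>auto simp: indicator_def\<close>)
      then have "l2norm (\<lambda>x. indicator {x. \<eta> \<le> \<bar>x - T\<^sup>2 / 2\<bar>} x * \<psi> \<epsilon> T x) \<le>
          sqrt ((l2norm (\<lambda>x. indicator {x. \<eta> / 2 \<le> \<bar>x - q T\<bar>} x * \<psi> \<epsilon> T x))\<^sup>2)" by (simp add: l2norm_nonneg)
      also have "\<dots> \<le> sqrt (4 / 3 * (spread T)\<^sup>2 / (\<eta> / 2)\<^sup>2)"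
        using position_spread[OF T, of "\<eta> / 2"] \<eta> by (intro real_sqrt_le_mono) simp
      finally show ?case unfolding spread_def .
    qed
    have "((\<lambda>\<epsilon>. sqrt (4 / 3 * (sqrt \<epsilon> * A * (1 + 2 * T) + 2 * wave_packet.F (\<psi> \<epsilon>) T)\<^sup>2 / (\<eta> / 2)\<^sup>2))
      \<longlongrightarrow> sqrt (4 / 3 * (0 * A * (1 + 2 * T) + 2 * 0)\<^sup>2 / (\<eta> / 2)\<^sup>2)) (at_right 0)"
      using \<eta> by (intro tendsto_intros F T sqrt_tendsto_0) auto
    then show "((\<lambda>\<epsilon>. sqrt (4 / 3 * (sqrt \<epsilon> * A * (1 + 2 * T) + 2 * wave_packet.F (\<psi> \<epsilon>) T)\<^sup>2 / (\<eta> / 2)\<^sup>2)) \<longlongrightarrow> 0) (at_right 0)"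
      by simp
  qed (auto simp: l2norm_nonneg)
qed

lemma concentrates_momentum:
  assumes f: "is_C2c f f1 f2" "l2norm f = 1" and beta: "0 < \<beta>" "\<beta> < 1 / 10"
    and sol: "\<And>\<epsilon>. \<epsilon> > 0 \<Longrightarrow> schroedinger_solution \<epsilon> absV (packet \<epsilon> (\<epsilon> powr \<beta>) f) (\<psi> \<epsilon>)" and T: "T \<ge> 0"
  shows "concentrates (\<lambda>\<epsilon>. \<psi> \<epsilon> T) (T\<^sup>2 / 2) T"
proof -
  obtain A where "\<forall>\<epsilon>. \<epsilon> > 0 \<longrightarrow> (\<exists>\<psi>'. wave_packet \<epsilon> (\<psi> \<epsilon>) \<psi>' (\<epsilon> powr \<beta>) A)"
    using wave_packets[OF f] sol by (meson powr_ge_zero)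
  then obtain \<psi>' where wp: "\<And>\<epsilon>. \<epsilon> > 0 \<Longrightarrow> wave_packet \<epsilon> (\<psi> \<epsilon>) (\<psi>' \<epsilon>) (\<epsilon> powr \<beta>) A" by metis
  show ?thesis
  proof (rule concentrates_wave_packets[OF wp powr_tendsto_0[OF beta(1)] T])
    fix t :: real assume t: "t \<ge> 0"
    define K where "K = (29/25) * (A + 1) * (1 + 2 * t)"
    define \<delta> where "\<delta> = (\<lambda>\<epsilon>. K * \<epsilon> powr (1 / 2 - 2 * \<beta>))"
    \<comment> \<open>The one part of the bound with a negative power of the initial momentum; its
      exponent 1/4 - 2 \<beta> is positive because \<beta> < 1/10.\<close>
    define r where "r = (\<lambda>\<epsilon>. sqrt K * \<epsilon> powr (1 / 4 - 2 * \<beta>))"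
    have A: "A \<ge> 0" using wave_packet.A[OF wp[of 1]] by simp
    have K: "K \<ge> 0" using A t by (simp add: K_def)
    have d: "\<delta> \<epsilon> = K * sqrt \<epsilon> / (\<epsilon> powr \<beta>)\<^sup>2" and rr: "sqrt (\<delta> \<epsilon>) / \<epsilon> powr \<beta> = r \<epsilon>" if e: "\<epsilon> > 0" for \<epsilon>
    proof -
      have "(\<epsilon> powr \<beta>)\<^sup>2 = \<epsilon> powr (2 * \<beta>)" using e by (simp add: power2_eq_square flip: powr_add)
      then show "\<delta> \<epsilon> = K * sqrt \<epsilon> / (\<epsilon> powr \<beta>)\<^sup>2" using e by (simp add: \<delta>_def powr_diff powr_half_sqrt)
      have "sqrt (\<epsilon> powr (1 / 2 - 2 * \<beta>)) = \<epsilon> powr (1 / 4 - \<beta>)"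
        using e by (simp flip: powr_half_sqrt add: powr_powr algebra_simps)
      moreover have "\<epsilon> powr (1 / 4 - \<beta>) / \<epsilon> powr \<beta> = \<epsilon> powr (1 / 4 - 2 * \<beta>)"
        by (simp flip: powr_diff)
      ultimately show "sqrt (\<delta> \<epsilon>) / \<epsilon> powr \<beta> = r \<epsilon>"
        by (simp only: \<delta>_def r_def real_sqrt_mult times_divide_eq_right[symmetric])
    qed
    have \<delta>0: "(\<delta> \<longlongrightarrow> 0) (at_right 0)" and r0: "(r \<longlongrightarrow> 0) (at_right 0)"
      unfolding \<delta>_def r_def using beta tendsto_mult_right_zero[OF powr_tendsto_0] by auto
    show "((\<lambda>\<epsilon>. wave_packet.F (\<psi> \<epsilon>) t) \<longlongrightarrow> 0) (at_right 0)"
    proof (rule tendsto_sandwich[where f = "\<lambda>_. 0"])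
      show "\<forall>\<^sub>F \<epsilon> in at_right 0. 0 \<le> wave_packet.F (\<psi> \<epsilon>) t"
        using wave_packet.spread_nonneg(2)[OF wp t] by (rule eventually_at_right_0)
      have "\<forall>\<^sub>F \<epsilon> in at_right 0. \<delta> \<epsilon> < 2 / 3" using \<delta>0 by (rule order_tendstoD) simp
      then show "\<forall>\<^sub>F \<epsilon> in at_right 0. wave_packet.F (\<psi> \<epsilon>) t \<le>
          sqrt (\<delta> \<epsilon>) * (4 * (\<epsilon> powr \<beta>)\<^sup>2) + 64 * (t + \<delta> \<epsilon> * \<epsilon> powr \<beta>) ^ 3 * r \<epsilon>"
        using eventually_at_right_less[of "0::real"]
      proof eventually_elim
        case (elim \<epsilon>)
        interpret wave_packet \<epsilon> "\<psi> \<epsilon>" "\<psi>' \<epsilon>" "\<epsilon> powr \<beta>" A by (rule wp[OF elim(2)])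
        have "F t \<le> sqrt (\<delta> \<epsilon>) * (4 * (\<epsilon> powr \<beta>)\<^sup>2 + 64 * (t + \<delta> \<epsilon> * \<epsilon> powr \<beta>) ^ 3 / \<epsilon> powr \<beta>)"
          by (rule F_bound_momentum[OF t _ d[OF elim(2), unfolded K_def]]) (use elim in auto)
        also have "\<dots> = sqrt (\<delta> \<epsilon>) * (4 * (\<epsilon> powr \<beta>)\<^sup>2) + 64 * (t + \<delta> \<epsilon> * \<epsilon> powr \<beta>) ^ 3 * r \<epsilon>"
          unfolding rr[OF elim(2), symmetric] by (simp add: algebra_simps)
        finally show ?case .
      qed
      have "((\<lambda>\<epsilon>. sqrt (\<delta> \<epsilon>) * (4 * (\<epsilon> powr \<beta>)\<^sup>2) + 64 * (t + \<delta> \<epsilon> * \<epsilon> powr \<beta>) ^ 3 * r \<epsilon>)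
        \<longlongrightarrow> sqrt 0 * (4 * 0\<^sup>2) + 64 * (t + 0 * 0) ^ 3 * 0) (at_right 0)"
        by (intro tendsto_add tendsto_mult tendsto_power tendsto_const tendsto_real_sqrt \<delta>0 r0 powr_tendsto_0 beta)
      then show "((\<lambda>\<epsilon>. sqrt (\<delta> \<epsilon>) * (4 * (\<epsilon> powr \<beta>)\<^sup>2) + 64 * (t + \<delta> \<epsilon> * \<epsilon> powr \<beta>) ^ 3 * r \<epsilon>) \<longlongrightarrow> 0) (at_right 0)"
        by simp
    qed simp
  qed
qed

lemma concentrates_rest:
  assumes f: "is_C2c f f1 f2" "is_C2c f2 f3 f4" "l2norm f = 1" and z: "\<And>x. x < 0 \<Longrightarrow> f x = 0"
    and sol: "\<And>\<epsilon>. \<epsilon> > 0 \<Longrightarrow> schroedinger_solution \<epsilon> absV (packet \<epsilon> 0 f) (\<psi> \<epsilon>)" and T: "T \<ge> 0"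
  shows "concentrates (\<lambda>\<epsilon>. \<psi> \<epsilon> T) (T\<^sup>2 / 2) T"
proof -
  obtain A where "\<forall>\<epsilon>. \<epsilon> > 0 \<longrightarrow> (\<exists>\<psi>'. wave_packet \<epsilon> (\<psi> \<epsilon>) \<psi>' 0 A)"
    using wave_packets[OF f(1,3)] sol by (meson order_refl)
  then obtain \<psi>' where wp: "\<And>\<epsilon>. \<epsilon> > 0 \<Longrightarrow> wave_packet \<epsilon> (\<psi> \<epsilon>) (\<psi>' \<epsilon>) 0 A" by metis
  note fL = Cc_L2[OF is_C2c_D(1)[OF f(1)]]
  define C where "C = l2norm f4 / 8"
  have C: "C \<ge> 0" by (simp add: C_def l2norm_nonneg)
  have quad: "neg_part_norm (\<psi> \<epsilon> s) \<le> C * s\<^sup>2" if "\<epsilon> > 0" "s \<ge> 0" for \<epsilon> s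
  proof -
    have "l2norm (\<lambda>x. \<psi> \<epsilon> 0 x - packet \<epsilon> 0 f x) = 0"
      using solution_evolution(2)[OF that(1) sol[OF that(1)]] packet_L2[OF fL that(1)] f(3) by auto
    from evolution.short_time[OF wave_packet.axioms(1)[OF wp[OF that(1)]] f(1,2) z this that(2)]
    show ?thesis by (simp add: C_def)
  qed
  show ?thesis
  proof (rule concentrates_wave_packets[OF wp tendsto_const T])
    fix t :: real assume t: "t \<ge> 0"
    define K where "K = 5 * (2 * ((29/25) * (A + 1) * (1 + 2 * t)) + 5)"
    show "((\<lambda>\<epsilon>. wave_packet.F (\<psi> \<epsilon>) t) \<longlongrightarrow> 0) (at_right 0)"
    proof (rule tendsto_sandwich[where f = "\<lambda>_. 0"])
      show "\<forall>\<^sub>F \<epsilon> in at_right 0. 0 \<le> wave_packet.F (\<psi> \<epsilon>) t"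
        using wave_packet.spread_nonneg(2)[OF wp t] by (rule eventually_at_right_0)
      show "\<forall>\<^sub>F \<epsilon> in at_right 0. wave_packet.F (\<psi> \<epsilon>) t \<le> (C + K) * \<epsilon> powr (1 / 8) * t ^ 3 / 6 + sqrt \<epsilon>"
      proof (rule eventually_at_right_0)
        fix \<epsilon> :: real assume e: "\<epsilon> > 0"
        \<comment> \<open>The switching time balances the two regimes: s0 = sqrt \<epsilon> /
          s0^3.\<close>
        let ?s = "\<epsilon> powr (1 / 8)"
        interpret wave_packet \<epsilon> "\<psi> \<epsilon>" "\<psi>' \<epsilon>" 0 A by (rule wp[OF e])
        have "F t \<le> (C * ?s + K * sqrt \<epsilon> / ?s ^ 3) * t ^ 3 / 6 + sqrt \<epsilon>"
          unfolding K_def by (rule F_bound_rest[OF t refl C _ quad[OF e]]) (use e in auto)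
        moreover have "sqrt \<epsilon> = ?s ^ 3 * ?s"
        proof -
          have "?s ^ 3 * ?s = \<epsilon> powr (1/8 + 1/8 + 1/8 + 1/8)" by (simp only: powr_add power3_eq_cube)
          then show ?thesis using e by (simp add: powr_half_sqrt)
        qed
        then have "K * sqrt \<epsilon> / ?s ^ 3 = K * ?s" using e by simp
        ultimately show "F t \<le> (C + K) * ?s * t ^ 3 / 6 + sqrt \<epsilon>" by (simp add: algebra_simps)
      qed
      have "((\<lambda>\<epsilon>. (C + K) * \<epsilon> powr (1 / 8) * t ^ 3 / 6 + sqrt \<epsilon>) \<longlongrightarrow> (C + K) * 0 * t ^ 3 / 6 + 0) (at_right 0)"
        by (intro tendsto_add tendsto_mult tendsto_divide tendsto_const powr_tendsto_0 sqrt_tendsto_0) auto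
      then show "((\<lambda>\<epsilon>. (C + K) * \<epsilon> powr (1 / 8) * t ^ 3 / 6 + sqrt \<epsilon>) \<longlongrightarrow> 0) (at_right 0)" by simp
    qed simp
  qed
qed

section \<open>Fourier inversion for test functions\<close>

lemma integrable_inverse_1_plus_square: "integrable lborel (\<lambda>v::real. C / (1 + v\<^sup>2))"
proof -
  have pos: "1 + x\<^sup>2 > 0" for x :: real by (simp add: add_pos_nonneg)
  have "set_integrable lborel (einterval (-\<infinity>) \<infinity>) (\<lambda>v::real. inverse (1 + v\<^sup>2))"
  proof (rule interval_integral_FTC_nonneg(1)[where F = arctan])
    show "((arctan \<circ> real_of_ereal) \<longlongrightarrow> - (pi / 2)) (at_right (-\<infinity>))"
      unfolding ereal_tendsto_simps by (rule tendsto_arctan_at_bot)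
    show "((arctan \<circ> real_of_ereal) \<longlongrightarrow> pi / 2) (at_left \<infinity>)"
      unfolding ereal_tendsto_simps by (rule tendsto_arctan_at_top)
    show "isCont (\<lambda>v::real. inverse (1 + v\<^sup>2)) x" for x
      using pos[of x] by (intro continuous_intros) auto
  qed (auto intro: DERIV_arctan less_imp_le[OF pos])
  then have "integrable lborel (\<lambda>v::real. C * inverse (1 + v\<^sup>2))"
    by (intro integrable_mult_right) (simp add: set_integrable_def einterval_def)
  then show ?thesis by (simp add: divide_inverse)
qed

lemma norm_integral_bounded_support:
  assumes f: "Cc f" "\<And>x. norm (f x) \<le> B" "\<And>x. R < \<bar>x\<bar> \<Longrightarrow> f x = 0" "R \<ge> 0"
  shows "norm (LINT x|lborel. f x) \<le> 2 * R * B"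
proof -
  have i: "integrable lborel (\<lambda>x. B * indicator {-R..R} x)"
    by (intro integrable_mult_right integrable_real_indicator) (auto simp: emeasure_lborel_Icc_eq)
  have "norm (LINT x|lborel. f x) \<le> (LINT x|lborel. norm (f x))" by (rule integral_norm_bound)
  also have "\<dots> \<le> (LINT x|lborel. B * indicator {-R..R} x)"
  proof (rule integral_mono[OF integrable_norm[OF Cc_integrable[OF f(1)]] i])
    fix x show "norm (f x) \<le> B * indicator {-R..R} x"
      using f(2)[of x] f(3)[of x] by (cases "x \<in> {-R..R}") auto
  qed
  also have "\<dots> = 2 * R * B" using f(4) by simp
  finally show ?thesis .
qed

lemma integrable_gaussian: "integrable lborel (\<lambda>z::real. exp (- z\<^sup>2 / 2))"
  and integral_gaussian: "(LINT z|lborel. exp (- z\<^sup>2 / 2)) = sqrt (2 * pi)"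
proof -
  have eq: "exp (- z\<^sup>2 / 2) = sqrt (2 * pi) * (std_normal_density z * z ^ (2 * 0))" for z :: real
    by (simp add: std_normal_density_def)
  show "integrable lborel (\<lambda>z::real. exp (- z\<^sup>2 / 2))"
    unfolding eq using integrable_std_normal_moment[of "2 * 0"] by (intro integrable_mult_right)
  show "(LINT z|lborel. exp (- z\<^sup>2 / 2)) = sqrt (2 * pi)"
    unfolding eq integral_mult_right_zero integral_std_normal_moment_even by simp
qed

lemma fourier_gaussian:
  assumes s: "s > 0"
  shows "(LINT v|lborel. character \<eta> v * of_real (exp (- (s * v)\<^sup>2 / 2))) =
    of_real (sqrt (2 * pi) / s * exp (- (\<eta> / s)\<^sup>2 / 2))"
proof -
  have base: "(LINT u|lborel. character t u * of_real (exp (- u\<^sup>2 / 2))) = of_real (sqrt (2 * pi) * exp (- t\<^sup>2 / 2))" for t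
  proof -
    have "complex_of_real (exp (- t\<^sup>2 / 2)) = char std_normal_distribution t"
      by (simp add: char_std_normal_distribution)
    also have "\<dots> = (LINT u|lborel. std_normal_density u *\<^sub>R character t u)"
      unfolding char_def character_def by (subst integral_density) (auto simp: normal_density_nonneg)
    also have "\<dots> = (LINT u|lborel. of_real (1 / sqrt (2 * pi)) * (character t u * of_real (exp (- u\<^sup>2 / 2))))"
      by (intro Bochner_Integration.integral_cong refl) (simp add: std_normal_density_def scaleR_conv_of_real mult_ac)
    also have "\<dots> = of_real (1 / sqrt (2 * pi)) * (LINT u|lborel. character t u * of_real (exp (- u\<^sup>2 / 2)))"
      by (rule integral_mult_right_zero)
    finally have "of_real (sqrt (2 * pi)) * complex_of_real (exp (- t\<^sup>2 / 2)) =
        of_real (sqrt (2 * pi)) * (of_real (1 / sqrt (2 * pi)) * (LINT u|lborel. character t u * of_real (exp (- u\<^sup>2 / 2))))"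
      by simp
    then show ?thesis by (simp add: mult.assoc[symmetric] flip: of_real_mult)
  qed
  have "(LINT v|lborel. character \<eta> v * of_real (exp (- (s * v)\<^sup>2 / 2))) =
      \<bar>1 / s\<bar> *\<^sub>R (LINT u|lborel. character \<eta> (0 + 1 / s * u) * of_real (exp (- (s * (0 + 1 / s * u))\<^sup>2 / 2)))"
    by (rule lborel_integral_real_affine) (use s in simp)
  also have "(LINT u|lborel. character \<eta> (0 + 1 / s * u) * of_real (exp (- (s * (0 + 1 / s * u))\<^sup>2 / 2))) =
      (LINT u|lborel. character (\<eta> / s) u * of_real (exp (- u\<^sup>2 / 2)))"
    using s by (simp add: character_def)
  finally show ?thesis unfolding base using s by (simp add: scaleR_conv_of_real)
qed

text \<open>Gaussian damping makes the double integral absolutely convergent, so Fubini turns it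
  into the average of \<open>f\<close> against a narrow Gaussian around \<open>p\<close>. The
  assumed decay provides the dominating function for removing the damping.\<close>

lemma fourier_inversion:
  assumes f: "Cc f" and C: "\<And>v. norm (LINT \<xi>|lborel. character v \<xi> * f \<xi>) \<le> C / (1 + v\<^sup>2)"
  shows "(LINT v|lborel. character (-p) v * (LINT \<xi>|lborel. character v \<xi> * f \<xi>)) = of_real (2 * pi) * f p"
proof -
  note [measurable] = Cc_measurable[OF f]
  define h where "h = (\<lambda>v. LINT \<xi>|lborel. character v \<xi> * f \<xi>)"
  have hm[measurable]: "h \<in> borel_measurable borel"
    unfolding h_def character_def by measurable
  define s where "s = (\<lambda>n. 1 / real (Suc n))"
  have s: "s n > 0" for n by (simp add: s_def)
  have s0: "s \<longlonglongrightarrow> 0" unfolding s_def using LIMSEQ_Suc[OF lim_1_over_n] by simp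
  define W where "W = (\<lambda>n v. complex_of_real (exp (- (s n * v)\<^sup>2 / 2)))"
  have Wm[measurable]: "W n \<in> borel_measurable borel" for n unfolding W_def by measurable
  have W1: "norm (W n v) \<le> 1" for n v by (simp add: W_def)
  have lim1: "(\<lambda>n. LINT v|lborel. character (-p) v * W n v * h v) \<longlonglongrightarrow> (LINT v|lborel. character (-p) v * h v)"
  proof (rule integral_dominated_convergence[where w = "\<lambda>v. C / (1 + v\<^sup>2)"])
    show "integrable lborel (\<lambda>v. C / (1 + v\<^sup>2))" by (rule integrable_inverse_1_plus_square)
    show "AE v in lborel. (\<lambda>n. character (-p) v * W n v * h v) \<longlonglongrightarrow> character (-p) v * h v"
    proof (rule AE_I2)
      fix v
      have "(\<lambda>n. W n v) \<longlonglongrightarrow> of_real (exp (- (0 * v)\<^sup>2 / 2))"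
        unfolding W_def by (intro tendsto_intros s0) auto
      then have "(\<lambda>n. character (-p) v * W n v * h v) \<longlonglongrightarrow> character (-p) v * of_real (exp (- (0 * v)\<^sup>2 / 2)) * h v"
        by (intro tendsto_intros)
      then show "(\<lambda>n. character (-p) v * W n v * h v) \<longlonglongrightarrow> character (-p) v * h v" by simp
    qed
    show "AE v in lborel. norm (character (-p) v * W n v * h v) \<le> C / (1 + v\<^sup>2)" for n
    proof (rule AE_I2)
      fix v
      have "norm (W n v) * norm (h v) \<le> 1 * norm (h v)" by (rule mult_right_mono[OF W1]) simp
      then show "norm (character (-p) v * W n v * h v) \<le> C / (1 + v\<^sup>2)"
        using C[of v] by (simp add: norm_mult h_def)
    qed
  qed measurable
  have eq: "(LINT v|lborel. character (-p) v * W n v * h v) =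
      of_real (sqrt (2 * pi)) * (LINT z|lborel. f (p + s n * z) * of_real (exp (- z\<^sup>2 / 2)))" for n
  proof -
    let ?g = "\<lambda>v \<xi>. W n v * f \<xi> * character (\<xi> - p) v"
    have Wi: "integrable lborel (W n)"
      using lborel_integrable_real_affine[OF integrable_gaussian, of "s n" 0] s[of n]
      unfolding W_def by (intro integrable_of_real) simp
    have int: "integrable (lborel \<Otimes>\<^sub>M lborel) (\<lambda>(v, \<xi>). ?g v \<xi>)"
    proof (rule lborel_pair.Fubini_integrable)
      show "(\<lambda>(v, \<xi>). ?g v \<xi>) \<in> borel_measurable (lborel \<Otimes>\<^sub>M lborel)"
        unfolding character_def by measurable
      show "integrable lborel (\<lambda>v. LINT \<xi>|lborel. norm (case (v, \<xi>) of (v, \<xi>) \<Rightarrow> ?g v \<xi>))"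
        using integrable_norm[OF Wi] by (simp add: norm_mult)
      show "AE v in lborel. integrable lborel (\<lambda>\<xi>. case (v, \<xi>) of (v, \<xi>) \<Rightarrow> ?g v \<xi>)"
      proof (rule AE_I2)
        fix v show "integrable lborel (\<lambda>\<xi>. case (v, \<xi>) of (v, \<xi>) \<Rightarrow> ?g v \<xi>)"
          by (rule Bochner_Integration.integrable_bound[OF integrable_mult_right[OF Cc_integrable[OF f], of "W n v"]])
            (auto simp: norm_mult character_def intro!: borel_measurable_times borel_measurable_exp)
      qed
    qed
    have "(LINT v|lborel. character (-p) v * W n v * h v) = (LINT v|lborel. LINT \<xi>|lborel. ?g v \<xi>)"
    proof (intro Bochner_Integration.integral_cong refl)
      fix v
      have c: "character (\<xi> - p) v = character (-p) v * character v \<xi>" for \<xi>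
        unfolding character_def exp_add[symmetric] by (simp add: algebra_simps)
      have "(LINT \<xi>|lborel. ?g v \<xi>) = (LINT \<xi>|lborel. (character (-p) v * W n v) * (character v \<xi> * f \<xi>))"
        by (intro Bochner_Integration.integral_cong refl) (simp add: c mult_ac)
      then show "character (-p) v * W n v * h v = (LINT \<xi>|lborel. ?g v \<xi>)"
        unfolding h_def by (simp only: integral_mult_right_zero)
    qed
    also have "\<dots> = (LINT \<xi>|lborel. LINT v|lborel. ?g v \<xi>)"
      by (rule lborel_pair.Fubini_integral[OF int, symmetric])
    also have "\<dots> = (LINT \<xi>|lborel. f \<xi> * of_real (sqrt (2 * pi) / s n * exp (- ((\<xi> - p) / s n)\<^sup>2 / 2)))"
    proof (intro Bochner_Integration.integral_cong refl)
      fix \<xi>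
      have "(LINT v|lborel. ?g v \<xi>) = (LINT v|lborel. f \<xi> * (character (\<xi> - p) v * of_real (exp (- (s n * v)\<^sup>2 / 2))))"
        by (intro Bochner_Integration.integral_cong refl) (simp add: W_def mult_ac)
      then show "(LINT v|lborel. ?g v \<xi>) = f \<xi> * of_real (sqrt (2 * pi) / s n * exp (- ((\<xi> - p) / s n)\<^sup>2 / 2))"
        by (simp only: integral_mult_right_zero fourier_gaussian[OF s])
    qed
    also have "\<dots> = \<bar>s n\<bar> *\<^sub>R (LINT z|lborel. f (p + s n * z) * of_real (sqrt (2 * pi) / s n * exp (- ((p + s n * z - p) / s n)\<^sup>2 / 2)))"
      by (rule lborel_integral_real_affine) (use s[of n] in simp)
    also have "(LINT z|lborel. f (p + s n * z) * of_real (sqrt (2 * pi) / s n * exp (- ((p + s n * z - p) / s n)\<^sup>2 / 2))) =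
        (LINT z|lborel. of_real (sqrt (2 * pi) / s n) * (f (p + s n * z) * of_real (exp (- z\<^sup>2 / 2))))"
      using s[of n] by (intro Bochner_Integration.integral_cong refl) simp
    also have "\<bar>s n\<bar> *\<^sub>R \<dots> = of_real (sqrt (2 * pi)) * (LINT z|lborel. f (p + s n * z) * of_real (exp (- z\<^sup>2 / 2)))"
      using s[of n] by (simp add: scaleR_conv_of_real integral_mult_right_zero)
    finally show ?thesis .
  qed
  obtain B where B: "\<And>x. norm (f x) \<le> B" using Cc_bounded[OF f] by auto
  have "(\<lambda>n. LINT z|lborel. f (p + s n * z) * of_real (exp (- z\<^sup>2 / 2))) \<longlonglongrightarrow> (LINT z|lborel. f p * of_real (exp (- z\<^sup>2 / 2)))"
  proof (rule integral_dominated_convergence[where w = "\<lambda>z. B * exp (- z\<^sup>2 / 2)"])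
    show "integrable lborel (\<lambda>z. B * exp (- z\<^sup>2 / 2))" by (intro integrable_mult_right integrable_gaussian)
    show "AE z in lborel. (\<lambda>n. f (p + s n * z) * of_real (exp (- z\<^sup>2 / 2))) \<longlonglongrightarrow> f p * of_real (exp (- z\<^sup>2 / 2))"
    proof (rule AE_I2)
      fix z
      have "(\<lambda>n. p + s n * z) \<longlonglongrightarrow> p + 0 * z" by (intro tendsto_intros s0)
      moreover have "isCont f p" using Cc_continuous[OF f] by (simp add: continuous_on_eq_continuous_at)
      ultimately have "(\<lambda>n. f (p + s n * z)) \<longlonglongrightarrow> f p" by (intro isCont_tendsto_compose[of p f]) auto
      then show "(\<lambda>n. f (p + s n * z) * of_real (exp (- z\<^sup>2 / 2))) \<longlonglongrightarrow> f p * of_real (exp (- z\<^sup>2 / 2))"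
        by (intro tendsto_intros)
    qed
    show "AE z in lborel. norm (f (p + s n * z) * of_real (exp (- z\<^sup>2 / 2))) \<le> B * exp (- z\<^sup>2 / 2)" for n
      using B by (intro AE_I2) (simp add: norm_mult mult_right_mono)
  qed measurable
  also have "(LINT z|lborel. f p * complex_of_real (exp (- z\<^sup>2 / 2))) = f p * of_real (sqrt (2 * pi))"
    by (simp only: integral_mult_right_zero integral_complex_of_real integral_gaussian)
  finally have "(\<lambda>n. LINT v|lborel. character (-p) v * W n v * h v) \<longlonglongrightarrow> of_real (sqrt (2 * pi)) * (f p * of_real (sqrt (2 * pi)))"
    unfolding eq by (intro tendsto_intros)
  from LIMSEQ_unique[OF lim1 this] show ?thesis
    unfolding h_def by (simp add: mult_ac flip: of_real_mult)
qed

section \<open>Symbols on phase space and their Fourier transforms in the momentum variable\<close>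

locale phase_symbol =
  fixes a :: "real \<times> real \<Rightarrow> complex" and a1 a2 :: "real \<Rightarrow> real \<Rightarrow> complex" and B R :: real
  assumes cont: "continuous_on UNIV a"
    and C2: "\<And>x. is_C2c (\<lambda>\<xi>. a (x, \<xi>)) (a1 x) (a2 x)"
    and bd: "\<And>p. norm (a p) \<le> B" "\<And>x \<xi>. norm (a2 x \<xi>) \<le> B"
    and supp: "\<And>x \<xi>. R < \<bar>x\<bar> \<or> R < \<bar>\<xi>\<bar> \<Longrightarrow> a (x, \<xi>) = 0" and R: "R > 0"

lemma test_function_phase_symbol:
  fixes a :: "real \<times> real \<Rightarrow> complex"
  assumes "test_function a"
  shows "\<exists>a1 a2 B R. phase_symbol a a1 a2 B R"
proof -
  let ?D = "\<lambda>g p. frechet_derivative g (at p) (0, 1)"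
  have ck: "Ck k a" for k using assms by (simp add: test_function_def)
  have "bounded (supp a)" using assms compact_imp_bounded by (auto simp: test_function_def)
  then obtain R0 where R0: "\<And>p. p \<in> Defs.supp a \<Longrightarrow> norm p \<le> R0" using bounded_iff by metis
  define R where "R = max R0 1"
  have big: "R < norm (x, \<xi>)" if "R < \<bar>x\<bar> \<or> R < \<bar>\<xi>\<bar>" for x \<xi> :: real
    using that norm_fst_le[of x \<xi>] norm_snd_le[of \<xi> x] by auto
  have z: "a (x, \<xi>) = 0" if "R < \<bar>x\<bar> \<or> R < \<bar>\<xi>\<bar>" for x \<xi>
    using big[OF that] R0[of "(x, \<xi>)"] closure_subset[of "{x. a x \<noteq> 0}"] unfolding supp_def R_def by force
  have d: "a differentiable (at p)" "Ck 1 (?D a)" for p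
    using ck[of "Suc 1", unfolded Ck.simps(2)] by (blast, blast)
  have d1: "?D a differentiable (at p)" "continuous_on UNIV (?D (?D a))" for p
    using d(2)[unfolded One_nat_def Ck.simps] by (blast, blast)
  have vd: "((\<lambda>\<xi>. g (x, \<xi>)) has_vector_derivative ?D g (x, \<xi>)) (at \<xi>)"
    if "\<And>p. g differentiable (at p)" for g :: "real \<times> real \<Rightarrow> complex" and x \<xi>
  proof -
    have gd: "(g has_derivative frechet_derivative g (at (x, \<xi>))) (at (x, \<xi>))"
      using that frechet_derivative_works by blast
    have pd: "((\<lambda>\<xi>. (x, \<xi>)) has_derivative (\<lambda>h. (0, h))) (at \<xi>)" by (auto intro!: derivative_eq_intros)
    from diff_chain_at[OF pd gd]
    have "((\<lambda>\<xi>. g (x, \<xi>)) has_derivative (\<lambda>h. frechet_derivative g (at (x, \<xi>)) (0, h))) (at \<xi>)"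
      by (simp only: o_def)
    moreover have "frechet_derivative g (at (x, \<xi>)) (0, h) = h *\<^sub>R ?D g (x, \<xi>)" for h
    proof -
      have "(0, h) = h *\<^sub>R (0 :: real, 1 :: real)" by simp
      then show ?thesis using linear_cmul[OF linear_frechet_derivative[OF that[of "(x, \<xi>)"]], of h "(0, 1)"] by metis
    qed
    then have "(\<lambda>h. frechet_derivative g (at (x, \<xi>)) (0, h)) = (\<lambda>h. h *\<^sub>R ?D g (x, \<xi>))" by (rule ext)
    ultimately show ?thesis unfolding has_vector_derivative_def by metis
  qed
  have ca: "continuous_on UNIV a" using ck[of 0] by simp
  have C2: "is_C2c (\<lambda>\<xi>. a (x, \<xi>)) (\<lambda>\<xi>. ?D a (x, \<xi>)) (\<lambda>\<xi>. ?D (?D a) (x, \<xi>))" for x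
    unfolding is_C2c_def Cc_def
  proof (intro conjI allI vd d(1) d1(1))
    have p: "continuous_on UNIV (\<lambda>\<xi>. (x, \<xi> :: real))"
      by (intro continuous_on_Pair continuous_on_const continuous_on_id)
    show "continuous_on UNIV (\<lambda>\<xi>. a (x, \<xi>))" "continuous_on UNIV (\<lambda>\<xi>. ?D (?D a) (x, \<xi>))"
      using continuous_on_compose2[OF ca p] continuous_on_compose2[OF d1(2) p] by auto
    show "\<exists>R. \<forall>\<xi>. R < \<bar>\<xi>\<bar> \<longrightarrow> a (x, \<xi>) = 0" using z by blast
  qed
  have zd: "?D g (x, \<xi>) = 0"
    if "\<And>x \<xi>. R < \<bar>x\<bar> \<or> R < \<bar>\<xi>\<bar> \<Longrightarrow> g (x, \<xi>) = 0" "\<And>p. g differentiable (at p)" "R < \<bar>x\<bar> \<or> R < \<bar>\<xi>\<bar>"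
    for g :: "real \<times> real \<Rightarrow> complex" and x \<xi>
  proof -
    have "((\<lambda>_. 0) has_vector_derivative ?D g (x, \<xi>)) (at \<xi>)"
    proof (rule has_vector_derivative_transform_within_open[OF vd[OF that(2)], where S = "{t. R < \<bar>x\<bar> \<or> R < \<bar>t\<bar>}"])
      show "open {t. R < \<bar>x\<bar> \<or> R < \<bar>t\<bar>}"
        by (intro open_Collect_disj open_Collect_less continuous_intros)
    qed (use that in auto)
    then show ?thesis using vector_derivative_unique_at has_vector_derivative_const by metis
  qed
  have bounded: "\<exists>B. \<forall>p. norm (g p) \<le> B"
    if c: "continuous_on UNIV g" and z: "\<And>x \<xi>. R < \<bar>x\<bar> \<or> R < \<bar>\<xi>\<bar> \<Longrightarrow> g (x, \<xi>) = 0"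
    for g :: "real \<times> real \<Rightarrow> complex"
  proof -
    have "compact (g ` ({-R..R} \<times> {-R..R}))"
      by (intro compact_continuous_image continuous_on_subset[OF c] compact_Times) auto
    then obtain b where b: "b > 0" "\<And>p. p \<in> {-R..R} \<times> {-R..R} \<Longrightarrow> norm (g p) \<le> b"
      using compact_imp_bounded bounded_pos by (metis image_eqI)
    have "norm (g (x, \<xi>)) \<le> b" for x \<xi>
    proof (cases "R < \<bar>x\<bar> \<or> R < \<bar>\<xi>\<bar>")
      case True
      then show ?thesis using z[OF True] b(1) by simp
    next
      case False
      then show ?thesis by (intro b(2)) auto
    qed
    then show ?thesis by auto
  qed
  obtain B1 where B1: "\<And>p. norm (a p) \<le> B1" using bounded[OF ca z] by auto
  obtain B2 where B2: "\<And>p. norm (?D (?D a) p) \<le> B2"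
    using bounded[OF d1(2) zd[OF zd[OF z d(1)] d1(1)]] by auto
  have "phase_symbol a (\<lambda>x \<xi>. ?D a (x, \<xi>)) (\<lambda>x \<xi>. ?D (?D a) (x, \<xi>)) (max B1 B2) R"
    using ca C2 B1 B2 z by unfold_locales (auto intro: max.coboundedI1 max.coboundedI2 simp: R_def)
  then show ?thesis by blast
qed

context phase_symbol
begin

definition K :: "real \<Rightarrow> real \<Rightarrow> complex" where
  "K x v = (LINT \<xi>|lborel. character v \<xi> * a (x, \<xi>))"

lemma a_measurable [measurable]: "a \<in> borel_measurable (borel \<Otimes>\<^sub>M borel)"
  unfolding borel_prod by (rule borel_measurable_continuous_onI[OF cont])

text \<open>Both \<open>K x v\<close> and v^2 times it, the latter after two integrations by parts
  in \<xi>, are bounded by 2 R B uniformly in x; the sum of the two bounds is the claim.\<close>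

lemma K_bound: "norm (K x v) \<le> 4 * R * B / (1 + v\<^sup>2)"
proof -
  note F = is_C2c_D[OF C2[of x]]
  let ?e = "character v"
  have s2: "a2 x \<xi> = 0" if "R < \<bar>\<xi>\<bar>" for \<xi>
  proof -
    have zd: "g' \<xi> = 0" if "R < \<bar>\<xi>\<bar>" "\<And>\<xi>. R < \<bar>\<xi>\<bar> \<Longrightarrow> g \<xi> = 0" "\<And>\<xi>. (g has_vector_derivative g' \<xi>) (at \<xi>)"
      for g g' :: "real \<Rightarrow> complex" and \<xi>
    proof -
      have "((\<lambda>_. 0) has_vector_derivative g' \<xi>) (at \<xi>)"
        by (rule has_vector_derivative_transform_within_open[OF that(3), where S = "{t. R < \<bar>t\<bar>}"])
          (use that in \<open>auto intro!: open_Collect_less continuous_intros\<close>)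
      then show ?thesis using vector_derivative_unique_at has_vector_derivative_const by metis
    qed
    have "a1 x \<xi> = 0" if "R < \<bar>\<xi>\<bar>" for \<xi> using zd[OF that _ F(4)] supp by blast
    from zd[OF that this F(5)] show ?thesis .
  qed
  have ce: "continuous_on UNIV (\<lambda>\<xi>. c * ?e \<xi>)" for c by (intro continuous_intros continuous_character)
  have b1: "norm (K x v) \<le> 2 * R * B"
    unfolding K_def
    by (rule norm_integral_bounded_support[OF Cc_mult[OF F(1) continuous_character]])
      (use bd supp R in \<open>auto simp: norm_mult\<close>)
  have "norm (LINT \<xi>|lborel. ?e \<xi> * a2 x \<xi>) \<le> 2 * R * B"
    by (rule norm_integral_bounded_support[OF Cc_mult[OF F(3) continuous_character]])
      (use bd s2 R in \<open>auto simp: norm_mult\<close>)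
  moreover have "(LINT \<xi>|lborel. ?e \<xi> * a2 x \<xi>) = - of_real (v\<^sup>2) * K x v"
  proof -
    have "(LINT \<xi>|lborel. a2 x \<xi> * ?e \<xi>) = - (LINT \<xi>|lborel. a1 x \<xi> * (\<i> * of_real v * ?e \<xi>))"
      by (rule ibp[OF F(2) F(5) Cc_continuous[OF F(3)] character_has_derivative ce])
    also have "(LINT \<xi>|lborel. a1 x \<xi> * (\<i> * of_real v * ?e \<xi>)) =
        - (LINT \<xi>|lborel. a (x, \<xi>) * (\<i> * of_real v * (\<i> * of_real v * ?e \<xi>)))"
      by (rule ibp[OF F(1) F(4) Cc_continuous[OF F(2)] has_vector_derivative_mult_right[OF character_has_derivative]])
        (intro continuous_intros continuous_character)
    also have "(LINT \<xi>|lborel. a (x, \<xi>) * (\<i> * of_real v * (\<i> * of_real v * ?e \<xi>))) =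
        (LINT \<xi>|lborel. - of_real (v\<^sup>2) * (?e \<xi> * a (x, \<xi>)))"
      by (intro Bochner_Integration.integral_cong refl) (simp add: power2_eq_square algebra_simps)
    finally show ?thesis unfolding K_def by (simp only: integral_mult_right_zero mult.commute[of "?e _"] minus_minus)
  qed
  ultimately have "v\<^sup>2 * norm (K x v) \<le> 2 * R * B" by (simp add: norm_mult norm_power)
  with b1 have "(1 + v\<^sup>2) * norm (K x v) \<le> 4 * R * B" by (simp add: algebra_simps)
  then show ?thesis by (simp add: pos_le_divide_eq add_pos_nonneg mult.commute)
qed

lemma K_measurable [measurable]: "(\<lambda>(x, v). K x v) \<in> borel_measurable (borel \<Otimes>\<^sub>M borel)"
  unfolding K_def character_def by measurable

lemma K_continuous: "isCont (\<lambda>x. K x v) q"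
  unfolding continuous_at_eps_delta
proof (intro allI impI)
  fix e :: real assume e: "e > 0"
  define e' where "e' = e / (2 * R + 1)"
  have e': "e' > 0" using e R by (simp add: e'_def)
  have "uniformly_continuous_on ({q-1..q+1} \<times> {-R..R}) a"
    by (rule compact_uniformly_continuous) (auto intro!: continuous_on_subset[OF cont] compact_Times)
  then obtain d where d: "d > 0" "\<And>p p'. p \<in> {q-1..q+1} \<times> {-R..R} \<Longrightarrow> p' \<in> {q-1..q+1} \<times> {-R..R} \<Longrightarrow>
      dist p' p < d \<Longrightarrow> dist (a p') (a p) < e'"
    unfolding uniformly_continuous_on_def using e' by metis
  show "\<exists>d>0. \<forall>x. dist x q < d \<longrightarrow> dist (K x v) (K q v) < e"
  proof (intro exI conjI allI impI)
    show "min d 1 > 0" using d by simp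
    fix x assume x: "dist x q < min d 1"
    have C: "Cc (\<lambda>\<xi>. character v \<xi> * (a (x, \<xi>) - a (q, \<xi>)))"
      by (intro Cc_mult Cc_diff continuous_character is_C2c_D(1)[OF C2])
    have "K x v - K q v = (LINT \<xi>|lborel. character v \<xi> * (a (x, \<xi>) - a (q, \<xi>)))"
      unfolding K_def right_diff_distrib
      by (intro Bochner_Integration.integral_diff[symmetric] Cc_integrable Cc_mult continuous_character is_C2c_D(1)[OF C2])
    also have "norm \<dots> \<le> 2 * R * e'"
    proof (rule norm_integral_bounded_support[OF C])
      fix \<xi>
      show "norm (character v \<xi> * (a (x, \<xi>) - a (q, \<xi>))) \<le> e'"
      proof (cases "R < \<bar>\<xi>\<bar>")
        case True then show ?thesis using e' supp by simp
      next
        case False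
        then have "dist (a (x, \<xi>)) (a (q, \<xi>)) < e'"
          using x by (intro d(2)) (auto simp: dist_Pair_Pair dist_real_def)
        then show ?thesis by (simp add: norm_mult dist_norm)
      qed
    qed (use supp R in auto)
    also have "\<dots> < e"
    proof -
      have "2 * R * e' = e * (2 * R / (2 * R + 1))" by (simp add: e'_def)
      also have "\<dots> < e * 1" using e R by (intro mult_strict_left_mono) auto
      finally show ?thesis by simp
    qed
    finally show "dist (K x v) (K q v) < e" by (simp add: dist_norm)
  qed
qed

lemma K_inversion: "(LINT v|lborel. character (-p) v * K q v) = of_real (2 * pi) * a (q, p)"
  using fourier_inversion[OF is_C2c_D(1)[OF C2], of q] K_bound[of q] unfolding K_def by blast

end

section \<open>The Wigner transform of a concentrating family\<close>

lemma L2_affine: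
  assumes "f \<in> L2" "c \<noteq> 0"
  shows "(\<lambda>v. f (t + c * v)) \<in> L2" "l2norm (\<lambda>v. f (t + c * v)) = sqrt (1 / \<bar>c\<bar>) * l2norm f"
proof -
  note [measurable] = L2_D(1)[OF assms(1)]
  have i: "integrable lborel (\<lambda>v. (norm (f (t + c * v)))\<^sup>2)"
    by (rule lborel_integrable_real_affine[OF L2_D(2)[OF assms(1)] assms(2)])
  show "(\<lambda>v. f (t + c * v)) \<in> L2" by (rule L2_I[OF _ i]) measurable
  have "(LINT x|lborel. (norm (f x))\<^sup>2) = \<bar>c\<bar> * (LINT v|lborel. (norm (f (t + c * v)))\<^sup>2)"
    using lborel_integral_real_affine[OF assms(2), of "\<lambda>x. (norm (f x))\<^sup>2" t] by simp
  then have "(LINT v|lborel. (norm (f (t + c * v)))\<^sup>2) = (1 / \<bar>c\<bar>) * (LINT x|lborel. (norm (f x))\<^sup>2)"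
    using assms(2) by simp
  then show "l2norm (\<lambda>v. f (t + c * v)) = sqrt (1 / \<bar>c\<bar>) * l2norm f"
    unfolding l2norm_def by (simp only: real_sqrt_mult)
qed

lemma borel_measurable_fst_snd [measurable]:
  "(fst :: real \<times> real \<Rightarrow> real) \<in> borel_measurable borel"
  "(snd :: real \<times> real \<Rightarrow> real) \<in> borel_measurable borel"
  by (intro borel_measurable_continuous_onI continuous_intros)+

context phase_symbol
begin

lemma a_measurable' [measurable]: "a \<in> borel_measurable borel"
  by (rule borel_measurable_continuous_onI[OF cont])

lemma a_integrable: "integrable lborel a"
proof -
  have "integrable lborel (\<lambda>p. indicator ({-R..R} \<times> {-R..R}) p *\<^sub>R a p)"
    by (rule borel_integrable_compact) (auto intro: compact_Times continuous_on_subset[OF cont])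
  moreover have "(\<lambda>p. indicator ({-R..R} \<times> {-R..R}) p *\<^sub>R a p) = a"
  proof
    fix p :: "real \<times> real"
    obtain x \<xi> where p: "p = (x, \<xi>)" by (cases p)
    show "indicator ({-R..R} \<times> {-R..R}) p *\<^sub>R a p = a p"
    proof (cases "R < \<bar>x\<bar> \<or> R < \<bar>\<xi>\<bar>")
      case True then show ?thesis using supp[OF True] p by simp
    next
      case False then show ?thesis using p by (auto simp: indicator_def)
    qed
  qed
  ultimately show ?thesis by simp
qed

definition pairing_density :: "real \<Rightarrow> (real \<Rightarrow> complex) \<Rightarrow> real \<Rightarrow> complex" where
  "pairing_density \<epsilon> f v = (LINT x|lborel. K x v * f (x - \<epsilon> * v / 2) * cnj (f (x + \<epsilon> * v / 2)))"

text \<open>The substitution y = \<epsilon> v removes \<epsilon> from the oscillating factor.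
  Integrating over \<xi> first then leaves \<open>K\<close>, and \<epsilon> survives only in the
  arguments of \<open>f\<close>.\<close>

lemma wigner_pairing_eq:
  assumes f: "f \<in> L2" and eps: "\<epsilon> > 0"
  shows "wigner_pairing \<epsilon> f a = of_real (1 / (2 * pi)) * (LINT v|lborel. pairing_density \<epsilon> f v)"
proof -
  note [measurable] = L2_D(1)[OF f]
  let ?u = "\<lambda>x v. f (x - \<epsilon> * v / 2) * cnj (f (x + \<epsilon> * v / 2))"
  define g where "g = (\<lambda>p v. character v (snd p) * ?u (fst p) v * a p)"
  have gm[measurable]: "(\<lambda>(p, v). g p v) \<in> borel_measurable (borel \<Otimes>\<^sub>M borel)"
    unfolding g_def character_def by measurable
  have w: "wigner \<epsilon> f x \<xi> = of_real (1 / (2 * pi)) * (LINT v|lborel. character v \<xi> * ?u x v)" for x \<xi>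
  proof -
    let ?h = "\<lambda>y. exp (\<i> / of_real \<epsilon> * of_real (y * \<xi>)) * f (x - y / 2) * cnj (f (x + y / 2))"
    have "(LINT y|lborel. ?h y) = \<bar>\<epsilon>\<bar> *\<^sub>R (LINT v|lborel. ?h (0 + \<epsilon> * v))"
      by (rule lborel_integral_real_affine) (use eps in simp)
    also have "(LINT v|lborel. ?h (0 + \<epsilon> * v)) = (LINT v|lborel. character v \<xi> * ?u x v)"
      using eps by (intro Bochner_Integration.integral_cong refl) (simp add: character_def mult.assoc)
    finally show ?thesis unfolding wigner_def using eps by (simp add: scaleR_conv_of_real)
  qed
  have L: "(\<lambda>v. f (x - \<epsilon> * v / 2)) \<in> L2" "l2norm (\<lambda>v. f (x - \<epsilon> * v / 2)) = sqrt (2 / \<epsilon>) * l2norm f"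
    "(\<lambda>v. f (x + \<epsilon> * v / 2)) \<in> L2" "l2norm (\<lambda>v. f (x + \<epsilon> * v / 2)) = sqrt (2 / \<epsilon>) * l2norm f" for x
    using L2_affine[OF f, of "- (\<epsilon> / 2)" x] L2_affine[OF f, of "\<epsilon> / 2" x] eps by simp_all
  have ui: "integrable lborel (\<lambda>v. norm (?u x v))" for x
    using L2_mult_integrable(2)[OF L(1,3), of x x] by (simp add: norm_mult)
  \<comment> \<open>Cauchy-Schwarz in v at fixed x. The bound deteriorates like 1 / \<epsilon>, but
    it serves only to justify Fubini at fixed \<epsilon>.\<close>
  have ub: "(LINT v|lborel. norm (?u x v)) \<le> 2 / \<epsilon> * (l2norm f)\<^sup>2" for x
  proof -
    have "(LINT v|lborel. norm (?u x v)) \<le> (sqrt (2 / \<epsilon>) * l2norm f) * (sqrt (2 / \<epsilon>) * l2norm f)"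
      using L2_mult_integral_le[OF L(1,3), of x x] unfolding L(2,4) by (simp add: norm_mult)
    also have "\<dots> = (sqrt (2 / \<epsilon>))\<^sup>2 * (l2norm f)\<^sup>2" unfolding power2_eq_square by (simp only: mult_ac)
    also have "(sqrt (2 / \<epsilon>))\<^sup>2 = 2 / \<epsilon>" using eps by (intro real_sqrt_pow2) simp
    finally show ?thesis .
  qed
  have ng: "norm (g p v) = norm (a p) * norm (?u (fst p) v)" for p v by (simp add: g_def norm_mult)
  have int: "integrable (lborel \<Otimes>\<^sub>M lborel) (\<lambda>(p, v). g p v)"
  proof (rule lborel_pair.Fubini_integrable)
    show "(\<lambda>(p, v). g p v) \<in> borel_measurable (lborel \<Otimes>\<^sub>M lborel)" by measurable
    have eq: "(LINT v|lborel. norm (g p v)) = norm (a p) * (LINT v|lborel. norm (?u (fst p) v))" for p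
      unfolding ng by simp
    have "integrable lborel (\<lambda>p. LINT v|lborel. norm (g p v))"
    proof (rule Bochner_Integration.integrable_bound[OF integrable_mult_right[OF a_integrable, of "of_real (2 / \<epsilon> * (l2norm f)\<^sup>2)"]])
      show "(\<lambda>p. LINT v|lborel. norm (g p v)) \<in> borel_measurable lborel" by measurable
      show "AE p in lborel. norm (LINT v|lborel. norm (g p v)) \<le> norm (of_real (2 / \<epsilon> * (l2norm f)\<^sup>2) * a p)"
      proof (rule AE_I2)
        fix p :: "real \<times> real"
        have "0 \<le> (LINT v|lborel. norm (?u (fst p) v))" by (rule Bochner_Integration.integral_nonneg) simp
        moreover have "norm (a p) * (LINT v|lborel. norm (?u (fst p) v)) \<le> norm (a p) * (2 / \<epsilon> * (l2norm f)\<^sup>2)"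
          by (intro mult_left_mono ub) simp
        ultimately show "norm (LINT v|lborel. norm (g p v)) \<le> norm (of_real (2 / \<epsilon> * (l2norm f)\<^sup>2) * a p)"
          unfolding eq norm_mult norm_of_real using eps by (simp add: mult.commute)
      qed
    qed
    then show "integrable lborel (\<lambda>p. LINT v|lborel. norm (case (p, v) of (p, v) \<Rightarrow> g p v))" by simp
    show "AE p in lborel. integrable lborel (\<lambda>v. case (p, v) of (p, v) \<Rightarrow> g p v)"
    proof (rule AE_I2)
      fix p :: "real \<times> real"
      have "integrable lborel (\<lambda>v. norm (a p) * norm (?u (fst p) v))" by (intro integrable_mult_right ui)
      then show "integrable lborel (\<lambda>v. case (p, v) of (p, v) \<Rightarrow> g p v)"
        by (rule Bochner_Integration.integrable_bound) (auto simp: ng)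
    qed
  qed
  have "wigner_pairing \<epsilon> f a = (LINT p|lborel. of_real (1 / (2 * pi)) * (LINT v|lborel. g p v))"
    unfolding wigner_pairing_def
  proof (intro Bochner_Integration.integral_cong refl)
    fix p :: "real \<times> real"
    have "(LINT v|lborel. g p v) = (LINT v|lborel. character v (snd p) * ?u (fst p) v) * a p"
      unfolding g_def by (rule integral_mult_left_zero)
    then show "wigner \<epsilon> f (fst p) (snd p) * a p = of_real (1 / (2 * pi)) * (LINT v|lborel. g p v)"
      unfolding w by simp
  qed
  also have "\<dots> = of_real (1 / (2 * pi)) * (LINT p|lborel. LINT v|lborel. g p v)"
    by (rule integral_mult_right_zero)
  also have "(LINT p|lborel. LINT v|lborel. g p v) = (LINT v|lborel. LINT p|lborel. g p v)"
    by (rule lborel_pair.Fubini_integral[OF int, symmetric])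
  also have "\<dots> = (LINT v|lborel. pairing_density \<epsilon> f v)"
  proof (rule integral_cong_AE)
    show "(\<lambda>v. LINT p|lborel. g p v) \<in> borel_measurable lborel" by measurable
    show "pairing_density \<epsilon> f \<in> borel_measurable lborel" unfolding pairing_density_def by measurable
    show "AE v in lborel. (LINT p|lborel. g p v) = pairing_density \<epsilon> f v"
      using lborel_pair.AE_integrable_snd[OF int]
    proof eventually_elim
      case (elim v)
      have e: "integrable (lborel \<Otimes>\<^sub>M lborel) (\<lambda>p. g p v)" unfolding lborel_prod by (rule elim)
      have "(LINT p|lborel. g p v) = (LINT p|(lborel \<Otimes>\<^sub>M lborel). g p v)" unfolding lborel_prod ..
      also have "\<dots> = (LINT x|lborel. LINT \<xi>|lborel. g (x, \<xi>) v)"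
        by (rule lborel_pair.integral_fst'[OF e, symmetric])
      also have "\<dots> = pairing_density \<epsilon> f v"
        unfolding pairing_density_def
      proof (intro Bochner_Integration.integral_cong refl)
        fix x
        have "(LINT \<xi>|lborel. g (x, \<xi>) v) = (LINT \<xi>|lborel. ?u x v * (character v \<xi> * a (x, \<xi>)))"
          by (intro Bochner_Integration.integral_cong refl) (simp add: g_def mult_ac)
        then show "(LINT \<xi>|lborel. g (x, \<xi>) v) = K x v * f (x - \<epsilon> * v / 2) * cnj (f (x + \<epsilon> * v / 2))"
          unfolding K_def by (simp only: integral_mult_right_zero) (simp add: mult_ac)
      qed
      finally show ?case .
    qed
  qed
  finally show ?thesis .
qed

lemma K_section_measurable [measurable]: "(\<lambda>x. K x v) \<in> borel_measurable borel"
  by measurable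

text \<open>Translations are isometries, so the bound is independent of \<epsilon> and serves as
  dominating function in the limit.\<close>

lemma pairing_density_bound:
  assumes f: "f \<in> L2" "l2norm f = 1"
  shows "norm (pairing_density \<epsilon> f v) \<le> 4 * R * B / (1 + v\<^sup>2)"
proof -
  have t: "(\<lambda>x. f (x + \<epsilon> * v / 2)) \<in> L2" "l2norm (\<lambda>x. f (x + \<epsilon> * v / 2)) = 1"
    using L2_translate[OF f(1), of "- (\<epsilon> * v / 2)"] l2norm_translate[of f "- (\<epsilon> * v / 2)"] f(2) by simp_all
  show ?thesis
    using ip_weighted_le[OF L2_translate[OF f(1), of "\<epsilon> * v / 2"] t(1) K_section_measurable K_bound[of _ v]] t(2) f(2)
    by (simp add: pairing_density_def l2norm_translate)
qed

end

text \<open>The almost invariance replaces the translate by a phase times the function itself; what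
  remains is the average of \<open>k\<close> against the squared modulus, whose mass gathers at
  \<open>q\<close>. The shift by e n w / 2 in \<open>k\<close> vanishes with e n.\<close>

lemma concentrates_tform_limit:
  assumes con: "concentrates \<Phi> q p" and w: "w \<ge> 0"
    and k: "k \<in> borel_measurable borel" "\<And>x. norm (k x) \<le> C" "isCont k q"
    and e: "\<And>n. e n > 0" "e \<longlonglongrightarrow> (0::real)"
  shows "(\<lambda>n. LINT x|lborel. k (x - e n * w / 2) * \<Phi> (e n) (x - e n * w) * cnj (\<Phi> (e n) x))
    \<longlonglongrightarrow> exp (- (\<i> * of_real (p * w))) * k q"
proof -
  have fl: "filterlim e (at_right 0) sequentially"
    by (rule tendsto_imp_filterlim_at_right[OF e(2)]) (use e(1) in simp)
  define f where "f = (\<lambda>n. \<Phi> (e n))"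
  have fL: "f n \<in> L2" and f1: "l2norm (f n) = 1" for n using con e(1) by (auto simp: concentrates_def f_def)
  define c where "c = exp (\<i> * of_real (p * w))"
  define om where "om = (\<lambda>n. l2norm (\<lambda>x. c * f n (x - e n * w) - f n x))"
  have om: "om \<longlonglongrightarrow> 0" unfolding om_def f_def c_def
    using filterlim_compose[OF _ fl] con w unfolding concentrates_def by blast
  have mass: "(\<lambda>n. l2norm (\<lambda>x. indicator {x. \<eta> \<le> \<bar>x - q\<bar>} x * f n x)) \<longlonglongrightarrow> 0" if "\<eta> > 0" for \<eta>
    unfolding f_def using filterlim_compose[OF _ fl] con that unfolding concentrates_def by blast
  define h where "h = (\<lambda>n x. k (x - e n * w / 2))"
  have hm: "h n \<in> borel_measurable borel" and hb: "norm (h n x) \<le> C" for n x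
    using k(2) unfolding h_def by (simp_all add: measurable_compose[OF _ k(1)])
  have C: "C \<ge> 0" using k(2)[of 0] norm_ge_zero order_trans by blast
  define A where "A = (\<lambda>n. LINT x|lborel. h n x * f n (x - e n * w) * cnj (f n x))"
  define D where "D = (\<lambda>n. LINT x|lborel. h n x * f n x * cnj (f n x))"
  have i1: "integrable lborel (\<lambda>x. h n x * f n (x - e n * w) * cnj (f n x))" for n
    by (rule tform_integrable[OF fL fL hm hb])
  have i2: "integrable lborel (\<lambda>x. h n x * f n x * cnj (f n x))" for n
    using tform_integrable[OF fL[of n] fL[of n] hm[of n] hb[of n], of 0] by simp
  have AD: "norm (c * A n - D n) \<le> C * om n" for n
  proof -
    have "c * A n - D n = (LINT x|lborel. h n x * (c * f n (x - e n * w) - f n x) * cnj (f n x))"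
    proof -
      have "c * A n - D n = (LINT x|lborel. c * (h n x * f n (x - e n * w) * cnj (f n x)) - h n x * f n x * cnj (f n x))"
        unfolding A_def D_def using i1 i2 by simp
      then show ?thesis by (simp add: algebra_simps)
    qed
    also have "norm \<dots> \<le> C * (om n * l2norm (f n))"
      unfolding om_def by (intro ip_weighted_le L2_diff L2_cmult L2_translate fL hm hb)
    finally show ?thesis by (simp add: f1)
  qed
  have cA: "(\<lambda>n. c * A n - D n) \<longlonglongrightarrow> 0"
    by (rule Lim_null_comparison[OF always_eventually[OF allI[OF AD]]]) (use tendsto_mult_right_zero[OF om] in simp)
  have "D \<longlonglongrightarrow> k q"
  proof (rule LIMSEQ_I)
    fix r :: real assume r: "r > 0"
    obtain d where d: "d > 0" "\<And>x. dist x q < d \<Longrightarrow> dist (k x) (k q) < r / 2"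
      using k(3) r unfolding continuous_at_eps_delta by (metis half_gt_zero)
    let ?S = "{x. d / 2 \<le> \<bar>x - q\<bar>}"
    let ?m = "\<lambda>n. l2norm (\<lambda>x. indicator ?S x * f n x)"
    have "(\<lambda>n. 2 * C * (?m n)\<^sup>2) \<longlonglongrightarrow> 2 * C * 0\<^sup>2" using d by (intro tendsto_intros mass) auto
    then have "\<forall>\<^sub>F n in sequentially. 2 * C * (?m n)\<^sup>2 < r / 2" using r by (intro order_tendstoD(2)) auto
    moreover have "(\<lambda>n. e n * w / 2) \<longlonglongrightarrow> 0 * w / 2" by (intro tendsto_intros e(2)) auto
    from order_tendstoD(2)[OF this, of "d / 2"] d(1)
    have "\<forall>\<^sub>F n in sequentially. e n * w / 2 < d / 2" by simp
    ultimately have "\<forall>\<^sub>F n in sequentially. norm (D n - k q) < r"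
    proof eventually_elim
      case (elim n)
      have iL: "(\<lambda>x. indicator ?S x * f n x) \<in> L2"
        by (rule L2_mult_bounded(1)[where C = 1]) (auto intro: fL simp: indicator_def)
      have n1: "(LINT x|lborel. f n x * cnj (f n x)) = 1"
        using ip_self[of "f n"] f1[of n] by (simp add: ip_def)
      have "D n - k q = (LINT x|lborel. (h n x - k q) * (f n x * cnj (f n x)))"
      proof -
        have "(LINT x|lborel. (h n x - k q) * (f n x * cnj (f n x))) =
            (LINT x|lborel. h n x * f n x * cnj (f n x) - k q * (f n x * cnj (f n x)))"
          by (intro Bochner_Integration.integral_cong refl) (simp add: algebra_simps)
        also have "\<dots> = D n - k q * 1"
          unfolding D_def n1[symmetric] using i2 L2_mult_integrable(1)[OF fL fL] by simp
        finally show ?thesis by simp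
      qed
      also have "norm \<dots> \<le> (LINT x|lborel. norm ((h n x - k q) * (f n x * cnj (f n x))))" by (rule integral_norm_bound)
      \<comment> \<open>Near \<open>q\<close> continuity of \<open>k\<close> bounds the weight by r
        / 2; elsewhere the crude bound 2 C meets a vanishing mass.\<close>
      also have "\<dots> \<le> (LINT x|lborel. r / 2 * (norm (f n x))\<^sup>2 + 2 * C * (norm (indicator ?S x * f n x))\<^sup>2)"
      proof (rule integral_mono)
        have "(\<lambda>x. (h n x - k q) * (f n x * cnj (f n x))) = (\<lambda>x. h n x * f n x * cnj (f n x) - k q * (f n x * cnj (f n x)))"
          by (simp add: fun_eq_iff algebra_simps)
        then show "integrable lborel (\<lambda>x. norm ((h n x - k q) * (f n x * cnj (f n x))))"
          using i2 L2_mult_integrable(1)[OF fL fL] by simp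
        show "integrable lborel (\<lambda>x. r / 2 * (norm (f n x))\<^sup>2 + 2 * C * (norm (indicator ?S x * f n x))\<^sup>2)"
          using L2_D(2)[OF fL[of n]] L2_D(2)[OF iL] by (intro Bochner_Integration.integrable_add integrable_mult_right)
        fix x
        have nf: "norm ((h n x - k q) * (f n x * cnj (f n x))) = norm (h n x - k q) * (norm (f n x))\<^sup>2"
          by (simp add: norm_mult power2_eq_square)
        show "norm ((h n x - k q) * (f n x * cnj (f n x))) \<le> r / 2 * (norm (f n x))\<^sup>2 + 2 * C * (norm (indicator ?S x * f n x))\<^sup>2"
        proof (cases "x \<in> ?S")
          case True
          have "norm (h n x - k q) \<le> 2 * C" using norm_triangle_ineq4[of "h n x" "k q"] hb[of n x] k(2)[of q] by linarith
          then have "norm (h n x - k q) * (norm (f n x))\<^sup>2 \<le> 2 * C * (norm (f n x))\<^sup>2" by (intro mult_right_mono) auto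
          moreover have "0 \<le> r / 2 * (norm (f n x))\<^sup>2" using r by simp
          ultimately show ?thesis unfolding nf using True by simp
        next
          case False
          have "0 \<le> e n * w" using e(1)[of n] w by simp
          moreover have "\<bar>x - q\<bar> < d / 2" using False by simp
          ultimately have "dist (x - e n * w / 2) q < d" using elim(2) unfolding dist_real_def by linarith
          from d(2)[OF this] have "norm (h n x - k q) \<le> r / 2" by (simp add: h_def dist_norm)
          from mult_right_mono[OF this zero_le_power2[of "norm (f n x)"]] show ?thesis unfolding nf using False by simp
        qed
      qed
      also have "\<dots> = r / 2 * (l2norm (f n))\<^sup>2 + 2 * C * (?m n)\<^sup>2"
        unfolding l2norm_sq using L2_D(2)[OF fL[of n]] L2_D(2)[OF iL] by simp
      also have "\<dots> < r" using elim(1) f1[of n] by simp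
      finally show ?case .
    qed
    then show "\<exists>no. \<forall>n\<ge>no. norm (D n - k q) < r" by (simp add: eventually_sequentially)
  qed
  from tendsto_add[OF cA this] have "(\<lambda>n. c * A n) \<longlonglongrightarrow> k q" by simp
  then have "(\<lambda>n. exp (- (\<i> * of_real (p * w))) * (c * A n)) \<longlonglongrightarrow> exp (- (\<i> * of_real (p * w))) * k q"
    by (intro tendsto_intros)
  moreover have "exp (- (\<i> * of_real (p * w))) * (c * z) = z" for z
    unfolding c_def mult.assoc[symmetric] exp_add[symmetric] by simp
  ultimately show ?thesis unfolding A_def h_def f_def by (simp only:)
qed

text \<open>For fixed v the inner integral tends to a phase times \<open>K q v\<close>; dominated
  convergence in v and Fourier inversion of the symbol at the momentum \<open>p\<close> give its
  value at the point.\<close>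

lemma wigner_pairing_limit:
  assumes con: "concentrates \<Phi> q p" and e: "\<And>n. e n > 0" "e \<longlonglongrightarrow> (0::real)" and a: "test_function a"
  shows "(\<lambda>n. wigner_pairing (e n) (\<Phi> (e n)) a) \<longlonglongrightarrow> a (q, p)"
proof -
  obtain a1 a2 B R where "phase_symbol a a1 a2 B R" using test_function_phase_symbol[OF a] by blast
  then interpret phase_symbol a a1 a2 B R .
  have fL: "\<Phi> (e n) \<in> L2" and f1: "l2norm (\<Phi> (e n)) = 1" for n using con e(1) by (auto simp: concentrates_def)
  have pw: "(\<lambda>n. pairing_density (e n) (\<Phi> (e n)) v) \<longlonglongrightarrow> character (-p) v * K q v" for v
  proof -
    have Kb: "norm (K x v) \<le> 4 * R * B" for x
    proof (rule order_trans[OF K_bound])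
      have "4 * R * B / (1 + v\<^sup>2) \<le> 4 * R * B / 1"
        using R order_trans[OF norm_ge_zero bd(1)[of "(0,0)"]] by (intro divide_left_mono) (auto simp: add_pos_nonneg)
      then show "4 * R * B / (1 + v\<^sup>2) \<le> 4 * R * B" by simp
    qed
    have tr: "pairing_density \<epsilon> f v = (LINT x|lborel. K (x - s) v * f (x - s - \<epsilon> * v / 2) * cnj (f (x - s + \<epsilon> * v / 2)))"
      for \<epsilon> f s unfolding pairing_density_def
      using integral_translate[of "\<lambda>x. K x v * f (x - \<epsilon> * v / 2) * cnj (f (x + \<epsilon> * v / 2))" s] by simp
    show ?thesis
    proof (cases "v \<ge> 0")
      case True
      have "pairing_density (e n) (\<Phi> (e n)) v =
          (LINT x|lborel. K (x - e n * v / 2) v * \<Phi> (e n) (x - e n * v) * cnj (\<Phi> (e n) x))" for n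
        by (subst tr[of _ _ "e n * v / 2"]) (simp add: diff_diff_eq mult.commute)
      then show ?thesis
        using concentrates_tform_limit[OF con True K_section_measurable Kb K_continuous e]
        by (simp add: character_def)
    next
      case False
      \<comment> \<open>Negative v: conjugation exchanges the two factors and so reverses the
        translation, with the conjugate of \<open>K\<close> as multiplier.\<close>
      define w where "w = - v"
      have w: "w \<ge> 0" using False by (simp add: w_def)
      have "pairing_density (e n) (\<Phi> (e n)) v =
          cnj (LINT x|lborel. cnj (K (x - e n * w / 2) v) * \<Phi> (e n) (x - e n * w) * cnj (\<Phi> (e n) x))" for n
      proof -
        have "pairing_density (e n) (\<Phi> (e n)) v =
            (LINT x|lborel. cnj (cnj (K (x - e n * w / 2) v) * \<Phi> (e n) (x - e n * w) * cnj (\<Phi> (e n) x)))"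
          by (subst tr[of _ _ "e n * w / 2"]) (simp add: w_def mult_ac add_ac)
        then show ?thesis by (simp only: Bochner_Integration.integral_cnj)
      qed
      moreover have "(\<lambda>n. LINT x|lborel. cnj (K (x - e n * w / 2) v) * \<Phi> (e n) (x - e n * w) * cnj (\<Phi> (e n) x))
          \<longlonglongrightarrow> exp (- (\<i> * of_real (p * w))) * cnj (K q v)"
        by (rule concentrates_tform_limit[OF con w _ _ _ e, where C = "4 * R * B"])
          (use Kb K_continuous in \<open>auto intro!: isCont_cnj\<close>)
      from tendsto_cnj[OF this] have "(\<lambda>n. cnj (LINT x|lborel. cnj (K (x - e n * w / 2) v) * \<Phi> (e n) (x - e n * w) * cnj (\<Phi> (e n) x)))
          \<longlonglongrightarrow> character (-p) v * K q v"
        by (simp add: character_def w_def exp_cnj)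
      ultimately show ?thesis by simp
    qed
  qed
  have "(\<lambda>n. LINT v|lborel. pairing_density (e n) (\<Phi> (e n)) v) \<longlonglongrightarrow> (LINT v|lborel. character (-p) v * K q v)"
  proof (rule integral_dominated_convergence[where w = "\<lambda>v. 4 * R * B / (1 + v\<^sup>2)"])
    show "(\<lambda>v. character (-p) v * K q v) \<in> borel_measurable lborel" by measurable
    show "pairing_density (e n) (\<Phi> (e n)) \<in> borel_measurable lborel" for n
      using L2_D(1)[OF fL[of n]] unfolding pairing_density_def by measurable
    show "AE v in lborel. norm (pairing_density (e n) (\<Phi> (e n)) v) \<le> 4 * R * B / (1 + v\<^sup>2)" for n
      using pairing_density_bound[OF fL f1] by simp
  qed (use pw integrable_inverse_1_plus_square in auto)
  then have "(\<lambda>n. of_real (1 / (2 * pi)) * (LINT v|lborel. pairing_density (e n) (\<Phi> (e n)) v)) \<longlonglongrightarrow>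
      of_real (1 / (2 * pi)) * (of_real (2 * pi) * a (q, p))"
    unfolding K_inversion by (intro tendsto_intros)
  then show ?thesis unfolding wigner_pairing_eq[OF fL e(1)] by simp
qed

section \<open>Bump functions and identification of the limit measure\<close>

lemma Ck_cong: "Ck k f \<Longrightarrow> (\<And>x. f x = g x) \<Longrightarrow> Ck k g"
  by (metis ext)

lemma Ck_SucI:
  assumes "\<And>x. (f has_derivative f' x) (at x)" "\<And>v. Ck k (\<lambda>x. f' x v)"
  shows "Ck (Suc k) f"
  unfolding Ck.simps
proof (intro conjI allI)
  show "f differentiable (at x)" for x using assms(1) differentiableI by blast
  fix v
  have "f' x = frechet_derivative f (at x)" for x by (rule frechet_derivative_at[OF assms(1)])
  then show "Ck k (\<lambda>x. frechet_derivative f (at x) v)" using assms(2)[of v] by simp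
qed

lemma Ck_SucD:
  assumes "Ck (Suc k) f"
  shows "(f has_derivative frechet_derivative f (at x)) (at x)" "Ck k (\<lambda>x. frechet_derivative f (at x) v)"
  using assms unfolding Ck.simps frechet_derivative_works by blast+

lemma Ck_mono: "Ck (Suc k) f \<Longrightarrow> Ck k f"
proof (induction k arbitrary: f)
  case 0
  have "isCont f x" for x using Ck_SucD(1)[OF 0] has_derivative_continuous by blast
  then show ?case by (simp add: continuous_on_eq_continuous_at)
next
  case (Suc k)
  show ?case by (rule Ck_SucI[OF Ck_SucD(1)[OF Suc.prems] Suc.IH[OF Ck_SucD(2)[OF Suc.prems]]])
qed

lemma Ck_add: "Ck k f \<Longrightarrow> Ck k g \<Longrightarrow> Ck k (\<lambda>x. f x + g x)"
proof (induction k arbitrary: f g)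
  case (Suc k)
  show ?case
    by (rule Ck_SucI[OF has_derivative_add[OF Ck_SucD(1)[OF Suc.prems(1)] Ck_SucD(1)[OF Suc.prems(2)]]])
      (intro Suc.IH Ck_SucD(2) Suc.prems)
qed (auto intro: continuous_intros)

text \<open>The product rule keeps one factor undifferentiated, and \<open>Ck_mono\<close> lowers
  its order to that of the induction hypothesis.\<close>

lemma Ck_mult:
  fixes f g :: "'a::euclidean_space \<Rightarrow> complex"
  shows "Ck k f \<Longrightarrow> Ck k g \<Longrightarrow> Ck k (\<lambda>x. f x * g x)"
proof (induction k arbitrary: f g)
  case (Suc k)
  show ?case
    by (rule Ck_SucI[OF has_derivative_mult[OF Ck_SucD(1)[OF Suc.prems(1)] Ck_SucD(1)[OF Suc.prems(2)]]])
      (rule Ck_add[OF Suc.IH[OF Ck_mono[OF Suc.prems(1)] Ck_SucD(2)[OF Suc.prems(2)]]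
          Suc.IH[OF Ck_SucD(2)[OF Suc.prems(1)] Ck_mono[OF Suc.prems(2)]]])
qed (auto intro: continuous_intros)

lemma Ck_const: "Ck k (\<lambda>_. c)"
proof (induction k arbitrary: c)
  case (Suc k)
  show ?case by (rule Ck_SucI[OF has_derivative_const Suc.IH])
qed auto

lemma Ck_cnj: "Ck k f \<Longrightarrow> Ck k (\<lambda>x. cnj (f x))"
proof (induction k arbitrary: f)
  case (Suc k)
  show ?case
    by (rule Ck_SucI[OF has_derivative_cnj[OF Ck_SucD(1)[OF Suc.prems]]]) (intro Suc.IH Ck_SucD(2) Suc.prems)
qed (auto intro: continuous_intros)

lemma Ck_reflect: "Ck k f \<Longrightarrow> Ck k (\<lambda>x. f (- x))"
proof (induction k arbitrary: f)
  case 0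
  then show ?case
    using continuous_on_compose2[OF _ continuous_on_minus[OF continuous_on_id], of UNIV f UNIV] by simp
next
  case (Suc k)
  have d: "((\<lambda>x. f (- x)) has_derivative (\<lambda>v. frechet_derivative f (at (- x)) (- v))) (at x)" for x
    using diff_chain_at[OF has_derivative_minus[OF has_derivative_ident] Ck_SucD(1)[OF Suc.prems]] by (simp add: o_def)
  show ?case by (rule Ck_SucI[OF d]) (rule Suc.IH[OF Ck_SucD(2)[OF Suc.prems]])
qed

text \<open>The functions \<open>P(1/x) exp(-1/x)\<close> on \<open>x > 0\<close> are closed under differentiation, which makes
  their smoothness at 0 an induction over all polynomials \<open>P\<close>.\<close>

definition flat :: "real poly \<Rightarrow> real \<Rightarrow> real" where
  "flat P x = (if x > 0 then poly P (1 / x) * exp (- (1 / x)) else 0)"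

lemma poly_over_exp_tendsto: "((\<lambda>t::real. poly P t * exp (- t)) \<longlongrightarrow> 0) at_top"
proof -
  have "((\<lambda>t::real. \<Sum>i\<le>degree P. coeff P i * (t ^ i / exp t)) \<longlongrightarrow> (\<Sum>i\<le>degree P. coeff P i * 0)) at_top"
    by (intro tendsto_sum tendsto_mult tendsto_const tendsto_power_div_exp_0)
  moreover have "(\<Sum>i\<le>degree P. coeff P i * (t ^ i / exp t)) = poly P t * exp (- t)" for t :: real
    by (simp add: poly_altdef sum_distrib_right exp_minus divide_inverse mult.assoc)
  ultimately show ?thesis by simp
qed

lemma flat_derivative:
  "(flat P has_real_derivative flat ([:0, 0, 1:] * (P - pderiv P)) x) (at x)"
proof -
  consider "x > 0" | "x < 0" | "x = 0" by linarith
  then show ?thesis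
  proof cases
    case 1
    have "((\<lambda>x. poly P (1 / x) * exp (- (1 / x))) has_real_derivative flat ([:0, 0, 1:] * (P - pderiv P)) x) (at x)"
      using 1 by (auto intro!: derivative_eq_intros poly_DERIV[THEN DERIV_chain2] simp: flat_def field_simps power2_eq_square)
    then show ?thesis
      by (rule has_field_derivative_transform_within_open[where S = "{0<..}"]) (use 1 in \<open>auto simp: flat_def\<close>)
  next
    case 2
    have "((\<lambda>_. 0) has_real_derivative flat ([:0, 0, 1:] * (P - pderiv P)) x) (at x)" using 2 by (simp add: flat_def)
    then show ?thesis
      by (rule has_field_derivative_transform_within_open[where S = "{..<0}"]) (use 2 in \<open>auto simp: flat_def\<close>)
  next
    case 3
    have "((\<lambda>h. flat P h / h) \<longlongrightarrow> 0) (at_right 0)"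
    proof -
      have "((\<lambda>h. poly ([:0, 1:] * P) (inverse h) * exp (- inverse h)) \<longlongrightarrow> 0) (at_right 0)"
        by (rule filterlim_compose[OF poly_over_exp_tendsto filterlim_inverse_at_top_right])
      then show ?thesis
        by (rule Lim_transform_eventually)
          (auto simp: eventually_at_filter flat_def field_simps intro!: always_eventually)
    qed
    moreover have "((\<lambda>h. flat P h / h) \<longlongrightarrow> 0) (at_left 0)"
      by (rule Lim_transform_eventually[OF tendsto_const])
        (auto simp: eventually_at_filter flat_def intro!: always_eventually)
    ultimately have "((\<lambda>h. flat P h / h) \<longlongrightarrow> 0) (at 0)" by (simp add: filterlim_split_at)
    then show ?thesis using 3 by (simp add: DERIV_def flat_def)
  qed
qed

lemma Ck_flat_affine:
  "Ck k (\<lambda>p::real \<times> real. complex_of_real (flat P (\<alpha> * fst p + \<gamma> * snd p + c)))"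
proof (induction k arbitrary: P)
  case 0
  have "continuous_on UNIV (flat P)"
    using DERIV_isCont[OF flat_derivative] by (simp add: continuous_on_eq_continuous_at)
  then show ?case
    by (auto intro!: continuous_on_of_real continuous_on_compose2[of UNIV "flat P"] continuous_intros)
next
  case (Suc k)
  let ?Q = "[:0, 0, 1:] * (P - pderiv P)"
  let ?l = "\<lambda>p::real \<times> real. \<alpha> * fst p + \<gamma> * snd p + c"
  have d: "((\<lambda>p. complex_of_real (flat P (?l p))) has_derivative
      (\<lambda>v. of_real (\<alpha> * fst v + \<gamma> * snd v) * of_real (flat ?Q (?l p)))) (at p)" for p
  proof -
    have "(?l has_derivative (\<lambda>v. \<alpha> * fst v + \<gamma> * snd v)) (at p)" by (auto intro!: derivative_eq_intros)
    moreover have "(flat P has_derivative (\<lambda>h. h * flat ?Q (?l p))) (at (?l p))"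
      using flat_derivative[of P "?l p"] by (simp only: has_field_derivative_def mult_commute_abs)
    ultimately have "((\<lambda>p. flat P (?l p)) has_derivative (\<lambda>v. (\<alpha> * fst v + \<gamma> * snd v) * flat ?Q (?l p))) (at p)"
      using diff_chain_at[of ?l _ p "flat P"] by (simp add: o_def)
    from has_derivative_of_real[OF this] show ?thesis by (simp only: of_real_mult)
  qed
  show ?case by (rule Ck_SucI[OF d Ck_mult[OF Ck_const Suc.IH]])
qed

lemma test_function_iff: "test_function f \<longleftrightarrow> (\<forall>k. Ck k f) \<and> bounded {x. f x \<noteq> 0}"
  by (simp add: test_function_def supp_def compact_closure)

text \<open>Positivity exactly on the open box is the point: a vanishing integral of such a function
  against a measure makes the box a null set.\<close>

lemma box_bump:
  fixes c1 d1 c2 d2 :: real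
  obtains g :: "real \<times> real \<Rightarrow> real" where "test_function (\<lambda>p. complex_of_real (g p))" "\<And>p. g p \<ge> 0"
    "\<And>x \<xi>. g (x, \<xi>) > 0 \<longleftrightarrow> c1 < x \<and> x < d1 \<and> c2 < \<xi> \<and> \<xi> < d2"
proof
  let ?f = "flat 1"
  define g where "g = (\<lambda>p::real \<times> real. ?f (fst p - c1) * ?f (d1 - fst p) * ?f (snd p - c2) * ?f (d2 - snd p))"
  have f: "?f x \<ge> 0" "?f x > 0 \<longleftrightarrow> x > 0" for x by (auto simp: flat_def)
  show "g p \<ge> 0" for p by (simp add: g_def f)
  show pos: "g (x, \<xi>) > 0 \<longleftrightarrow> c1 < x \<and> x < d1 \<and> c2 < \<xi> \<and> \<xi> < d2" for x \<xi>
    using f(1)[of "x - c1"] f(1)[of "d1 - x"] f(1)[of "\<xi> - c2"] f(1)[of "d2 - \<xi>"]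
      f(2)[of "x - c1"] f(2)[of "d1 - x"] f(2)[of "\<xi> - c2"] f(2)[of "d2 - \<xi>"]
    by (auto simp: g_def zero_less_mult_iff not_less)
  show "test_function (\<lambda>p. complex_of_real (g p))" unfolding test_function_iff
  proof (intro conjI allI)
    fix k
    have "Ck k (\<lambda>p. complex_of_real (?f (1 * fst p + 0 * snd p + (- c1))) * of_real (?f ((-1) * fst p + 0 * snd p + d1)) *
       of_real (?f (0 * fst p + 1 * snd p + (- c2))) * of_real (?f (0 * fst p + (-1) * snd p + d2)))"
      by (intro Ck_mult Ck_flat_affine)
    then show "Ck k (\<lambda>p. complex_of_real (g p))" by (rule Ck_cong) (simp add: g_def)
    have "{p. complex_of_real (g p) \<noteq> 0} \<subseteq> {c1..d1} \<times> {c2..d2}"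
    proof
      fix p assume "p \<in> {p. complex_of_real (g p) \<noteq> 0}"
      then have "g p > 0" using \<open>\<And>p. g p \<ge> 0\<close>[of p] by simp
      then show "p \<in> {c1..d1} \<times> {c2..d2}" using pos[of "fst p" "snd p"] by (cases p) auto
    qed
    then show "bounded {p. complex_of_real (g p) \<noteq> 0}"
      using bounded_subset bounded_Times bounded_closed_interval by metis
  qed
qed

section \<open>Identification of the limit measure\<close>

lemma return_pair: "return borel q \<Otimes>\<^sub>M return borel p = (return borel (q, p) :: (real \<times> real) measure)"
proof (rule measure_eqI)
  show s: "sets (return borel q \<Otimes>\<^sub>M return borel p) = sets (return borel (q, p) :: (real \<times> real) measure)"
    by (simp add: borel_prod[symmetric] cong: sets_pair_measure_cong)
  fix A :: "(real \<times> real) set" assume "A \<in> sets (return borel q \<Otimes>\<^sub>M return borel p)"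
  then have A: "A \<in> sets (borel \<Otimes>\<^sub>M borel)" unfolding s by (simp only: sets_return borel_prod)
  interpret p: prob_space "return borel p" by (rule prob_space_return) simp
  have "emeasure (return borel q \<Otimes>\<^sub>M return borel p) A = (\<integral>\<^sup>+ x. emeasure (return borel p) (Pair x -` A) \<partial>return borel q)"
    by (rule p.emeasure_pair_measure_alt) (use A in \<open>simp cong: sets_pair_measure_cong\<close>)
  also have "\<dots> = (\<integral>\<^sup>+ x. indicator A (x, p) \<partial>return borel q)"
    by (intro nn_integral_cong) (use sets_Pair1[OF A] in \<open>auto simp: emeasure_return indicator_def\<close>)
  also have "\<dots> = indicator A (q, p)"
    using A by (intro nn_integral_return) auto
  finally show "emeasure (return borel q \<Otimes>\<^sub>M return borel p) A = emeasure (return borel (q, p)) A"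
    using A[unfolded borel_prod] by simp
qed

text \<open>Since the full family of pairings converges, every sequence tending to 0 gives the same
  limit functional: one sequence shows that the Dirac mass occurs, and any other candidate must
  integrate all test functions like it.\<close>

lemma wigner_measures_concentrates:
  assumes con: "concentrates \<Phi> q p"
  shows "wigner_measures \<Phi> = {return borel q \<Otimes>\<^sub>M return borel p}"
  unfolding return_pair
proof (intro equalityI subsetI)
  fix \<mu> :: "(real \<times> real) measure" assume "\<mu> \<in> {return borel (q, p)}"
  then have mu: "\<mu> = return borel (q, p)" by simp
  let ?e = "\<lambda>n. 1 / real (Suc n)"
  have e: "?e \<longlonglongrightarrow> 0" using LIMSEQ_Suc[OF lim_1_over_n] by simp
  have "(\<lambda>n. wigner_pairing (?e n) (\<Phi> (?e n)) a) \<longlonglongrightarrow> (LINT p|\<mu>. a p)" if "test_function a" for a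
  proof -
    have "continuous_on UNIV a" using that Ck.simps(1)[of a] unfolding test_function_def by blast
    then have "(LINT z|\<mu>. a z) = a (q, p)" unfolding mu
      by (intro integral_return) (auto intro: borel_measurable_continuous_onI)
    then show ?thesis using wigner_pairing_limit[OF con _ e that] by simp
  qed
  moreover have "emeasure \<mu> S < \<infinity>" for S unfolding mu
    using emeasure_space[of "return borel (q, p)" S] by (simp add: le_less_trans[OF _ ennreal_one_less_top] prob_space.emeasure_space_1 prob_space_return)
  ultimately show "\<mu> \<in> wigner_measures \<Phi>"
    unfolding wigner_measures_def using e by (auto simp: mu intro!: exI[of _ ?e])
next
  fix \<mu> :: "(real \<times> real) measure" assume "\<mu> \<in> wigner_measures \<Phi>"
  then obtain e where sets_mu: "sets \<mu> = sets borel" and fin: "\<And>S. compact S \<Longrightarrow> emeasure \<mu> S < \<infinity>"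
    and e: "\<And>n. e n > 0" "e \<longlonglongrightarrow> 0"
    and lim: "\<And>a. test_function a \<Longrightarrow> (\<lambda>n. wigner_pairing (e n) (\<Phi> (e n)) a) \<longlonglongrightarrow> (LINT z|\<mu>. a z)"
    unfolding wigner_measures_def by blast
  have val: "(LINT z|\<mu>. a z) = a (q, p)" if "test_function a" for a
    by (rule LIMSEQ_unique[OF lim[OF that] wigner_pairing_limit[OF con e that]])
  note [measurable_cong] = sets_mu
  \<comment> \<open>Integrability comes from finiteness on compact sets; without it the Bochner
    integral would be 0 by default and say nothing.\<close>
  have bump: "integrable \<mu> g \<and> (LINT z|\<mu>. g z) = g (q, p)"
    if "test_function (\<lambda>z. complex_of_real (g z))" for g :: "real \<times> real \<Rightarrow> real"
  proof
    have "continuous_on UNIV (\<lambda>z. complex_of_real (g z))"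
      using that Ck.simps(1) unfolding test_function_def by blast
    then have c: "continuous_on UNIV g" using continuous_on_Re by fastforce
    then have [measurable]: "g \<in> borel_measurable borel" by (rule borel_measurable_continuous_onI)
    let ?S = "Defs.supp (\<lambda>z. complex_of_real (g z))"
    have S: "compact ?S" using that by (simp add: test_function_def)
    then obtain b where b: "\<And>z. z \<in> ?S \<Longrightarrow> norm (g z) \<le> b"
      using compact_imp_bounded[OF compact_continuous_image[OF continuous_on_subset[OF c]]] bounded_iff
      by (metis UNIV_I image_eqI subsetI)
    have S'[measurable]: "?S \<in> sets borel" using S by (simp add: borel_compact)
    have "integrable \<mu> (\<lambda>z. b * indicator ?S z)"
      by (intro integrable_mult_right integrable_real_indicator) (use fin[OF S] S' sets_mu in auto)
    then show "integrable \<mu> g"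
    proof (rule Bochner_Integration.integrable_bound)
      show "AE z in \<mu>. norm (g z) \<le> norm (b * indicator ?S z)"
      proof (rule AE_I2)
        fix z show "norm (g z) \<le> norm (b * indicator ?S z)"
        proof (cases "z \<in> ?S")
          case True then show ?thesis using b[OF True] by simp
        next
          case False
          then have "g z = 0" using closure_subset[of "{z. complex_of_real (g z) \<noteq> 0}"] unfolding supp_def by auto
          then show ?thesis by simp
        qed
      qed
    qed measurable
    have "complex_of_real (LINT z|\<mu>. g z) = complex_of_real (g (q, p))"
      using val[OF that] by simp
    then show "(LINT z|\<mu>. g z) = g (q, p)" by (simp only: of_real_eq_iff)
  qed
  have null: "{c1<..<d1} \<times> {c2<..<d2} \<in> null_sets \<mu>" if "(q, p) \<notin> {c1<..<d1} \<times> {c2<..<d2}" for c1 c2 d1 d2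
  proof -
    obtain g where g: "test_function (\<lambda>z. complex_of_real (g z))" "\<And>z. g z \<ge> 0"
      "\<And>x \<xi>. g (x, \<xi>) > 0 \<longleftrightarrow> c1 < x \<and> x < d1 \<and> c2 < \<xi> \<and> \<xi> < d2" using box_bump by blast
    have bx: "z \<in> {c1<..<d1} \<times> {c2<..<d2} \<longleftrightarrow> g z > 0" for z
      using g(3)[of "fst z" "snd z"] by (cases z) auto
    have "\<not> g (q, p) > 0" using that bx by blast
    then have "g (q, p) = 0" using g(2)[of "(q, p)"] by linarith
    then have "AE z in \<mu>. g z = 0"
      using bump[OF g(1)] g(2) integral_nonneg_eq_0_iff_AE[of \<mu> g] by simp
    then have "AE z in \<mu>. z \<notin> {c1<..<d1} \<times> {c2<..<d2}" by (rule eventually_mono) (simp add: bx)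
    then show ?thesis using sets_mu
      by (subst AE_iff_null_sets) (auto intro!: borel_open open_Times)
  qed
  let ?z = "(q, p)"
  \<comment> \<open>The complement of the point is a countable union of open boxes that miss it:
    left, right, below and above, each clipped at size n.\<close>
  have compl: "- {?z} \<in> null_sets \<mu>"
  proof -
    let ?N = "\<lambda>n. {q - real n<..<q} \<times> {- real n<..<real n} \<union> {q<..<q + real n} \<times> {- real n<..<real n} \<union>
      {- real n<..<real n} \<times> {p - real n<..<p} \<union> {- real n<..<real n} \<times> {p<..<p + real n}"
    have N: "(\<Union>n. ?N n) \<in> null_sets \<mu>"
      by (intro null_sets_UN null_sets.Un null) auto
    have S: "- {?z} \<subseteq> (\<Union>n. ?N n)"
    proof
      fix z assume z: "z \<in> - {?z}"
      obtain x \<xi> where zx: "z = (x, \<xi>)" by (cases z)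
      obtain n where n: "\<bar>x\<bar> + \<bar>\<xi>\<bar> + \<bar>q\<bar> + \<bar>p\<bar> < real n" using reals_Archimedean2 by blast
      have b: "- real n < x" "x < real n" "- real n < \<xi>" "\<xi> < real n" "q - real n < x" "x < q + real n"
        "p - real n < \<xi>" "\<xi> < p + real n" using n by linarith+
      have "x \<noteq> q \<or> \<xi> \<noteq> p" using z zx by auto
      then consider "x < q" | "q < x" | "\<xi> < p" | "p < \<xi>" by linarith
      then have "z \<in> ?N n" unfolding zx by cases (simp_all add: b)
      then show "z \<in> (\<Union>n. ?N n)" by blast
    qed
    have "- {?z} \<in> sets \<mu>" unfolding sets_mu by (intro borel_open open_Compl closed_singleton)
    from null_sets_subset[OF N this S] show ?thesis .
  qed
  \<comment> \<open>With the complement null, the integral of a bump function positive at the point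
    is its value there times the mass of the point; comparison with the known integral fixes this
    mass.\<close>
  have one: "emeasure \<mu> {?z} = 1"
  proof -
    obtain g where g: "test_function (\<lambda>z. complex_of_real (g z))" "\<And>z. g z \<ge> 0"
      "\<And>x \<xi>. g (x, \<xi>) > 0 \<longleftrightarrow> q - 1 < x \<and> x < q + 1 \<and> p - 1 < \<xi> \<and> \<xi> < p + 1"
      by (rule box_bump[of "q - 1" "q + 1" "p - 1" "p + 1"]) (rule that)
    have g0: "g ?z > 0" by (simp add: g(3))
    have gm: "g \<in> borel_measurable \<mu>" using bump[OF g(1)] by blast
    have "AE z in \<mu>. z \<notin> - {?z}" by (rule AE_not_in[OF compl])
    then have "(LINT z|\<mu>. g z) = (LINT z|\<mu>. g ?z * indicator {?z} z)"
      using gm by (intro integral_cong_AE) (auto simp: indicator_def sets_mu)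
    also have "\<dots> = g ?z * measure \<mu> {?z}" using sets_mu sets_eq_imp_space_eq[OF sets_mu] by simp
    finally have "measure \<mu> {?z} = 1" using bump[OF g(1)] g0 by simp
    moreover have "emeasure \<mu> {?z} \<noteq> \<infinity>" using fin[of "{?z}"] by simp
    ultimately show ?thesis by (simp add: emeasure_eq_ennreal_measure)
  qed
  have "\<mu> = return borel ?z"
  proof (rule measure_eqI)
    show "sets \<mu> = sets (return borel ?z)" using sets_mu by simp
    fix A assume A: "A \<in> sets \<mu>"
    have n: "A - {?z} \<in> null_sets \<mu>" using A sets_mu by (intro null_sets_subset[OF compl]) auto
    show "emeasure \<mu> A = emeasure (return borel ?z) A"
    proof (cases "?z \<in> A")
      case True
      then have "emeasure \<mu> A = emeasure \<mu> ({?z} \<union> (A - {?z}))" by (simp add: insert_absorb)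
      also have "\<dots> = emeasure \<mu> {?z}" by (rule emeasure_Un_null_set[OF _ n]) (use sets_mu in auto)
      finally show ?thesis using True A sets_mu one by simp
    next
      case False
      then have "A \<in> null_sets \<mu>" using n by simp
      then show ?thesis using False A sets_mu by (simp add: null_sets_def)
    qed
  qed
  then show "\<mu> \<in> {return borel ?z}" by simp
qed

section \<open>Time reversal and parity\<close>

lemma schroedinger_op_C2c:
  assumes "is_C2c f f1 f2" shows "schroedinger_op \<epsilon> V f = schrop \<epsilon> V f f2"
proof -
  have "vector_derivative f (at x) = f1 x" "vector_derivative f1 (at x) = f2 x" for x
    using is_C2c_D(4,5)[OF assms] vector_derivative_at by blast+
  then show ?thesis by (simp add: schroedinger_op_def schrop_def fun_eq_iff)
qed

lemma L2_reflect:
  assumes "f \<in> L2" shows "(\<lambda>x. f (- x)) \<in> L2" "l2norm (\<lambda>x. f (- x)) = l2norm f"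
  using L2_affine[OF assms, of "-1" 0] by simp_all

lemma l2norm_cnj: "l2norm (\<lambda>x. cnj (f x)) = l2norm f"
  by (rule l2norm_cong_norm) simp

lemma test_function_cnj:
  assumes "test_function f" shows "test_function (\<lambda>x. cnj (f x))"
  using assms Ck_cnj by (auto simp: test_function_iff)

lemma test_function_reflect:
  fixes f :: "real \<Rightarrow> complex"
  assumes "test_function f" shows "test_function (\<lambda>x. f (- x))"
proof -
  have "{x. f (- x) \<noteq> 0} = uminus ` {x. f x \<noteq> 0}" by (auto simp: image_iff intro: exI[of _ "- _"]) (metis minus_minus)
  then have "bounded {x. f (- x) \<noteq> 0}" using assms by (simp add: test_function_iff)
  then show ?thesis using assms Ck_reflect by (auto simp: test_function_iff)
qed

lemma schrop_test_reflect:
  assumes "test_function f"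
  shows "schroedinger_op \<epsilon> absV (\<lambda>x. f (- x)) x = schroedinger_op \<epsilon> absV f (- x)"
proof -
  obtain f1 f2 where C: "is_C2c f f1 f2" and f2: "schroedinger_op \<epsilon> absV f = schrop \<epsilon> absV f f2"
    using test_function_C2c[OF assms] by metis
  have "is_C2c (\<lambda>x. f (- x)) (\<lambda>x. of_real (1 / (-1)) * f1 (- x)) (\<lambda>x. of_real (1 / (-1)\<^sup>2) * f2 (- x))"
    using is_C2c_scale[OF C, of "-1"] by simp
  from schroedinger_op_C2c[OF this, of \<epsilon> absV] show ?thesis unfolding f2 by (simp add: schrop_def)
qed

lemma schrop_test_cnj:
  assumes "test_function f"
  shows "schroedinger_op \<epsilon> V (\<lambda>x. cnj (f x)) x = cnj (schroedinger_op \<epsilon> V f x)"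
proof -
  obtain f1 f2 where C: "is_C2c f f1 f2" and f2: "schroedinger_op \<epsilon> V f = schrop \<epsilon> V f f2"
    using test_function_C2c[OF assms] by metis
  have "is_C2c (\<lambda>x. cnj (f x)) (\<lambda>x. cnj (f1 x)) (\<lambda>x. cnj (f2 x))"
    using is_C2c_D[OF C] unfolding is_C2c_def
    by (intro conjI allI has_vector_derivative_cnj Cc_cnj Cc_continuous)
  from schroedinger_op_C2c[OF this, of \<epsilon> V] show ?thesis unfolding f2 by (simp add: schrop_def)
qed

lemma hamiltonian_reflect:
  assumes "(u, v) \<in> hamiltonian \<epsilon> absV" shows "(\<lambda>x. u (- x), \<lambda>x. v (- x)) \<in> hamiltonian \<epsilon> absV"
proof -
  from assms obtain \<phi> where uv: "u \<in> L2" "v \<in> L2" and t: "\<And>n::nat. test_function (\<phi> n)"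
    and l: "(\<lambda>n. l2norm (\<lambda>x. \<phi> n x - u x)) \<longlonglongrightarrow> 0"
    "(\<lambda>n. l2norm (\<lambda>x. schroedinger_op \<epsilon> absV (\<phi> n) x - v x)) \<longlonglongrightarrow> 0"
    unfolding hamiltonian_def by blast
  have L: "\<phi> n \<in> L2" "schroedinger_op \<epsilon> absV (\<phi> n) \<in> L2" for n
  proof -
    obtain f1 f2 where C: "is_C2c (\<phi> n) f1 f2" and f2: "schroedinger_op \<epsilon> absV (\<phi> n) = schrop \<epsilon> absV (\<phi> n) f2"
      using test_function_C2c[OF t[of n]] by metis
    show "\<phi> n \<in> L2" by (rule Cc_L2[OF is_C2c_D(1)[OF C]])
    show "schroedinger_op \<epsilon> absV (\<phi> n) \<in> L2" unfolding f2 by (rule Cc_L2[OF schrop_Cc[OF C continuous_absV]])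
  qed
  show ?thesis unfolding hamiltonian_def
  proof (intro CollectI case_prodI conjI exI[of _ "\<lambda>n x. \<phi> n (- x)"] allI)
    show "(\<lambda>n. l2norm (\<lambda>x. \<phi> n (- x) - u (- x))) \<longlonglongrightarrow> 0"
      using l(1) L2_reflect(2)[OF L2_diff[OF L(1) uv(1)]] by simp
    show "(\<lambda>n. l2norm (\<lambda>x. schroedinger_op \<epsilon> absV (\<lambda>x. \<phi> n (- x)) x - v (- x))) \<longlonglongrightarrow> 0"
      unfolding schrop_test_reflect[OF t] using l(2) L2_reflect(2)[OF L2_diff[OF L(2) uv(2)]] by simp
  qed (use uv L2_reflect(1) t test_function_reflect in auto)
qed

lemma hamiltonian_cnj:
  assumes "(u, v) \<in> hamiltonian \<epsilon> V" shows "(\<lambda>x. cnj (u x), \<lambda>x. cnj (v x)) \<in> hamiltonian \<epsilon> V"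
proof -
  from assms obtain \<phi> where uv: "u \<in> L2" "v \<in> L2" and t: "\<And>n::nat. test_function (\<phi> n)"
    and l: "(\<lambda>n. l2norm (\<lambda>x. \<phi> n x - u x)) \<longlonglongrightarrow> 0"
    "(\<lambda>n. l2norm (\<lambda>x. schroedinger_op \<epsilon> V (\<phi> n) x - v x)) \<longlonglongrightarrow> 0"
    unfolding hamiltonian_def by blast
  show ?thesis unfolding hamiltonian_def
  proof (intro CollectI case_prodI conjI exI[of _ "\<lambda>n x. cnj (\<phi> n x)"] allI)
    show "(\<lambda>n. l2norm (\<lambda>x. cnj (\<phi> n x) - cnj (u x))) \<longlonglongrightarrow> 0"
      using l(1) l2norm_cnj[of "\<lambda>x. \<phi> _ x - u x"] by simp
    show "(\<lambda>n. l2norm (\<lambda>x. schroedinger_op \<epsilon> V (\<lambda>x. cnj (\<phi> n x)) x - cnj (v x))) \<longlonglongrightarrow> 0"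
      unfolding schrop_test_cnj[OF t] using l(2) l2norm_cnj[of "\<lambda>x. schroedinger_op \<epsilon> V (\<phi> _) x - v x"] by simp
  qed (use uv L2_cnj t test_function_cnj in auto)
qed

text \<open>Parity: the potential is even and the kinetic term is of second order.\<close>

lemma solution_reflect:
  assumes sol: "schroedinger_solution \<epsilon> absV \<psi>\<^sub>0 \<psi>" and m: "\<psi>\<^sub>0 \<in> borel_measurable borel"
  shows "schroedinger_solution \<epsilon> absV (\<lambda>x. \<psi>\<^sub>0 (- x)) (\<lambda>t x. \<psi> t (- x))"
proof -
  have AE: "AE x in lborel. \<psi> 0 x = \<psi>\<^sub>0 x" using sol by (simp add: schroedinger_solution_def)
  obtain \<psi>' where p: "\<forall>t. \<psi> t \<in> L2 \<and> \<psi>' t \<in> L2 \<and>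
      ((\<lambda>h. l2norm (\<lambda>x. (\<psi> (t + h) x - \<psi> t x) / of_real h - \<psi>' t x)) \<longlongrightarrow> 0) (at 0) \<and>
      (\<psi> t, \<lambda>x. \<i> * of_real \<epsilon> * \<psi>' t x) \<in> hamiltonian \<epsilon> absV"
    using sol unfolding schroedinger_solution_def by (elim conjE exE)
  have L: "\<And>t. \<psi> t \<in> L2" "\<And>t. \<psi>' t \<in> L2" using p by auto
  show ?thesis unfolding schroedinger_solution_def
  proof (intro conjI exI[of _ "\<lambda>t x. \<psi>' t (- x)"] allI)
    note [measurable] = m L2_D(1)[OF L(1)]
    have "AE x in distr lborel borel uminus. \<psi> 0 x = \<psi>\<^sub>0 x" unfolding lborel_distr_uminus by (rule AE)
    then show "AE x in lborel. \<psi> 0 (- x) = \<psi>\<^sub>0 (- x)"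
      by (subst (asm) AE_distr_iff) auto
    fix t
    show "(\<lambda>x. \<psi> t (- x)) \<in> L2" "(\<lambda>x. \<psi>' t (- x)) \<in> L2" using L L2_reflect(1) by auto
    show "((\<lambda>h. l2norm (\<lambda>x. (\<psi> (t + h) (- x) - \<psi> t (- x)) / of_real h - \<psi>' t (- x))) \<longlongrightarrow> 0) (at 0)"
      using p L2_reflect(2)[OF L2_diff[OF l2_deriv_quotient_L2[of \<psi>, OF L(1)] L(2)]] by simp
    show "(\<lambda>x. \<psi> t (- x), \<lambda>x. \<i> * of_real \<epsilon> * \<psi>' t (- x)) \<in> hamiltonian \<epsilon> absV"
      using hamiltonian_reflect p by blast
  qed
qed

text \<open>Time reversal: the operator is real, so conjugation changes only the sign of i, and t ->
  -t restores it.\<close>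

lemma solution_reverse:
  assumes sol: "schroedinger_solution \<epsilon> V \<psi>\<^sub>0 \<psi>"
  shows "schroedinger_solution \<epsilon> V (\<lambda>x. cnj (\<psi>\<^sub>0 x)) (\<lambda>t x. cnj (\<psi> (- t) x))"
proof -
  have AE: "AE x in lborel. \<psi> 0 x = \<psi>\<^sub>0 x" using sol by (simp add: schroedinger_solution_def)
  obtain \<psi>' where p: "\<forall>t. \<psi> t \<in> L2 \<and> \<psi>' t \<in> L2 \<and>
      ((\<lambda>h. l2norm (\<lambda>x. (\<psi> (t + h) x - \<psi> t x) / of_real h - \<psi>' t x)) \<longlongrightarrow> 0) (at 0) \<and>
      (\<psi> t, \<lambda>x. \<i> * of_real \<epsilon> * \<psi>' t x) \<in> hamiltonian \<epsilon> V"
    using sol unfolding schroedinger_solution_def by (elim conjE exE)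
  have L: "\<And>t. \<psi> t \<in> L2" "\<And>t. \<psi>' t \<in> L2" using p by auto
  show ?thesis unfolding schroedinger_solution_def
  proof (intro conjI exI[of _ "\<lambda>t x. - cnj (\<psi>' (- t) x)"] allI)
    show "AE x in lborel. cnj (\<psi> (- 0) x) = cnj (\<psi>\<^sub>0 x)" using AE by eventually_elim simp
    fix t
    show "(\<lambda>x. cnj (\<psi> (- t) x)) \<in> L2" using L(1) L2_cnj by blast
    show "(\<lambda>x. - cnj (\<psi>' (- t) x)) \<in> L2" using L2_cmult[OF L2_cnj[OF L(2)], of "-1"] by simp
    have n: "filterlim (\<lambda>h::real. - h) (at 0) (at 0)"
      using filterlim_at[of "\<lambda>h::real. - h" 0 UNIV "at 0"]
      by (auto simp: eventually_at_filter intro!: tendsto_eq_intros)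
    have "((\<lambda>h. l2norm (\<lambda>x. (\<psi> (- t + - h) x - \<psi> (- t) x) / of_real (- h) - \<psi>' (- t) x)) \<longlongrightarrow> 0) (at 0)"
      using filterlim_compose[OF p[rule_format, THEN conjunct2, THEN conjunct2, THEN conjunct1] n, of "- t"] .
    moreover have "l2norm (\<lambda>x. (\<psi> (- t + - h) x - \<psi> (- t) x) / of_real (- h) - \<psi>' (- t) x) =
       l2norm (\<lambda>x. (cnj (\<psi> (- (t + h)) x) - cnj (\<psi> (- t) x)) / of_real h - - cnj (\<psi>' (- t) x))" for h
    proof (rule l2norm_cong_norm)
      fix x
      have "(cnj (\<psi> (- (t + h)) x) - cnj (\<psi> (- t) x)) / of_real h - - cnj (\<psi>' (- t) x) =
        - cnj ((\<psi> (- t + - h) x - \<psi> (- t) x) / of_real (- h) - \<psi>' (- t) x)" by simp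
      then show "norm ((\<psi> (- t + - h) x - \<psi> (- t) x) / of_real (- h) - \<psi>' (- t) x) =
        norm ((cnj (\<psi> (- (t + h)) x) - cnj (\<psi> (- t) x)) / of_real h - - cnj (\<psi>' (- t) x))"
        by (simp only: norm_minus_cancel complex_mod_cnj)
    qed
    ultimately show "((\<lambda>h. l2norm (\<lambda>x. (cnj (\<psi> (- (t + h)) x) - cnj (\<psi> (- t) x)) / of_real h - - cnj (\<psi>' (- t) x))) \<longlongrightarrow> 0) (at 0)"
      by simp
    have "(\<psi> (- t), \<lambda>x. \<i> * of_real \<epsilon> * \<psi>' (- t) x) \<in> hamiltonian \<epsilon> V" using p by blast
    from hamiltonian_cnj[OF this] show "(\<lambda>x. cnj (\<psi> (- t) x), \<lambda>x. \<i> * of_real \<epsilon> * - cnj (\<psi>' (- t) x)) \<in> hamiltonian \<epsilon> V"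
      by simp
  qed
qed

lemma concentrates_cnj:
  assumes "concentrates (\<lambda>\<epsilon> x. cnj (\<Phi> \<epsilon> x)) q p" shows "concentrates \<Phi> q (- p)"
proof -
  have L: "\<Phi> \<epsilon> \<in> L2" "l2norm (\<Phi> \<epsilon>) = 1" if "\<epsilon> > 0" for \<epsilon>
    using assms that L2_cnj[of "\<lambda>x. cnj (\<Phi> \<epsilon> x)"] l2norm_cnj[of "\<Phi> \<epsilon>"] by (auto simp: concentrates_def)
  have 1: "l2norm (\<lambda>x. exp (\<i> * of_real (- p * v)) * \<Phi> \<epsilon> (x - \<epsilon> * v) - \<Phi> \<epsilon> x) =
      l2norm (\<lambda>x. exp (\<i> * of_real (p * v)) * cnj (\<Phi> \<epsilon> (x - \<epsilon> * v)) - cnj (\<Phi> \<epsilon> x))" for v \<epsilon>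
    by (subst l2norm_cnj[symmetric]) (simp add: exp_cnj)
  have 2: "l2norm (\<lambda>x. indicator S x * cnj (\<Phi> \<epsilon> x)) = l2norm (\<lambda>x. indicator S x * \<Phi> \<epsilon> x)" for S \<epsilon>
    by (rule l2norm_cong_norm) (simp add: norm_mult)
  show ?thesis using assms L unfolding concentrates_def 1 2 by blast
qed

text \<open>Reflection turns the translation by \<epsilon> v into its inverse. Translating the whole
  difference back and extracting a phase of modulus 1 returns to v \<ge> 0 with the momentum
  negated.\<close>

lemma concentrates_reflect:
  assumes con: "concentrates (\<lambda>\<epsilon> x. \<Phi> \<epsilon> (- x)) q p" shows "concentrates \<Phi> (- q) (- p)"
  unfolding concentrates_def
proof (intro conjI allI impI)
  have L': "(\<lambda>x. \<Phi> \<epsilon> (- x)) \<in> L2" "l2norm (\<lambda>x. \<Phi> \<epsilon> (- x)) = 1" if "\<epsilon> > 0" for \<epsilon>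
    using con that by (auto simp: concentrates_def)
  show L: "\<Phi> \<epsilon> \<in> L2" and "l2norm (\<Phi> \<epsilon>) = 1" if "\<epsilon> > 0" for \<epsilon>
    using L2_reflect[OF L'(1)[OF that]] L'(2)[OF that] by simp_all
  have pos: "\<forall>\<^sub>F \<epsilon>::real in at_right 0. \<epsilon> > 0" by (rule eventually_at_right_less)
  show "((\<lambda>\<epsilon>. l2norm (\<lambda>x. exp (\<i> * of_real (- p * v)) * \<Phi> \<epsilon> (x - \<epsilon> * v) - \<Phi> \<epsilon> x)) \<longlongrightarrow> 0) (at_right 0)"
    if v: "v \<ge> 0" for v
  proof (rule Lim_transform_eventually)
    show "((\<lambda>\<epsilon>. l2norm (\<lambda>x. exp (\<i> * of_real (p * v)) * \<Phi> \<epsilon> (- (x - \<epsilon> * v)) - \<Phi> \<epsilon> (- x))) \<longlongrightarrow> 0) (at_right 0)"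
      using con v by (simp add: concentrates_def)
    show "\<forall>\<^sub>F \<epsilon> in at_right 0. l2norm (\<lambda>x. exp (\<i> * of_real (p * v)) * \<Phi> \<epsilon> (- (x - \<epsilon> * v)) - \<Phi> \<epsilon> (- x)) =
       l2norm (\<lambda>x. exp (\<i> * of_real (- p * v)) * \<Phi> \<epsilon> (x - \<epsilon> * v) - \<Phi> \<epsilon> x)"
      using pos
    proof eventually_elim
      case (elim \<epsilon>)
      let ?g = "\<lambda>x. exp (\<i> * of_real (p * v)) * \<Phi> \<epsilon> x - \<Phi> \<epsilon> (x - \<epsilon> * v)"
      have g: "?g \<in> L2" by (intro L2_diff L2_cmult L2_translate L elim)
      have "l2norm (\<lambda>x. exp (\<i> * of_real (p * v)) * \<Phi> \<epsilon> (- (x - \<epsilon> * v)) - \<Phi> \<epsilon> (- x)) = l2norm (\<lambda>x. ?g (- (x - \<epsilon> * v)))"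
        by (simp add: algebra_simps)
      also have "\<dots> = l2norm ?g"
        using l2norm_translate[of "\<lambda>x. ?g (- x)" "\<epsilon> * v"] L2_reflect(2)[OF g] by simp
      also have "\<dots> = l2norm (\<lambda>x. exp (\<i> * of_real (- p * v)) * \<Phi> \<epsilon> (x - \<epsilon> * v) - \<Phi> \<epsilon> x)"
      proof (rule l2norm_cong_norm)
        fix x
        have e: "exp (\<i> * of_real (p * v)) * exp (\<i> * of_real (- p * v)) = 1"
          unfolding exp_add[symmetric] by simp
        have "?g x = - (exp (\<i> * of_real (p * v)) * (exp (\<i> * of_real (- p * v)) * \<Phi> \<epsilon> (x - \<epsilon> * v) - \<Phi> \<epsilon> x))"
          unfolding right_diff_distrib mult.assoc[symmetric] e by simp
        then show "norm (?g x) = norm (exp (\<i> * of_real (- p * v)) * \<Phi> \<epsilon> (x - \<epsilon> * v) - \<Phi> \<epsilon> x)"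
          by (simp only: norm_minus_cancel norm_mult norm_exp_i_times mult_1)
      qed
      finally show ?case .
    qed
  qed
  show "((\<lambda>\<epsilon>. l2norm (\<lambda>x. indicator {x. \<eta> \<le> \<bar>x - - q\<bar>} x * \<Phi> \<epsilon> x)) \<longlongrightarrow> 0) (at_right 0)" if \<eta>: "\<eta> > 0" for \<eta>
  proof (rule Lim_transform_eventually)
    show "((\<lambda>\<epsilon>. l2norm (\<lambda>x. indicator {x. \<eta> \<le> \<bar>x - q\<bar>} x * \<Phi> \<epsilon> (- x))) \<longlongrightarrow> 0) (at_right 0)"
      using con \<eta> by (simp add: concentrates_def)
    show "\<forall>\<^sub>F \<epsilon> in at_right 0. l2norm (\<lambda>x. indicator {x. \<eta> \<le> \<bar>x - q\<bar>} x * \<Phi> \<epsilon> (- x)) =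
       l2norm (\<lambda>x. indicator {x. \<eta> \<le> \<bar>x - - q\<bar>} x * \<Phi> \<epsilon> x)"
      using pos
    proof eventually_elim
      case (elim \<epsilon>)
      have "(\<lambda>x. indicator {x. \<eta> \<le> \<bar>x - - q\<bar>} x * \<Phi> \<epsilon> x) \<in> L2"
        by (rule L2_mult_bounded(1)[where C = 1]) (auto intro: L elim simp: indicator_def)
      from L2_reflect(2)[OF this]
      have "l2norm (\<lambda>x. indicator {x. \<eta> \<le> \<bar>x - - q\<bar>} (- x) * \<Phi> \<epsilon> (- x)) = l2norm (\<lambda>x. indicator {x. \<eta> \<le> \<bar>x - - q\<bar>} x * \<Phi> \<epsilon> x)" .
      moreover have "indicator {x. \<eta> \<le> \<bar>x - - q\<bar>} (- x) = (indicator {x. \<eta> \<le> \<bar>x - q\<bar>} x :: complex)" for x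
        by (simp add: indicator_def abs_minus_commute)
      ultimately show ?case by simp
    qed
  qed
qed

theorem theorem1p12:
  fixes V :: "real \<Rightarrow> real"
    and \<beta> :: real
    and \<Psi>1 \<Psi>2 :: "real \<Rightarrow> complex"
    and \<psi>1 \<psi>2 :: "real \<Rightarrow> real \<Rightarrow> real \<Rightarrow> complex"
  assumes V: "V = (\<lambda>x. - \<bar>x\<bar>)"
    and beta: "0 < \<beta>" "\<beta> < 1 / 10"
    and test: "test_function \<Psi>1" "test_function \<Psi>2"
    and norm: "l2norm \<Psi>1 = 1" "l2norm \<Psi>2 = 1"
    and supp: "supp \<Psi>1 \<subseteq> {x. x > 0}"
    and sol1: "\<And>\<epsilon>. \<epsilon> > 0 \<Longrightarrow> schroedinger_solution \<epsilon> V
        (\<lambda>x. of_real (1 / \<epsilon> powr (1 / 4)) * \<Psi>1 (x / sqrt \<epsilon>)) (\<psi>1 \<epsilon>)"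
    and sol2: "\<And>\<epsilon>. \<epsilon> > 0 \<Longrightarrow> schroedinger_solution \<epsilon> V
        (\<lambda>x. of_real (1 / \<epsilon> powr (1 / 4)) * \<Psi>2 (x / sqrt \<epsilon>)
               * exp (- \<i> * of_real (\<epsilon> powr (\<beta> - 1) * x))) (\<psi>2 \<epsilon>)"
  shows "(\<forall>t\<le>0.
            wigner_measures (\<lambda>\<epsilon>. \<psi>1 \<epsilon> t) = {return borel (t\<^sup>2 / 2) \<Otimes>\<^sub>M return borel t} \<and>
            wigner_measures (\<lambda>\<epsilon>. \<psi>2 \<epsilon> t) = {return borel (t\<^sup>2 / 2) \<Otimes>\<^sub>M return borel t}) \<and>
         (\<forall>t>0.
            wigner_measures (\<lambda>\<epsilon>. \<psi>1 \<epsilon> t) = {return borel (t\<^sup>2 / 2) \<Otimes>\<^sub>M return borel t} \<and>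
            wigner_measures (\<lambda>\<epsilon>. \<psi>2 \<epsilon> t) = {return borel (- t\<^sup>2 / 2) \<Otimes>\<^sub>M return borel (- t)})"
proof -
  define b where "b = (\<lambda>\<epsilon>. \<epsilon> powr \<beta>)"
  have neg: "\<Psi>1 x = 0" if "x < 0" for x
    using closure_subset[of "{x. \<Psi>1 x \<noteq> 0}"] supp that unfolding supp_def by force
  \<comment> \<open>The profile is differentiated four times: twice by the correction in the
    short-time ansatz and twice more by its residual.\<close>
  have rest: "concentrates (\<lambda>\<epsilon>. \<psi> \<epsilon> T) (T\<^sup>2 / 2) T"
    if f: "test_function f" "l2norm f = 1" "\<And>x. x < 0 \<Longrightarrow> f x = 0"
      and sol: "\<And>\<epsilon>. \<epsilon> > 0 \<Longrightarrow> schroedinger_solution \<epsilon> absV (packet \<epsilon> 0 f) (\<psi> \<epsilon>)" and T: "T \<ge> 0" for f \<psi> T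
  proof -
    obtain f1 f2 where a: "is_C2c f f1 f2" "test_function f2" using test_function_C2c[OF f(1)] by metis
    obtain f3 f4 where b: "is_C2c f2 f3 f4" using test_function_C2c[OF a(2)] by metis
    show ?thesis by (rule concentrates_rest[OF a(1) b f(2,3) sol T])
  qed
  have moving: "concentrates (\<lambda>\<epsilon>. \<psi> \<epsilon> T) (T\<^sup>2 / 2) T"
    if f: "test_function f" "l2norm f = 1"
      and sol: "\<And>\<epsilon>. \<epsilon> > 0 \<Longrightarrow> schroedinger_solution \<epsilon> absV (packet \<epsilon> (\<epsilon> powr \<beta>) f) (\<psi> \<epsilon>)" and T: "T \<ge> 0" for f \<psi> T
  proof -
    obtain f1 f2 where a: "is_C2c f f1 f2" using test_function_C2c[OF f(1)] by metis
    show ?thesis by (rule concentrates_momentum[OF a f(2) beta sol T])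
  qed
  let ?g1 = "\<lambda>\<epsilon> x. of_real (1 / \<epsilon> powr (1 / 4)) * \<Psi>1 (x / sqrt \<epsilon>)"
  let ?g2 = "\<lambda>\<epsilon> x. of_real (1 / \<epsilon> powr (1 / 4)) * \<Psi>2 (x / sqrt \<epsilon>) * exp (- \<i> * of_real (\<epsilon> powr (\<beta> - 1) * x))"
  have g1: "?g1 \<epsilon> = packet \<epsilon> 0 \<Psi>1" "(\<lambda>x. cnj (?g1 \<epsilon> x)) = packet \<epsilon> 0 (\<lambda>x. cnj (\<Psi>1 x))" for \<epsilon>
    by (simp_all add: packet_def rescale_def character_def fun_eq_iff)
  have ph: "\<epsilon> powr (\<beta> - 1) = \<epsilon> powr \<beta> / \<epsilon>" if "\<epsilon> > 0" for \<epsilon> using that by (simp add: powr_diff)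
  \<comment> \<open>The data have momentum -\<epsilon> powr \<beta>; conjugation and reflection each
    change its sign.\<close>
  have g2: "(\<lambda>x. cnj (?g2 \<epsilon> x)) = packet \<epsilon> (\<epsilon> powr \<beta>) (\<lambda>x. cnj (\<Psi>2 x))"
    "(\<lambda>x. ?g2 \<epsilon> (- x)) = packet \<epsilon> (\<epsilon> powr \<beta>) (\<lambda>x. \<Psi>2 (- x))" if "\<epsilon> > 0" for \<epsilon>
    using that by (simp_all add: packet_def rescale_def character_def fun_eq_iff ph exp_cnj mult_ac)
  have m2: "?g2 \<epsilon> \<in> borel_measurable borel" for \<epsilon>
    using Cc_measurable[OF test_function_derivative(3)[OF test(2)]] by measurable
  have L2: "\<Psi>2 \<in> L2" by (rule Cc_L2[OF test_function_derivative(3)[OF test(2)]])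
  note s1 = sol1[unfolded V] and s2 = sol2[unfolded V]
  \<comment> \<open>Conjugation preserves the support on x > 0, so the packet without momentum
    leaves to the right in both directions of time.\<close>
  have 1: "concentrates (\<lambda>\<epsilon>. \<psi>1 \<epsilon> t) (t\<^sup>2 / 2) t" for t
  proof (cases "t \<ge> 0")
    case True
    show ?thesis by (rule rest[OF test(1) norm(1) neg _ True]) (use s1 g1(1) in auto)
  next
    case False
    have "concentrates (\<lambda>\<epsilon> x. cnj (\<psi>1 \<epsilon> (- (- t)) x)) ((- t)\<^sup>2 / 2) (- t)"
    proof (rule rest[OF test_function_cnj[OF test(1)], where \<psi> = "\<lambda>\<epsilon> t x. cnj (\<psi>1 \<epsilon> (- t) x)"])
      show "schroedinger_solution \<epsilon> absV (packet \<epsilon> 0 (\<lambda>x. cnj (\<Psi>1 x))) (\<lambda>t x. cnj (\<psi>1 \<epsilon> (- t) x))" if "\<epsilon> > 0" for \<epsilon>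
        using solution_reverse[OF s1[OF that]] unfolding g1(2) .
    qed (use False norm neg in \<open>auto simp: l2norm_cnj\<close>)
    from concentrates_cnj[OF this] show ?thesis by simp
  qed
  \<comment> \<open>Backwards in time the second packet moves to the right, away from the
    singularity; conjugation makes this a forward motion with initial momentum \<epsilon> powr
    \<beta>.\<close>
  have 2: "concentrates (\<lambda>\<epsilon>. \<psi>2 \<epsilon> t) (t\<^sup>2 / 2) t" if t: "t \<le> 0" for t
  proof -
    have "concentrates (\<lambda>\<epsilon> x. cnj (\<psi>2 \<epsilon> (- (- t)) x)) ((- t)\<^sup>2 / 2) (- t)"
    proof (rule moving[OF test_function_cnj[OF test(2)], where \<psi> = "\<lambda>\<epsilon> t x. cnj (\<psi>2 \<epsilon> (- t) x)"])
      show "schroedinger_solution \<epsilon> absV (packet \<epsilon> (\<epsilon> powr \<beta>) (\<lambda>x. cnj (\<Psi>2 x))) (\<lambda>t x. cnj (\<psi>2 \<epsilon> (- t) x))" if "\<epsilon> > 0" for \<epsilon>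
        using solution_reverse[OF s2[OF that]] unfolding g2(1)[OF that] .
    qed (use t norm in \<open>auto simp: l2norm_cnj\<close>)
    from concentrates_cnj[OF this] show ?thesis by simp
  qed
  \<comment> \<open>Forwards in time the second packet leaves to the left; reflection moves it to
    the half-line where the potential is -x.\<close>
  have 3: "concentrates (\<lambda>\<epsilon>. \<psi>2 \<epsilon> t) (- t\<^sup>2 / 2) (- t)" if t: "t > 0" for t
  proof -
    have "concentrates (\<lambda>\<epsilon> x. \<psi>2 \<epsilon> t (- x)) (t\<^sup>2 / 2) t"
    proof (rule moving[OF test_function_reflect[OF test(2)], where \<psi> = "\<lambda>\<epsilon> t x. \<psi>2 \<epsilon> t (- x)"])
      show "schroedinger_solution \<epsilon> absV (packet \<epsilon> (\<epsilon> powr \<beta>) (\<lambda>x. \<Psi>2 (- x))) (\<lambda>t x. \<psi>2 \<epsilon> t (- x))" if "\<epsilon> > 0" for \<epsilon>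
        using solution_reflect[OF s2[OF that] m2] unfolding g2(2)[OF that] .
    qed (use t norm L2_reflect(2)[OF L2] in auto)
    from concentrates_reflect[OF this] show ?thesis by simp
  qed
  show ?thesis
    using 1 2 3 wigner_measures_concentrates by blast
qed

end
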